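(* Let $d\ge1$, let $I_1,\dots,I_d\subset\mathbb R$ be open intervals (bounded or unbounded), $\mathbf I=I_1\times\dots\times I_d$, and let $\mathbf n=(n_1,\dots,n_d)\in\mathbb N^d$ be such that $n_i\ge2$ for $i=1,\dots,d$. Let $f\colon\mathbf I\to\mathbb R$ be a function. Then $f$ is box-$\mathbf n$-convex if and only if for every $\boldsymbol\alpha=(\alpha_1,\dots,\alpha_d)\in\mathbf I$ there exist a pseudo-polynomial $W_{\boldsymbol\alpha}\colon\mathbf I\to\mathbb R$ of degree $(n_1-1,\dots,n_d-1)$ and a Borel measure $\mu$ on $\mathbf I$, which is finite on compact sets, such that for all $(x_1,\dots,x_d)\in\mathbf I$ $$f(x_1,\dots,x_d)=W_{\boldsymbol\alpha}(x_1,\dots,x_d)+\sum_{A\subset\{1,\dots,d\}}\int_{\mathbf I_{A,\boldsymbol\alpha}}\prod_{j\in A'}\frac{(x_j-u_j)_+^{n_j-1}}{(n_j-1)!}\prod_{j\in A}(-1)^{n_j}\frac{(x_j-u_j)_-^{n_j-1}}{(n_j-1)!}\,d\mu(u_1,\dots,u_d),$$ where $A'=\{1,\dots,d\}\setminus A$ and $\mathbf I_{A,\boldsymbol\alpha}=\{(u_1,\dots,u_d)\in\mathbf I: u_j\le\alpha_j\text{ if }j\in A\text{ and }u_j>\alpha_j\text{ if }j\in A'\}$.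
   Context: $\mathbb N=\{0,1,2,\dots\}$; $x_+=\max\{0,x\}$, $x_-=\max\{0,-x\}$, and $(x-u)_\pm^{m}=((x-u)_\pm)^m$; Borel measures are nonnegative. Divided differences: for a real function $g$ of one variable and pairwise distinct points, $[x_0;g]=g(x_0)$ and $[x_0,\dots,x_n;g]=\dfrac{[x_1,\dots,x_n;g]-[x_0,\dots,x_{n-1};g]}{x_n-x_0}$ for $n\ge1$. Multiple divided differences: for $f\colon\mathbf I\to\mathbb R$, $\mathbf n\in\mathbb N^d$, and vectors $\mathbf x_i=(x_{i0},\dots,x_{in_i})\in I_i^{n_i+1}$ with pairwise distinct coordinates ($i=1,\dots,d$), $[\mathbf x_1;\dots;\mathbf x_d;f]$ is defined by induction on $d$: for $d=1$ it is $[x_{10},\dots,x_{1n_1};f]$; for $d>1$ it is $[x_{d0},\dots,x_{dn_d};g]$, where $g(x)=[\mathbf x_1;\dots;\mathbf x_{d-1};f(\cdot,\dots,\cdot,x)]$ for $x\in I_d$. $f$ is box-$\mathbf n$-convex if $[\mathbf x_1;\dots;\mathbf x_d;f]\ge0$ for all such $\mathbf x_1,\dots,\mathbf x_d$. A pseudo-polynomial of degree $(m_1,\dots,m_d)$ is a function $W(x_1,\dots,x_d)=\sum_{i=1}^d\sum_{k=0}^{m_i}A_{ik}(x_1,\dots,x_{i-1},x_{i+1},\dots,x_d)\,x_i^k$, where $A_{ik}\colon\prod_{j\ne i}I_j\to\mathbb R$ are arbitrary functions (constants if $d=1$). *)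

theory Defs
  imports "HOL-Analysis.Analysis"
begin

(* Points of I_1 x ... x I_d are represented as the elements of Pi\<^sub>E {1..d} I, i.e. functions
   nat => real that are fixed to the value undefined outside {1..d}; a function on the box is a map
   (nat => real) => real of which only the values on Pi\<^sub>E {1..d} I matter. *)

(* [x_0, ..., x_n; g] *)
primrec divided_diff :: "nat \<Rightarrow> (nat \<Rightarrow> real) \<Rightarrow> (real \<Rightarrow> real) \<Rightarrow> real" where
  "divided_diff 0 x g = g (x 0)"
| "divided_diff (Suc n) x g =
     (divided_diff n (\<lambda>k. x (Suc k)) g - divided_diff n x g) / (x (Suc n) - x 0)"

(* x i k is the k-th coordinate of the vector of nodes for the i-th variable. The recursion starts
   from the single point of the empty product, so that for one variable the value is
   divided_diff (n 1) (x 1) (\<lambda>t. f (t)). *)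
primrec multi_divided_diff ::
  "nat \<Rightarrow> (nat \<Rightarrow> nat) \<Rightarrow> (nat \<Rightarrow> nat \<Rightarrow> real) \<Rightarrow> ((nat \<Rightarrow> real) \<Rightarrow> real) \<Rightarrow> real" where
  "multi_divided_diff 0 n x f = f (\<lambda>_. undefined)"
| "multi_divided_diff (Suc d) n x f =
     divided_diff (n (Suc d)) (x (Suc d))
       (\<lambda>t. multi_divided_diff d n x (\<lambda>y. f (y(Suc d := t))))"

definition box_convex ::
  "nat \<Rightarrow> (nat \<Rightarrow> real set) \<Rightarrow> (nat \<Rightarrow> nat) \<Rightarrow> ((nat \<Rightarrow> real) \<Rightarrow> real) \<Rightarrow> bool" where
  "box_convex d I n f \<longleftrightarrow>
     (\<forall>x. (\<forall>i\<in>{1..d}. (\<forall>k\<le>n i. x i k \<in> I i) \<and> inj_on (x i) {..n i})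
        \<longrightarrow> multi_divided_diff d n x f \<ge> 0)"

(* Restricting x to {1..d} - {i} drops the i-th coordinate; for d = 1 the coefficients
   are evaluated at a single point only, hence are constants. *)
definition pseudo_polynomial ::
  "nat \<Rightarrow> (nat \<Rightarrow> real set) \<Rightarrow> (nat \<Rightarrow> nat) \<Rightarrow> ((nat \<Rightarrow> real) \<Rightarrow> real) \<Rightarrow> bool" where
  "pseudo_polynomial d I m W \<longleftrightarrow>
     (\<exists>A :: nat \<Rightarrow> nat \<Rightarrow> (nat \<Rightarrow> real) \<Rightarrow> real. \<forall>x\<in>Pi\<^sub>E {1..d} I.
        W x = (\<Sum>i=1..d. \<Sum>k=0..m i. A i k (restrict x ({1..d} - {i})) * x i ^ k))"

(* The topology that Pi\<^sub>E {1..d} I inherits from the product topology on nat => real is the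
   Euclidean one, since the coordinates outside {1..d} are constant; thus borel and compact
   refer to the usual Borel and compact subsets of the box. *)
definition locally_finite_borel_measure ::
  "nat \<Rightarrow> (nat \<Rightarrow> real set) \<Rightarrow> (nat \<Rightarrow> real) measure \<Rightarrow> bool" where
  "locally_finite_borel_measure d I \<mu> \<longleftrightarrow>
     sets \<mu> = sets (restrict_space borel (Pi\<^sub>E {1..d} I)) \<and>
     (\<forall>K. K \<subseteq> Pi\<^sub>E {1..d} I \<and> compact K \<longrightarrow> emeasure \<mu> K < \<infinity>)"

definition box_part ::
  "nat \<Rightarrow> (nat \<Rightarrow> real set) \<Rightarrow> nat set \<Rightarrow> (nat \<Rightarrow> real) \<Rightarrow> (nat \<Rightarrow> real) set" where
  "box_part d I A \<alpha> =
     {u \<in> Pi\<^sub>E {1..d} I. (\<forall>j\<in>A. u j \<le> \<alpha> j) \<and> (\<forall>j\<in>{1..d} - A. u j > \<alpha> j)}"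

definition pos_part :: "real \<Rightarrow> real" where
  "pos_part x = max 0 x"

definition neg_part :: "real \<Rightarrow> real" where
  "neg_part x = max 0 (- x)"

end

theory Submission
  imports Defs "HOL-Probability.Probability"
begin

text \<open>Write \<open>mdd S f\<close> for the multiple divided difference of \<open>f\<close> at a tuple \<open>S\<close> of node sets. Divided
  differences of truncated powers are B-splines, so the integral in the representation has the multiple
  divided difference \<open>\<integral> \<Prod> B\<^sub>j(u\<^sub>j) d\<mu>\<close>, where \<open>B\<^sub>j \<ge> 0\<close> is the B-spline of the nodes \<open>S j\<close> and the choice of
  \<open>\<alpha>\<close> has disappeared, because the kernels for different \<open>\<alpha>\<close> differ by polynomials of degree \<open>n j - 1\<close>;
  pseudo-polynomials are annihilated. This gives one direction.

  Conversely one needs a single measure \<open>\<mu>\<close> with \<open>mdd S f = \<integral> \<Prod> B\<^sub>j(u\<^sub>j) d\<mu>\<close> for all \<open>S\<close>. On the grid of mesh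
  \<open>1 / N!\<close> the discrete Taylor formula writes \<open>mdd S f\<close> as a sum over grid windows of discrete B-splines
  times the nonnegative divided differences of \<open>f\<close> over the windows, that is, nearly as an integral of the
  B-splines with respect to a discrete measure \<open>\<mu>\<^sub>N\<close>. The \<open>\<mu>\<^sub>N\<close> are uniformly bounded on compact sets, and a
  vague limit point \<open>\<mu>\<close> has the required property for rational nodes. Since \<open>n j \<ge> 2\<close>, multiple divided
  differences depend continuously on each coordinate, which extends it to all nodes. Finally a function
  all of whose multiple divided differences vanish is a pseudo-polynomial, because it is annihilated by the
  composition of the interpolation error operators in the single variables.\<close>

section \<open>Divided differences and B-splines\<close>

text \<open>The obstacle is that \<open>f\<close> has no regularity of its own, as the coefficients
  of a pseudo-polynomial are arbitrary functions. So everything is stated for divided differences,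
  which do not see that part. Any finite set of rationals lies on all grids of mesh
  \<open>1 / fact N\<close> from some \<open>N\<close> on; for such nodes the grid formula is an
  identity, and \<open>f\<close> is never approximated between grid points. Its weights are discrete
  B-splines, which vary with \<open>N\<close> and must be replaced by B-splines before a limit
  measure can be tested against them. The bound \<open>n i \<ge> 2\<close> makes B-splines
  continuous, hence admissible test functions. The measures live on an open box and may have
  infinite mass; B-splines positive at given points provide both the bounds for compactness and the
  weight that makes the masses finite.\<close>

definition wt :: "real set \<Rightarrow> real \<Rightarrow> real" where
  "wt S t = (if t \<in> S then inverse (\<Prod>b\<in>S - {t}. t - b) else 0)"

text \<open>With a set of nodes, symmetry is built in; \<open>wt S t\<close> is the reciprocal of
  the derivative at \<open>t\<close> of the node polynomial of \<open>S\<close>.\<close>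

definition dd :: "real set \<Rightarrow> (real \<Rightarrow> real) \<Rightarrow> real" where
  "dd S g = (\<Sum>t\<in>S. wt S t * g t)"

lemma wt_insert:
  assumes "finite S" "a \<in> S" "t \<in> S" "t \<noteq> a"
  shows "wt S t * (t - a) = wt (S - {a}) t"
proof -
  have "S - {t} = insert a (S - {a} - {t})" using assms by auto
  then have "(\<Prod>b\<in>S - {t}. t - b) = (t - a) * (\<Prod>b\<in>S - {a} - {t}. t - b)"
    using assms by (metis (no_types, lifting) Diff_iff finite_Diff insertCI prod.insert)
  then show ?thesis using assms by (auto simp: wt_def field_simps)
qed

text \<open>The factor \<open>t - a\<close> kills the node \<open>a\<close> and cancels one factor
  in every other weight. This is the source of the recursion, of the annihilation of polynomials and
  of the B-spline recurrence.\<close>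

lemma dd_mult_linear:
  assumes "finite S" "a \<in> S"
  shows "dd S (\<lambda>t. (t - a) * g t) = dd (S - {a}) g"
proof -
  have "dd S (\<lambda>t. (t - a) * g t) = (\<Sum>t\<in>S - {a}. wt S t * ((t - a) * g t))"
    unfolding dd_def using assms by (subst sum.remove[of _ a]) auto
  also have "\<dots> = dd (S - {a}) g" unfolding dd_def
    by (rule sum.cong) (use wt_insert[OF assms] in \<open>auto simp: mult.assoc[symmetric]\<close>)
  finally show ?thesis .
qed

lemma dd_add: "dd S (\<lambda>t. f t + g t) = dd S f + dd S g"
  by (simp add: dd_def algebra_simps sum.distrib)

lemma dd_diff: "dd S (\<lambda>t. f t - g t) = dd S f - dd S g"
  by (simp add: dd_def algebra_simps sum_subtractf)

lemma dd_cmult: "dd S (\<lambda>t. c * g t) = c * dd S g"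
  by (simp add: dd_def algebra_simps sum_distrib_left)

lemma dd_sum: "dd S (\<lambda>t. \<Sum>j\<in>J. g j t) = (\<Sum>j\<in>J. dd S (g j))"
  unfolding dd_def by (simp add: sum_distrib_left sum.swap[of _ J])

lemma dd_cong: "(\<And>t. t \<in> S \<Longrightarrow> f t = g t) \<Longrightarrow> dd S f = dd S g"
  by (simp add: dd_def)

lemma dd_singleton [simp]: "dd {a} g = g a"
  by (simp add: dd_def wt_def)

lemma dd_rec:
  assumes "finite S" "a \<in> S" "b \<in> S"
  shows "(b - a) * dd S g = dd (S - {a}) g - dd (S - {b}) g"
proof -
  have "dd (S - {a}) g - dd (S - {b}) g = dd S (\<lambda>t. (t - a) * g t - (t - b) * g t)"
    using assms by (simp add: dd_mult_linear dd_diff)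
  also have "\<dots> = dd S (\<lambda>t. (b - a) * g t)"
    by (rule dd_cong) (simp add: algebra_simps)
  finally show ?thesis by (simp add: dd_cmult)
qed

lemma dd_doubleton:
  assumes "a \<noteq> b"
  shows "dd {a, b} g = (g b - g a) / (b - a)"
proof -
  have "{a, b} - {a} = {b}" "{a, b} - {b} = {a}" using assms by auto
  then show ?thesis using dd_rec[of "{a, b}" a b g] assms by (simp add: field_simps)
qed

lemma dd_const:
  assumes "finite S" "card S \<ge> 2"
  shows "dd S (\<lambda>t. c) = 0"
  using assms
proof (induction "card S" arbitrary: S rule: less_induct)
  case less
  obtain a b where ab: "a \<in> S" "b \<in> S" "a \<noteq> b"
    using less.prems by (metis card_2_iff' ex_card subset_iff)
  have *: "dd (S - {x}) (\<lambda>t. c) = (if card S = 2 then c else 0)" if "x \<in> S" for x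
  proof (cases "card S = 2")
    case True
    then have "card (S - {x}) = 1" using that less.prems by simp
    then obtain y where "S - {x} = {y}" by (auto simp: card_1_singleton_iff)
    then show ?thesis using True by simp
  next
    case False
    have "dd (S - {x}) (\<lambda>t. c) = 0"
      by (rule less.hyps) (use False that less.prems in \<open>auto simp: card_Diff_singleton intro: card_Diff1_less\<close>)
    then show ?thesis using False by simp
  qed
  have "(b - a) * dd S (\<lambda>t. c) = 0"
    using dd_rec[OF less.prems(1) ab(1,2), of "\<lambda>t. c"] * ab by simp
  then show ?case using ab by simp
qed

text \<open>One factor is split as \<open>t - r x = (t - a) + (a - r x)\<close> with a node
  \<open>a\<close>: the first part removes a node, the second only lowers the degree, and the
  inequality between the cardinalities survives both.\<close>

lemma dd_prod_linear:
  assumes "finite A" "finite S" "card A + 1 < card S"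
  shows "dd S (\<lambda>t. \<Prod>i\<in>A. t - r i) = 0"
  using assms
proof (induction A arbitrary: S rule: finite_induct)
  case empty
  then show ?case using dd_const[of S 1] by simp
next
  case (insert x A)
  obtain a where a: "a \<in> S" using insert by fastforce
  have "dd S (\<lambda>t. \<Prod>i\<in>insert x A. t - r i)
      = dd S (\<lambda>t. (t - a) * (\<Prod>i\<in>A. t - r i) + (a - r x) * (\<Prod>i\<in>A. t - r i))"
    by (rule dd_cong) (use insert in \<open>simp add: algebra_simps\<close>)
  also have "\<dots> = dd (S - {a}) (\<lambda>t. \<Prod>i\<in>A. t - r i) + (a - r x) * dd S (\<lambda>t. \<Prod>i\<in>A. t - r i)"
    using a insert by (simp only: dd_add dd_mult_linear dd_cmult)
  also have "\<dots> = 0" using insert a by simp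
  finally show ?case .
qed

lemma dd_power:
  assumes "finite S" "k + 1 < card S"
  shows "dd S (\<lambda>t. t ^ k) = 0"
  using dd_prod_linear[of "{..<k}" S "\<lambda>_. 0"] assms by simp

lemma divided_diff_eq_dd:
  assumes "inj_on x {..n}"
  shows "divided_diff n x g = dd (x ` {..n}) g"
  using assms
proof (induction n arbitrary: x)
  case (Suc n)
  have ne: "x (Suc n) \<noteq> x 0" using Suc.prems by (auto dest: inj_onD)
  have 1: "(\<lambda>k. x (Suc k)) ` {..n} = x ` {..Suc n} - {x 0}"
  proof -
    have "(\<lambda>k. x (Suc k)) ` {..n} = x ` (Suc ` {..n})" by (simp add: image_image)
    also have "Suc ` {..n} = {..Suc n} - {0}" unfolding image_Suc_atMost by auto
    also have "x ` \<dots> = x ` {..Suc n} - {x 0}"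
      using inj_on_image_set_diff[OF Suc.prems, of "{..Suc n}" "{0}"] by simp
    finally show ?thesis .
  qed
  have 2: "x ` {..n} = x ` {..Suc n} - {x (Suc n)}"
  proof -
    have "{..n} = {..Suc n} - {Suc n}" by auto
    then show ?thesis
      using inj_on_image_set_diff[OF Suc.prems, of "{..Suc n}" "{Suc n}"] by simp
  qed
  have i1: "inj_on (\<lambda>k. x (Suc k)) {..n}"
    using Suc.prems by (auto simp: inj_on_def)
  have i2: "inj_on x {..n}" using Suc.prems by (rule inj_on_subset) auto
  have "divided_diff (Suc n) x g
      = (dd (x ` {..Suc n} - {x 0}) g - dd (x ` {..Suc n} - {x (Suc n)}) g) / (x (Suc n) - x 0)"
    using Suc.IH[OF i1] Suc.IH[OF i2] 1 2 by simp
  also have "\<dots> = dd (x ` {..Suc n}) g"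
    using dd_rec[of "x ` {..Suc n}" "x 0" "x (Suc n)" g] ne by (simp add: field_simps)
  finally show ?case .
qed simp

section \<open>Lagrange interpolation and its error\<close>

definition lagrange :: "real set \<Rightarrow> real \<Rightarrow> real \<Rightarrow> real" where
  "lagrange Z z t = wt Z z * (\<Prod>y\<in>Z - {z}. t - y)"

lemma lagrange_node:
  assumes "finite Z" "z \<in> Z" "t \<in> Z"
  shows "lagrange Z z t = (if t = z then 1 else 0)"
  using assms by (auto simp: lagrange_def wt_def)

text \<open>Multiplied by the node polynomial of \<open>Z\<close>, the weight at \<open>t\<close>
  becomes 1 and the weight at \<open>z\<close> becomes minus the Lagrange polynomial of
  \<open>z\<close>. The sign or the vanishing of a divided difference thus controls the
  interpolation error.\<close>

lemma dd_insert_interpolation: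
  assumes "finite Z" "t \<notin> Z"
  shows "dd (insert t Z) h * (\<Prod>z\<in>Z. t - z) = h t - (\<Sum>z\<in>Z. lagrange Z z t * h z)"
proof -
  let ?w = "\<Prod>z\<in>Z. t - z"
  have w0: "?w \<noteq> 0" using assms by auto
  have "wt (insert t Z) t * ?w = 1" using assms w0 by (simp add: wt_def)
  moreover have "wt (insert t Z) z * ?w = - lagrange Z z t" if "z \<in> Z" for z
  proof -
    have zt: "z \<noteq> t" using that assms by auto
    have "wt (insert t Z) z * (z - t) = wt Z z"
      using wt_insert[of "insert t Z" t z] that assms zt by simp
    moreover have "?w = (t - z) * (\<Prod>y\<in>Z - {z}. t - y)" using that assms by (simp add: prod.remove)
    ultimately show ?thesis unfolding lagrange_def by (metis minus_diff_eq minus_mult_left minus_mult_right mult.assoc)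
  qed
  moreover have "dd (insert t Z) h * ?w = (\<Sum>z\<in>insert t Z. (wt (insert t Z) z * ?w) * h z)"
    unfolding dd_def sum_distrib_right by (rule sum.cong) (auto simp: ac_simps)
  ultimately have "dd (insert t Z) h * ?w = h t + (\<Sum>z\<in>Z. - lagrange Z z t * h z)"
    using assms by simp
  then show ?thesis by (simp add: sum_negf)
qed

text \<open>Truncated powers for \<open>h = 0\<close>, and their analogues on a grid of mesh \<open>h\<close> containing \<open>u\<close>.\<close>
definition trunc_pow :: "nat \<Rightarrow> real \<Rightarrow> real \<Rightarrow> real \<Rightarrow> real" where
  "trunc_pow n h u t = (if u < t then (\<Prod>l=1..<n. t - u - real l * h) / fact (n - 1) else 0)"

text \<open>For \<open>n = 1\<close> the two sides differ at \<open>t \<le> u\<close>, because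
  \<open>0 ^ 0 = 1\<close>.\<close>

lemma trunc_pow_0: "n \<ge> 2 \<Longrightarrow> trunc_pow n 0 u t = pos_part (t - u) ^ (n - 1) / fact (n - 1)"
  by (auto simp: trunc_pow_def pos_part_def)

section \<open>Support, recurrence and positivity of continuous and discrete B-splines\<close>

lemma dd_trunc_pow_below:
  assumes "finite S" "card S = n + 1" "n \<ge> 1" "\<And>t. t \<in> S \<Longrightarrow> u < t"
  shows "dd S (trunc_pow n h u) = 0"
proof -
  have "dd S (trunc_pow n h u) = dd S (\<lambda>t. inverse (fact (n - 1)) * (\<Prod>l=1..<n. t - (u + real l * h)))"
    by (rule dd_cong) (use assms(4) in \<open>auto simp: trunc_pow_def field_simps\<close>)
  also have "\<dots> = 0" unfolding dd_cmult
    by (subst dd_prod_linear) (use assms in auto)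
  finally show ?thesis .
qed

lemma dd_eq_0: "(\<And>t. t \<in> S \<Longrightarrow> g t = 0) \<Longrightarrow> dd S g = 0"
  by (simp add: dd_def)

lemma trunc_pow_Suc:
  assumes "n \<ge> 1"
  shows "trunc_pow (Suc n) h u t = (t - (u + real n * h)) * trunc_pow n h u t / real n"
proof -
  have "(\<Prod>l=1..<Suc n. t - u - real l * h) = (\<Prod>l=1..<n. t - u - real l * h) * (t - u - real n * h)"
    using assms by (rule prod.atLeastLessThan_Suc)
  moreover have "fact n = real n * fact (n - 1)" using assms by (simp add: fact_reduce)
  ultimately show ?thesis by (simp add: trunc_pow_def diff_diff_eq mult.commute)
qed

text \<open>The Cox-de Boor recurrence. The new factor of \<open>trunc_pow (Suc n)\<close> is
  \<open>t - y\<close>, an affine combination of \<open>t - a\<close> and \<open>t - b\<close>, each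
  of which removes a node. For \<open>a \<le> y \<le> b\<close> both coefficients are
  nonnegative.\<close>

lemma dd_trunc_pow_rec:
  fixes u h :: real
  assumes "finite S" "a \<in> S" "b \<in> S" "a \<noteq> b" "n \<ge> 1"
  defines "y \<equiv> u + real n * h"
  shows "dd S (trunc_pow (Suc n) h u) = ((b - y) * dd (S - {a}) (trunc_pow n h u) + (y - a) * dd (S - {b}) (trunc_pow n h u))
     / ((b - a) * real n)"
proof -
  have "dd S (trunc_pow (Suc n) h u) = dd S (\<lambda>t. ((b - y) / ((b - a) * n)) * ((t - a) * trunc_pow n h u t)
      + ((y - a) / ((b - a) * n)) * ((t - b) * trunc_pow n h u t))"
  proof (rule dd_cong)
    fix t
    have "trunc_pow (Suc n) h u t = (t - y) * trunc_pow n h u t / real n"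
      using trunc_pow_Suc[of n h u t] assms by simp
    moreover have "t - y = ((b - y) * (t - a) + (y - a) * (t - b)) / (b - a)"
      using assms(4) by (simp add: field_simps)
    ultimately show "trunc_pow (Suc n) h u t = ((b - y) / ((b - a) * n)) * ((t - a) * trunc_pow n h u t)
      + ((y - a) / ((b - a) * n)) * ((t - b) * trunc_pow n h u t)"
      using assms by (simp add: add_divide_distrib distrib_right mult.assoc)
  qed
  also have "\<dots> = ((b - y) / ((b - a) * n)) * dd (S - {a}) (trunc_pow n h u)
      + ((y - a) / ((b - a) * n)) * dd (S - {b}) (trunc_pow n h u)"
    using assms by (simp only: dd_add dd_cmult dd_mult_linear)
  finally show ?thesis by (simp add: add_divide_distrib)
qed

text \<open>With the extreme nodes in the recurrence, only \<open>?y\<close> outside their range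
  needs an argument. If it is left of all nodes, so is \<open>u\<close>, and a polynomial remains.
  If it is right of them, every node beyond \<open>u\<close> is a root of the product; this is where
  the grid hypothesis enters, since between its roots the product may be negative.\<close>

lemma dd_trunc_pow_nonneg:
  assumes "finite S" "card S = n + 1" "n \<ge> 1" "h \<ge> 0"
    and "\<And>t. t \<in> S \<Longrightarrow> h = 0 \<or> (\<exists>k::int. t = u + of_int k * h)"
  shows "dd S (trunc_pow n h u) \<ge> 0"
  using assms(3,1,2,5)
proof (induction n arbitrary: S rule: dec_induct)
  case base
  then obtain a b where ab: "S = {a, b}" "a \<noteq> b" by (metis card_2_iff nat_1_add_1)
  show ?case unfolding ab(1) dd_doubleton[OF ab(2)]
    by (auto simp: trunc_pow_def divide_simps)
next
  case (step n)
  let ?a = "Min S" and ?b = "Max S" and ?y = "u + real n * h"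
  have ne: "S \<noteq> {}" using step by auto
  have ab: "?a \<in> S" "?b \<in> S" using step ne by auto
  have "\<not> S \<subseteq> {?a}" using step by (metis Suc_eq_plus1 card.empty card_1_singleton_iff nat.inject subset_singletonD add_cancel_right_left nat.distinct(1) Suc_neq_Zero not_one_le_zero)
  then obtain c where "c \<in> S" "c \<noteq> ?a" by auto
  then have lt: "?a < ?b" using Min_le[of S c] Max_ge[of S c] step.prems(1) by linarith
  have nn: "dd (S - {x}) (trunc_pow n h u) \<ge> 0" if "x \<in> S" for x
    by (rule step.IH) (use step that in auto)
  consider "?y < ?a" | "?y > ?b" | "?a \<le> ?y \<and> ?y \<le> ?b" by linarith
  then show ?case
  proof cases
    case 1
    have "dd S (trunc_pow (Suc n) h u) = 0"
    proof (rule dd_trunc_pow_below)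
      fix t assume "t \<in> S"
      then have "?a \<le> t" using step by simp
      moreover have "0 \<le> real n * h" using assms(4) by simp
      ultimately show "u < t" using 1 by linarith
    qed (use step in auto)
    then show ?thesis by simp
  next
    case 2
    have "trunc_pow (Suc n) h u t = 0" if t: "t \<in> S" for t
    proof (cases "u < t")
      case True
      have "t \<le> ?b" using t step by simp
      then have ty: "t < ?y" using 2 by simp
      then have h: "h > 0" using True assms(4) by (cases "h = 0") auto
      then obtain k :: int where k: "t = u + of_int k * h" using step.prems(3)[OF t] by auto
      then have "0 < of_int k * h" "of_int k * h < real n * h" using ty True by auto
      then have k': "0 < k" "k < int n" using h by (simp_all add: zero_less_mult_iff)
      then have "nat k \<in> {1..<Suc n}" "t - u - real (nat k) * h = 0" using k by auto
      then show ?thesis unfolding trunc_pow_def by (metis (mono_tags, lifting) div_0 finite_atLeastLessThan prod_zero)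
    qed (simp add: trunc_pow_def)
    then show ?thesis by (simp add: dd_eq_0)
  next
    case 3
    show ?thesis
      by (subst dd_trunc_pow_rec[OF \<open>finite S\<close> ab])
         (use 3 lt step nn[OF ab(1)] nn[OF ab(2)] in \<open>auto intro!: divide_nonneg_nonneg add_nonneg_nonneg mult_nonneg_nonneg\<close>)
  qed
qed

text \<open>Both coefficients of the recurrence are positive, so one shorter B-spline positive at
  \<open>u\<close> suffices: an interior node left of \<open>u\<close> becomes the new left end, one
  right of \<open>u\<close> the new right end. If all interior nodes equal \<open>u\<close>, there
  is just one and \<open>n = 1\<close>; the B-spline of two nodes is positive also at its left end,
  hence the weaker \<open>a \<le> u\<close> in that case.\<close>

lemma bspline_pos:
  assumes "finite S" "card S = n + 1" "n \<ge> 1" "a \<in> S" "b \<in> S"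
    and "n = 1 \<Longrightarrow> a \<le> u" "n \<noteq> 1 \<Longrightarrow> a < u" "u < b"
  shows "dd S (trunc_pow n 0 u) > 0"
  using assms(3,1,2,4-)
proof (induction n arbitrary: S a b rule: dec_induct)
  case base
  then have "a \<noteq> b" by auto
  moreover have "{a, b} \<subseteq> S" using base by auto
  ultimately have "S = {a, b}"
    using card_subset_eq[of S "{a, b}"] base by auto
  then show ?case using base dd_doubleton[OF \<open>a \<noteq> b\<close>] by (simp add: trunc_pow_def)
next
  case (step n)
  let ?a = "Min S" and ?b = "Max S"
  have ab: "?a \<in> S" "?b \<in> S" using step by (auto intro!: Min_in Max_in)
  have au: "?a < u" "u < ?b" 

  proof -
    have "a < u" using step.hyps(1) step.prems(6) by simp
    then show "?a < u" "u < ?b"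
      using Min_le[of S a] Max_ge[of S b] step.prems by linarith+
  qed
  have nn: "dd (S - {x}) (trunc_pow n 0 u) \<ge> 0" if "x \<in> S" for x
    by (rule dd_trunc_pow_nonneg) (use step that in auto)
  have card: "card (S - {?a, ?b}) = n"
    using ab au step by (subst card_Diff_subset) auto
  have "dd (S - {?a}) (trunc_pow n 0 u) > 0 \<or> dd (S - {?b}) (trunc_pow n 0 u) > 0"
  proof (cases "\<exists>c\<in>S - {?a, ?b}. c < u \<or> (n = 1 \<and> c \<le> u)")
    case True
    then obtain c where "c \<in> S - {?a, ?b}" "c < u \<or> (n = 1 \<and> c \<le> u)" by auto
    then have "dd (S - {?a}) (trunc_pow n 0 u) > 0"
      by (intro step.IH[of _ c ?b]) (use step ab au in auto)
    then show ?thesis ..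
  next
    case False
    have "\<exists>c\<in>S - {?a, ?b}. u < c"
    proof (rule ccontr)
      assume "\<not> ?thesis"
      then have eq: "\<forall>c\<in>S - {?a, ?b}. c = u \<and> n \<noteq> 1"
        using False by (metis linorder_less_linear order_refl)
      moreover from eq have "S - {?a, ?b} \<subseteq> {u}" by auto
      then have "n \<le> 1" using card card_mono[of "{u}" "S - {?a, ?b}"] by simp
      moreover have "S - {?a, ?b} \<noteq> {}" using card step by (metis card.empty not_one_le_zero)
      ultimately show False using step by auto
    qed
    then obtain c where c: "c \<in> S - {?a, ?b}" "u < c" ..
    then have "dd (S - {?b}) (trunc_pow n 0 u) > 0"
      by (intro step.IH[of _ ?a c]) (use step ab au in auto)
    then show ?thesis ..
  qed
  then have "0 < (?b - u) * dd (S - {?a}) (trunc_pow n 0 u) + (u - ?a) * dd (S - {?b}) (trunc_pow n 0 u)"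
    using nn[OF ab(1)] nn[OF ab(2)] au
    by (metis add_nonneg_pos add_pos_nonneg diff_gt_0_iff_gt less_imp_le mult_nonneg_nonneg mult_pos_pos)
  then show ?case
    by (subst dd_trunc_pow_rec[OF \<open>finite S\<close> ab]) (use au step in auto)
qed

section \<open>The discrete Taylor formula\<close>

primrec fd :: "nat \<Rightarrow> (int \<Rightarrow> real) \<Rightarrow> int \<Rightarrow> real" where
  "fd 0 G z = G z"
| "fd (Suc n) G z = fd n G (z + 1) - fd n G z"

text \<open>By Pascal's rule \<open>p - 1 - j choose n\<close> is the difference of
  \<open>p - j choose Suc n\<close> and \<open>p - 1 - j choose Suc n\<close>. Applied to the
  remainder in Newton's formula, this splits off the next term.\<close>

lemma sum_binomial_by_parts:
  fixes H :: "nat \<Rightarrow> real"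
  shows "(\<Sum>j<p. real (p - 1 - j choose n) * H j)
    = real (p choose Suc n) * H 0 + (\<Sum>j<p. real (p - 1 - j choose Suc n) * (H (Suc j) - H j))"
proof (induction p arbitrary: H)
  case (Suc p)
  have "(\<Sum>j<Suc p. real (Suc p - 1 - j choose n) * H j)
      = real (p choose n) * H 0 + (\<Sum>j<p. real (p - 1 - j choose n) * H (Suc j))"
    by (simp add: sum.lessThan_Suc_shift del: sum.lessThan_Suc)
  moreover have "(\<Sum>j<Suc p. real (Suc p - 1 - j choose Suc n) * (H (Suc j) - H j))
      = real (p choose Suc n) * (H 1 - H 0)
        + (\<Sum>j<p. real (p - 1 - j choose Suc n) * (H (Suc (Suc j)) - H (Suc j)))"
    by (simp add: sum.lessThan_Suc_shift del: sum.lessThan_Suc)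
  ultimately show ?case using Suc.IH[of "\<lambda>j. H (Suc j)"] by (simp add: algebra_simps)
qed simp

text \<open>A sum replaces the integral remainder of Taylor's formula;
  \<open>p - 1 - j choose n\<close> is the discrete counterpart of
  \<open>(t - u) ^ n / fact n\<close>.\<close>

lemma newton_forward:
  "G (a + int p) = (\<Sum>k<Suc n. real (p choose k) * fd k G a)
     + (\<Sum>j<p. real (p - 1 - j choose n) * fd (Suc n) G (a + int j))"
proof (induction n)
  case 0
  have "G (a + int p) = G a + (\<Sum>j<p. G (a + int j + 1) - G (a + int j))"
    by (induction p) (auto simp: ac_simps)
  then show ?case by simp
next
  case (Suc n)
  then show ?case using sum_binomial_by_parts[of p n "\<lambda>j. fd (Suc n) G (a + int j)"]
    by (simp add: ac_simps)
qed

definition window :: "real \<Rightarrow> nat \<Rightarrow> int \<Rightarrow> real set" where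
  "window h n z = (\<lambda>k. h * of_int k) ` {z..z + int n}"

lemma finite_window [simp]: "finite (window h n z)"
  by (simp add: window_def)

lemma card_window: "h > 0 \<Longrightarrow> card (window h n z) = n + 1"
  unfolding window_def by (subst card_image) (auto simp: inj_on_def)

lemma fd_eq_dd:
  assumes "h > 0"
  shows "fd n (\<lambda>k. g (h * of_int k)) z = fact n * h ^ n * dd (window h n z) g"
proof (induction n arbitrary: z)
  case (Suc n)
  let ?S = "window h (Suc n) z" and ?a = "h * of_int z" and ?b = "h * of_int (z + int (Suc n))"
  have inj: "inj_on (\<lambda>k::int. h * of_int k) UNIV" using assms by (auto simp: inj_on_def)
  have "{z..z + int (Suc n)} - {z} = {z + 1..z + 1 + int n}" 
    "{z..z + int (Suc n)} - {z + int (Suc n)} = {z..z + int n}" by auto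
  then have W: "?S - {?a} = window h n (z + 1)" "?S - {?b} = window h n z"
    using inj_on_image_set_diff[OF inj, of "{z..z + int (Suc n)}" "{z}"]
      inj_on_image_set_diff[OF inj, of "{z..z + int (Suc n)}" "{z + int (Suc n)}"]
    unfolding window_def by auto
  have "(?b - ?a) * dd ?S g = dd (?S - {?a}) g - dd (?S - {?b}) g"
    unfolding window_def by (rule dd_rec) (auto intro!: imageI simp del: of_int_add)
  moreover have "?b - ?a = h * real (Suc n)" by (simp add: algebra_simps)
  ultimately have *: "dd (window h n (z + 1)) g - dd (window h n z) g = h * real (Suc n) * dd ?S g"
    using W by simp
  have "fd (Suc n) (\<lambda>k. g (h * of_int k)) z
      = fact n * h ^ n * (dd (window h n (z + 1)) g - dd (window h n z) g)"
    by (simp add: Suc.IH right_diff_distrib)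
  then show ?case unfolding * by (simp add: field_simps)
qed (simp add: window_def)

text \<open>The roots of \<open>trunc_pow\<close> start one mesh width to the right of
  \<open>u\<close> precisely so that its values on the grid are the binomial coefficients in the
  remainder of \<open>newton_forward\<close>, with \<open>p - 1 - j\<close> and not
  \<open>p - j\<close> on top.\<close>

lemma trunc_pow_grid:
  assumes "h > 0"
  shows "trunc_pow (Suc n) h (h * of_int z) (h * of_int (z + 1 + int m)) = h ^ n * real (m choose n)"
proof -
  have "(\<Prod>l=1..<Suc n. h * of_int (z + 1 + int m) - h * of_int z - real l * h)
      = (\<Prod>l=0..<n. h * (real m - real l))"
    unfolding One_nat_def prod.atLeast_Suc_lessThan_Suc_shift
    by (rule prod.cong) (auto simp: algebra_simps)
  also have "\<dots> = h ^ n * (\<Prod>l=0..<n. real m - real l)" by (simp add: prod.distrib)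
  finally show ?thesis using assms
    by (simp add: trunc_pow_def binomial_gbinomial gbinomial_prod_rev)
qed

text \<open>At grid points up to \<open>z\<close> the truncation gives 0, and the next
  \<open>n - 1\<close> grid points are roots. Together with \<open>dd_trunc_pow_below\<close>, only
  those \<open>z\<close> remain whose whole window, from \<open>z\<close> to \<open>z + n\<close>,
  lies in the range of the nodes.\<close>

lemma dd_trunc_pow_above:
  assumes "h > 0" "\<And>t. t \<in> S \<Longrightarrow> \<exists>k::int. t = h * of_int k \<and> k < z + int n"
  shows "dd S (trunc_pow n h (h * of_int z)) = 0"
proof (rule dd_eq_0)
  fix t assume "t \<in> S"
  then obtain k where k: "t = h * of_int k" "k < z + int n" using assms by blast
  show "trunc_pow n h (h * of_int z) t = 0"
  proof (cases "z < k")
    case True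
    then have "nat (k - z) \<in> {1..<n}" using k by auto
    moreover have "t - h * of_int z - real (nat (k - z)) * h = 0"
      using True k by (simp add: algebra_simps)
    ultimately have "(\<Prod>l=1..<n. t - h * of_int z - real l * h) = 0" by (metis finite_atLeastLessThan prod_zero)
    then show ?thesis by (simp add: trunc_pow_def)
  qed (use k assms in \<open>simp add: trunc_pow_def\<close>)
qed

text \<open>A discrete Peano kernel formula: \<open>dd S\<close> annihilates the polynomial part of
  Newton's formula at the leftmost node and acts on the remainder through the truncated powers.
  \<open>J\<close> is any finite set containing the windows between the extreme nodes, so that one
  index set serves many \<open>S\<close>.\<close>

lemma dd_grid_expansion:
  assumes h: "h > 0" and n: "n \<ge> 1" and S: "finite S" "card S = n + 1"
    and grid: "S \<subseteq> range (\<lambda>k::int. h * of_int k)" and J: "finite J"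
    and cover: "\<And>z::int. Min S \<le> h * of_int z \<Longrightarrow> h * of_int (z + int n) \<le> Max S \<Longrightarrow> z \<in> J"
  shows "dd S g = (\<Sum>z\<in>J. (fact n * h * dd S (trunc_pow n h (h * of_int z))) * dd (window h n z) g)"
proof -
  obtain m where m: "n = Suc m" using n by (cases n) auto
  have ne: "S \<noteq> {}" using S by auto
  obtain a b where ab: "Min S = h * of_int a" "Max S = h * of_int b"
    using grid Min_in[OF S(1) ne] Max_in[OF S(1) ne] by blast
  let ?G = "\<lambda>k. g (h * of_int k)" and ?P = "nat (b - a)"
  let ?c = "\<lambda>z::int. dd S (trunc_pow n h (h * of_int z))"
  have rng: "\<exists>p\<le>?P. t = h * of_int (a + int p)" if tS: "t \<in> S" for t
  proof -
    obtain k where k: "t = h * of_int k" using grid tS by auto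
    have "h * of_int a \<le> h * of_int k" "h * of_int k \<le> h * of_int b"
      using ab Min_le[OF S(1) tS] Max_ge[OF S(1) tS] k by auto
    then have "a \<le> k" "k \<le> b" using h by auto
    then show ?thesis using k by (intro exI[of _ "nat (k - a)"]) auto
  qed
  have "dd S g = dd S (\<lambda>t. (\<Sum>k<n. fd k ?G a / (h ^ k * fact k) * (\<Prod>i\<in>{0..<k}. t - h * of_int (a + int i)))
      + (\<Sum>j<?P. fd n ?G (a + int j) / h ^ m * trunc_pow n h (h * of_int (a + int j)) t))"
  proof (rule dd_cong)
    fix t assume "t \<in> S"
    then obtain p where p: "p \<le> ?P" "t = h * of_int (a + int p)" using rng by blast
    have "(\<Prod>i\<in>{0..<k}. t - h * of_int (a + int i)) = h ^ k * fact k * real (p choose k)" for k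
    proof -
      have "(\<Prod>i\<in>{0..<k}. t - h * of_int (a + int i)) = (\<Prod>i\<in>{0..<k}. h * (real p - real i))"
        by (rule prod.cong) (auto simp: p algebra_simps)
      then show ?thesis by (simp add: prod.distrib binomial_gbinomial gbinomial_prod_rev)
    qed
    then have 1: "fd k ?G a / (h ^ k * fact k) * (\<Prod>i\<in>{0..<k}. t - h * of_int (a + int i))
        = real (p choose k) * fd k ?G a" for k
      using h by simp
    \<comment> \<open>Truncation kills the terms from \<open>p\<close> on, so the upper limit can be
      the same for all nodes \<open>t\<close>; only then can \<open>dd S\<close> be applied
      termwise.\<close>
    have 2: "(\<Sum>j<p. real (p - 1 - j choose m) * fd n ?G (a + int j))
        = (\<Sum>j<?P. fd n ?G (a + int j) / h ^ m * trunc_pow n h (h * of_int (a + int j)) t)"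
    proof (rule sum.mono_neutral_cong_left)
      show "\<forall>j\<in>{..<?P} - {..<p}. fd n ?G (a + int j) / h ^ m * trunc_pow n h (h * of_int (a + int j)) t = 0"
        using h by (auto simp: trunc_pow_def p)
      fix j assume "j \<in> {..<p}"
      then have "t = h * of_int ((a + int j) + 1 + int (p - 1 - j))" using p by auto
      then have "trunc_pow n h (h * of_int (a + int j)) t = h ^ m * real (p - 1 - j choose m)"
        using trunc_pow_grid[OF h, of m "a + int j" "p - 1 - j"] unfolding m by simp
      then show "real (p - 1 - j choose m) * fd n ?G (a + int j)
          = fd n ?G (a + int j) / h ^ m * trunc_pow n h (h * of_int (a + int j)) t"
        using h by simp
    qed (use p in auto)
    show "g t = (\<Sum>k<n. fd k ?G a / (h ^ k * fact k) * (\<Prod>i\<in>{0..<k}. t - h * of_int (a + int i)))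
      + (\<Sum>j<?P. fd n ?G (a + int j) / h ^ m * trunc_pow n h (h * of_int (a + int j)) t)"
      unfolding 1 2[symmetric] using newton_forward[of ?G a p m] p m by simp
  qed
  also have "\<dots> = (\<Sum>j<?P. fd n ?G (a + int j) / h ^ m * ?c (a + int j))"
    unfolding dd_add dd_sum dd_cmult using S by (simp add: dd_prod_linear)
  \<comment> \<open>The constant is \<open>fact n * h ^ n\<close> from \<open>fd_eq_dd\<close>
    divided by \<open>h ^ m\<close>, where \<open>m = n - 1\<close>.\<close>
  also have "\<dots> = (\<Sum>j<?P. (fact n * h * ?c (a + int j)) * dd (window h n (a + int j)) g)"
    using h by (intro sum.cong refl) (simp add: fd_eq_dd[OF h] m field_simps)
  also have "\<dots> = (\<Sum>z\<in>{a..<b}. (fact n * h * ?c z) * dd (window h n z) g)"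
    by (rule sum.reindex_bij_witness[of _ "\<lambda>z. nat (z - a)" "\<lambda>j. a + int j"]) auto
  also have "\<dots> = (\<Sum>z\<in>J. (fact n * h * ?c z) * dd (window h n z) g)"
  proof -
    have z: "?c z = 0" if "z \<notin> {a..<b} \<inter> J" for z
    proof -
      have "z < a \<or> b < z + int n"
        using that cover[of z] ab h n by (force simp: not_le)
      then show ?thesis
      proof
        assume "z < a"
        show ?thesis
        proof (rule dd_trunc_pow_below[OF S n])
          fix t assume "t \<in> S"
          then have "Min S \<le> t" using S by simp
          moreover have "h * of_int z < Min S" using ab h \<open>z < a\<close> by simp
          ultimately show "h * of_int z < t" by simp
        qed
      next
        assume "b < z + int n"
        show ?thesis
        proof (rule dd_trunc_pow_above[OF h])
          fix t assume "t \<in> S"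
          then obtain k where k: "t = h * of_int k" "h * of_int k \<le> h * of_int b"
            using grid Max_ge[OF S(1)] ab by (metis (no_types, lifting) image_iff subsetD)
          then have "k \<le> b" using h by simp
          then show "\<exists>k::int. t = h * of_int k \<and> k < z + int n" using k \<open>b < z + int n\<close> by auto
        qed
      qed
    qed
    have "(\<Sum>z\<in>A. (fact n * h * ?c z) * dd (window h n z) g)
        = (\<Sum>z\<in>{a..<b} \<inter> J. (fact n * h * ?c z) * dd (window h n z) g)" if "finite A" "{a..<b} \<inter> J \<subseteq> A" for A
      using that by (intro sum.mono_neutral_right) (auto simp: z)
    from this[of "{a..<b}"] this[of J] show ?thesis using J by simp
  qed
  finally show ?thesis .
qed

section \<open>Multiple divided differences\<close>

lemma sum_PiE_insert:
  fixes F :: "_ \<Rightarrow> 'c::comm_monoid_add"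
  assumes "i \<notin> A"
  shows "(\<Sum>t\<in>Pi\<^sub>E (insert i A) S. F t) = (\<Sum>s\<in>S i. \<Sum>t\<in>Pi\<^sub>E A S. F (t(i := s)))"
proof -
  have "(\<Sum>t\<in>Pi\<^sub>E (insert i A) S. F t) = (\<Sum>(s, t)\<in>S i \<times> Pi\<^sub>E A S. F (t(i := s)))"
    unfolding PiE_insert_eq by (subst sum.reindex[OF inj_combinator[OF assms]]) (simp add: case_prod_unfold)
  then show ?thesis by (simp add: sum.cartesian_product)
qed

text \<open>The tensor product of the functionals \<open>dd (S i)\<close> as one finite sum. It is
  symmetric in the coordinates, so any of them can be made the outermost one, which the recursive
  definition permits only for the last.\<close>

definition mdd :: "'i set \<Rightarrow> ('i \<Rightarrow> real set) \<Rightarrow> (('i \<Rightarrow> real) \<Rightarrow> real) \<Rightarrow> real" where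
  "mdd A S f = (\<Sum>t\<in>Pi\<^sub>E A S. (\<Prod>i\<in>A. wt (S i) (t i)) * f t)"

lemma mdd_empty [simp]: "mdd {} S f = f (\<lambda>_. undefined)"
  by (simp add: mdd_def)

lemma mdd_cong:
  assumes "\<And>i. i \<in> A \<Longrightarrow> S i = S' i" "\<And>t. t \<in> Pi\<^sub>E A S \<Longrightarrow> f t = g t"
  shows "mdd A S f = mdd A S' g"
proof -
  have "Pi\<^sub>E A S = Pi\<^sub>E A S'" using assms(1) by (rule PiE_cong)
  moreover have "(\<Prod>i\<in>A. wt (S i) (t i)) = (\<Prod>i\<in>A. wt (S' i) (t i))" for t
    using assms(1) by (intro prod.cong) auto
  ultimately show ?thesis unfolding mdd_def using assms(2) by (metis (no_types, lifting) sum.cong)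
qed

lemma mdd_insert:
  assumes "finite A" "i \<notin> A"
  shows "mdd (insert i A) S f = dd (S i) (\<lambda>s. mdd A S (\<lambda>t. f (t(i := s))))"
proof -
  have "(\<Prod>j\<in>A. wt (S j) ((t(i := s)) j)) = (\<Prod>j\<in>A. wt (S j) (t j))" for s t
    using assms by (intro prod.cong) auto
  then show ?thesis unfolding mdd_def dd_def using assms
    by (simp add: sum_PiE_insert sum_distrib_left mult.assoc)
qed

lemma mdd_remove:
  assumes "finite A" "i \<in> A"
  shows "mdd A S f = dd (S i) (\<lambda>s. mdd (A - {i}) S (\<lambda>t. f (t(i := s))))"
  using mdd_insert[of "A - {i}" i S f] assms by (simp add: insert_absorb)

lemma mdd_add: "mdd A S (\<lambda>t. f t + g t) = mdd A S f + mdd A S g"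
  by (simp add: mdd_def algebra_simps sum.distrib)

lemma mdd_diff: "mdd A S (\<lambda>t. f t - g t) = mdd A S f - mdd A S g"
  by (simp add: mdd_def algebra_simps sum_subtractf)

lemma mdd_cmult: "mdd A S (\<lambda>t. c * g t) = c * mdd A S g"
  by (simp add: mdd_def algebra_simps sum_distrib_left)

lemma mdd_sum: "mdd A S (\<lambda>t. \<Sum>j\<in>J. g j t) = (\<Sum>j\<in>J. mdd A S (g j))"
  unfolding mdd_def by (simp add: sum_distrib_left sum.swap[of _ J])

lemma mdd_prod:
  assumes "finite A"
  shows "mdd A S (\<lambda>t. \<Prod>i\<in>A. k i (t i)) = (\<Prod>i\<in>A. dd (S i) (k i))"
  using assms
proof (induction A rule: finite_induct)
  case (insert i A)
  have "mdd (insert i A) S (\<lambda>t. \<Prod>j\<in>insert i A. k j (t j))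
      = dd (S i) (\<lambda>s. mdd A S (\<lambda>t. k i s * (\<Prod>j\<in>A. k j (t j))))"
    unfolding mdd_insert[OF insert(1,2)] using insert
    by (intro dd_cong mdd_cong) (auto intro!: prod.cong)
  also have "\<dots> = dd (S i) (\<lambda>s. (\<Prod>i\<in>A. dd (S i) (k i)) * k i s)"
    by (simp add: mdd_cmult insert mult.commute)
  finally show ?case using insert by (simp add: dd_cmult)
qed simp

text \<open>Identities between functionals in the single variables tensorize. They must hold for all
  \<open>g\<close>, because they are applied to partially evaluated differences of
  \<open>f\<close>.\<close>

lemma mdd_expansion:
  assumes "finite A"
    and "\<And>i g. i \<in> A \<Longrightarrow> dd (S i) g = (\<Sum>z\<in>J i. c i z * dd (V i z) g)"
  shows "mdd A S f = (\<Sum>z\<in>Pi\<^sub>E A J. (\<Prod>i\<in>A. c i (z i)) * mdd A (\<lambda>i. V i (z i)) f)"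
  using assms
proof (induction A arbitrary: f rule: finite_induct)
  case (insert i A)
  have *: "(\<Prod>j\<in>insert i A. c j ((z(i := y)) j)) * mdd (insert i A) (\<lambda>j. V j ((z(i := y)) j)) f
     = (\<Prod>j\<in>A. c j (z j)) * (c i y * dd (V i y) (\<lambda>s. mdd A (\<lambda>i. V i (z i)) (\<lambda>t. f (t(i := s)))))" for z y
  proof -
    have "(\<Prod>j\<in>A. c j ((z(i := y)) j)) = (\<Prod>j\<in>A. c j (z j))"
      using insert by (intro prod.cong) auto
    moreover have "mdd A (\<lambda>j. V j ((z(i := y)) j)) g = mdd A (\<lambda>j. V j (z j)) g" for g
      using insert by (intro mdd_cong) auto
    ultimately show ?thesis using insert by (simp add: mdd_insert mult_ac)
  qed
  have "mdd (insert i A) S f = dd (S i) (\<lambda>s. \<Sum>z\<in>Pi\<^sub>E A J. (\<Prod>i\<in>A. c i (z i)) * mdd A (\<lambda>i. V i (z i)) (\<lambda>t. f (t(i := s))))"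
    using insert by (simp add: mdd_insert)
  also have "\<dots> = (\<Sum>z\<in>Pi\<^sub>E A J. (\<Prod>i\<in>A. c i (z i)) * (\<Sum>y\<in>J i. c i y * dd (V i y) (\<lambda>s. mdd A (\<lambda>i. V i (z i)) (\<lambda>t. f (t(i := s))))))"
    using insert.prems by (simp add: dd_sum dd_cmult)
  also have "\<dots> = (\<Sum>y\<in>J i. \<Sum>z\<in>Pi\<^sub>E A J. (\<Prod>j\<in>A. c j (z j)) * (c i y * dd (V i y) (\<lambda>s. mdd A (\<lambda>i. V i (z i)) (\<lambda>t. f (t(i := s))))))"
    by (subst sum.swap) (simp add: sum_distrib_left)
  finally show ?case unfolding sum_PiE_insert[OF insert(2)] * .
qed simp

lemma multi_divided_diff_eq_mdd:
  assumes "\<And>i. i \<in> {1..d} \<Longrightarrow> inj_on (x i) {..n i}"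
  shows "multi_divided_diff d n x f = mdd {1..d} (\<lambda>i. x i ` {..n i}) f"
  using assms
proof (induction d arbitrary: f)
  case (Suc d)
  have "{1..Suc d} = insert (Suc d) {1..d}" by auto
  then show ?case using Suc by (simp add: mdd_insert divided_diff_eq_dd)
qed simp

definition nodes :: "nat \<Rightarrow> (nat \<Rightarrow> real set) \<Rightarrow> (nat \<Rightarrow> nat) \<Rightarrow> (nat \<Rightarrow> real set) \<Rightarrow> bool" where
  "nodes d I n S \<longleftrightarrow> (\<forall>i\<in>{1..d}. S i \<subseteq> I i \<and> finite (S i) \<and> card (S i) = n i + 1)"

lemma box_convex_iff: "box_convex d I n f \<longleftrightarrow> (\<forall>S. nodes d I n S \<longrightarrow> mdd {1..d} S f \<ge> 0)"
proof safe
  fix S assume f: "box_convex d I n f" and S: "nodes d I n S"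
  have "\<forall>i\<in>{1..d}. \<exists>g. bij_betw g {..n i} (S i)"
    using S by (auto simp: nodes_def intro!: finite_same_card_bij)
  then obtain x where x: "\<And>i. i \<in> {1..d} \<Longrightarrow> bij_betw (x i) {..n i} (S i)" by metis
  then have "multi_divided_diff d n x f = mdd {1..d} (\<lambda>i. x i ` {..n i}) f"
    by (intro multi_divided_diff_eq_mdd) (auto simp: bij_betw_def)
  also have "\<dots> = mdd {1..d} S f"
    using x by (intro mdd_cong) (auto simp: bij_betw_def)
  finally show "mdd {1..d} S f \<ge> 0"
    using f x S unfolding box_convex_def nodes_def bij_betw_def by (metis atMost_iff image_eqI subsetD)
next
  assume f: "\<forall>S. nodes d I n S \<longrightarrow> mdd {1..d} S f \<ge> 0"
  show "box_convex d I n f" unfolding box_convex_def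
  proof (intro allI impI)
    fix x assume x: "\<forall>i\<in>{1..d}. (\<forall>k\<le>n i. x i k \<in> I i) \<and> inj_on (x i) {..n i}"
    then have "nodes d I n (\<lambda>i. x i ` {..n i})"
      by (auto simp: nodes_def card_image)
    then show "0 \<le> multi_divided_diff d n x f"
      using f x multi_divided_diff_eq_mdd[of d x n f] by metis
  qed
qed

lemma mdd_pseudo_polynomial:
  assumes "pseudo_polynomial d I (\<lambda>i. n i - 1) W" "nodes d I n S" "\<And>i. i \<in> {1..d} \<Longrightarrow> n i \<ge> 1"
  shows "mdd {1..d} S W = 0"
proof -
  obtain A where A: "\<And>x. x \<in> Pi\<^sub>E {1..d} I \<Longrightarrow>
      W x = (\<Sum>i=1..d. \<Sum>k=0..n i - 1. A i k (restrict x ({1..d} - {i})) * x i ^ k)"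
    using assms(1) unfolding pseudo_polynomial_def by blast
  have "Pi\<^sub>E {1..d} S \<subseteq> Pi\<^sub>E {1..d} I" using assms(2) by (intro PiE_mono) (auto simp: nodes_def)
  then have "mdd {1..d} S W = mdd {1..d} S (\<lambda>x. \<Sum>i=1..d. \<Sum>k=0..n i - 1. A i k (restrict x ({1..d} - {i})) * x i ^ k)"
    by (intro mdd_cong) (auto simp: A)
  also have "\<dots> = (\<Sum>i=1..d. \<Sum>k=0..n i - 1. mdd {1..d} S (\<lambda>x. A i k (restrict x ({1..d} - {i})) * x i ^ k))"
    by (simp add: mdd_sum)
  also have "\<dots> = 0"
  proof (intro sum.neutral ballI)
    fix i k assume i: "i \<in> {1..d}" and k: "k \<in> {0..n i - 1}"
    let ?c = "mdd ({1..d} - {i}) S (\<lambda>t. A i k (restrict t ({1..d} - {i})))"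
    have "restrict (t(i := s)) ({1..d} - {i}) = restrict t ({1..d} - {i})" for t :: "nat \<Rightarrow> real" and s
      by (auto simp: restrict_def)
    then have "mdd {1..d} S (\<lambda>x. A i k (restrict x ({1..d} - {i})) * x i ^ k) = dd (S i) (\<lambda>s. ?c * s ^ k)"
      using i by (simp add: mdd_remove[of _ i] mdd_cmult[symmetric] mult.commute)
    also have "\<dots> = 0"
      unfolding dd_cmult using assms(2) assms(3)[OF i] i k by (subst dd_power) (auto simp: nodes_def)
    finally show "mdd {1..d} S (\<lambda>x. A i k (restrict x ({1..d} - {i})) * x i ^ k) = 0" .
  qed
  finally show ?thesis .
qed

section \<open>Interpolation errors and pseudo-polynomials\<close>

lemma lagrange_poly:
  assumes "finite Z" "z \<in> Z"
  obtains c where "\<And>t. lagrange Z z t = (\<Sum>k=0..card Z - 1. c k * t ^ k)"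
proof -
  let ?p = "smult (wt Z z) (\<Prod>y\<in>Z - {z}. [:- y, 1:])"
  have deg: "degree ?p \<le> card Z - 1"
  proof -
    have "degree (\<Prod>y\<in>Z - {z}. [:- y, 1:]) \<le> (\<Sum>y\<in>Z - {z}. degree [:- y, 1:])"
      using assms by (intro degree_prod_sum_le[THEN order_trans]) auto
    also have "\<dots> = card Z - 1" using assms by (simp add: card_Diff_singleton)
    finally show ?thesis by (simp add: degree_smult_eq)
  qed
  have "lagrange Z z t = (\<Sum>k=0..card Z - 1. coeff ?p k * t ^ k)" for t
  proof -
    have "lagrange Z z t = poly ?p t" by (simp add: lagrange_def poly_prod)
    also have "\<dots> = (\<Sum>k\<le>degree ?p. coeff ?p k * t ^ k)" by (rule poly_altdef)
    also have "\<dots> = (\<Sum>k=0..card Z - 1. coeff ?p k * t ^ k)"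
      using deg by (intro sum.mono_neutral_left) (auto simp del: degree_smult_eq coeff_smult simp: not_le coeff_eq_0)
    finally show ?thesis .
  qed
  then show ?thesis by (rule that)
qed

definition interp_error :: "(nat \<Rightarrow> real set) \<Rightarrow> nat \<Rightarrow> ((nat \<Rightarrow> real) \<Rightarrow> real) \<Rightarrow> (nat \<Rightarrow> real) \<Rightarrow> real" where
  "interp_error N i G x = G x - (\<Sum>z\<in>N i. lagrange (N i) z (x i) * G (x(i := z)))"

text \<open>The product \<open>(1 - P k) ... (1 - P 1)\<close>, where \<open>P i\<close> is
  interpolation at \<open>N i\<close> in the variable \<open>i\<close>. What it subtracts from
  \<open>F\<close> is the Boolean sum interpolant, a pseudo-polynomial.\<close>

primrec interp_errors :: "(nat \<Rightarrow> real set) \<Rightarrow> nat \<Rightarrow> ((nat \<Rightarrow> real) \<Rightarrow> real) \<Rightarrow> (nat \<Rightarrow> real) \<Rightarrow> real" where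
  "interp_errors N 0 F = F"
| "interp_errors N (Suc k) F = interp_error N (Suc k) (interp_errors N k F)"

lemma interp_error_node:
  assumes "finite (N i)" "x i \<in> N i"
  shows "interp_error N i G x = 0"
proof -
  have "(\<Sum>z\<in>N i. lagrange (N i) z (x i) * G (x(i := z)))
      = (\<Sum>z\<in>N i. if z = x i then G (x(i := z)) else 0)"
    using assms by (intro sum.cong) (auto simp: lagrange_node)
  then show ?thesis using assms by (simp add: interp_error_def)
qed

text \<open>At nodes \<open>insert (x i) (N i)\<close> has too few points for a divided difference.
  But each error vanishes at its own nodes, and later operators change only later coordinates, so
  the zero persists.\<close>

lemma interp_errors_node:
  assumes "\<And>i. i \<in> {1..k} \<Longrightarrow> finite (N i)" "\<exists>i\<in>{1..k}. x i \<in> N i"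
  shows "interp_errors N k F x = 0"
  using assms
proof (induction k arbitrary: x)
  case (Suc k)
  show ?case
  proof (cases "x (Suc k) \<in> N (Suc k)")
    case False
    then obtain i where i: "i \<in> {1..k}" "x i \<in> N i" using Suc.prems(2) by (auto simp: le_Suc_eq)
    have "interp_errors N k F (x(Suc k := z)) = 0" for z
      using i by (intro Suc.IH) (auto intro!: Suc.prems(1) bexI[of _ i])
    moreover from this[of "x (Suc k)"] have "interp_errors N k F x = 0" by simp
    ultimately show ?thesis by (simp add: interp_error_def)
  qed (simp add: interp_error_node Suc.prems(1))
qed simp

text \<open>The one-variable error formula, once per coordinate. The variables beyond
  \<open>k\<close> are still frozen at \<open>x\<close>, hence the case distinction in the argument
  of \<open>F\<close>.\<close>

lemma interp_errors_eq_mdd: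
  assumes "\<And>i. i \<in> {1..k} \<Longrightarrow> finite (N i)" "\<And>i. i \<in> {1..k} \<Longrightarrow> x i \<notin> N i"
  shows "interp_errors N k F x = (\<Prod>i=1..k. \<Prod>z\<in>N i. x i - z) *
    mdd {1..k} (\<lambda>i. insert (x i) (N i)) (\<lambda>t. F (\<lambda>i. if i \<in> {1..k} then t i else x i))"
  using assms
proof (induction k arbitrary: x)
  case (Suc k)
  let ?S = "\<lambda>i. insert (x i) (N i)" and ?w = "\<Prod>i=1..k. \<Prod>z\<in>N i. x i - z"
  have ins: "{1..Suc k} = insert (Suc k) {1..k}" by auto
  have "interp_errors N (Suc k) F x
      = dd (?S (Suc k)) (\<lambda>s. interp_errors N k F (x(Suc k := s))) * (\<Prod>z\<in>N (Suc k). x (Suc k) - z)"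
    using Suc.prems by (simp add: dd_insert_interpolation interp_error_def)
  also have "dd (?S (Suc k)) (\<lambda>s. interp_errors N k F (x(Suc k := s)))
      = dd (?S (Suc k)) (\<lambda>s. ?w * mdd {1..k} ?S (\<lambda>t. F (\<lambda>i. if i \<in> {1..Suc k} then (t(Suc k := s)) i else x i)))"
  proof (rule dd_cong)
    fix s
    let ?y = "x(Suc k := s)"
    have "interp_errors N k F ?y = (\<Prod>i=1..k. \<Prod>z\<in>N i. ?y i - z) *
      mdd {1..k} (\<lambda>i. insert (?y i) (N i)) (\<lambda>t. F (\<lambda>i. if i \<in> {1..k} then t i else ?y i))"
      by (rule Suc.IH) (use Suc.prems in auto)
    also have "(\<Prod>i=1..k. \<Prod>z\<in>N i. ?y i - z) = ?w" by (intro prod.cong) auto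
    also have "mdd {1..k} (\<lambda>i. insert (?y i) (N i)) (\<lambda>t. F (\<lambda>i. if i \<in> {1..k} then t i else ?y i))
      = mdd {1..k} ?S (\<lambda>t. F (\<lambda>i. if i \<in> {1..Suc k} then (t(Suc k := s)) i else x i))"
      by (rule mdd_cong) (auto intro!: arg_cong[of _ _ F] simp: fun_eq_iff)
    finally show "interp_errors N k F ?y = ?w * mdd {1..k} ?S (\<lambda>t. F (\<lambda>i. if i \<in> {1..Suc k} then (t(Suc k := s)) i else x i))" .
  qed
  also have "\<dots> = ?w * mdd {1..Suc k} ?S (\<lambda>t. F (\<lambda>i. if i \<in> {1..Suc k} then t i else x i))"
    unfolding dd_cmult ins by (simp add: mdd_insert)
  finally show ?case by (simp add: mult_ac)
qed simp

text \<open>Since the full product of errors vanishes, \<open>F\<close> telescopes into differences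
  of successive errors. The \<open>i\<close>-th difference is the interpolant of the previous error
  in the variable \<open>i\<close>: a polynomial of degree at most \<open>n i - 1\<close> in
  \<open>x i\<close> whose coefficients are built from values with \<open>x i\<close> replaced by
  nodes.\<close>

lemma pseudo_polynomial_of_mdd_0:
  assumes inf: "\<And>i. i \<in> {1..d} \<Longrightarrow> infinite (I i)" and n: "\<And>i. i \<in> {1..d} \<Longrightarrow> n i \<ge> 1"
    and F: "\<And>S. nodes d I n S \<Longrightarrow> mdd {1..d} S F = 0"
  shows "pseudo_polynomial d I (\<lambda>i. n i - 1) F"
proof -
  have "\<forall>i\<in>{1..d}. \<exists>Z\<subseteq>I i. finite Z \<and> card Z = n i"
    using inf infinite_arbitrarily_large by metis
  then obtain N where N: "\<And>i. i \<in> {1..d} \<Longrightarrow> N i \<subseteq> I i \<and> finite (N i) \<and> card (N i) = n i" by metis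
  have "\<forall>i\<in>{1..d}. \<forall>z\<in>N i. \<exists>c. \<forall>t. lagrange (N i) z t = (\<Sum>k=0..n i - 1. c k * t ^ k)"
    using N lagrange_poly by metis
  then obtain c where c: "\<And>i z t. i \<in> {1..d} \<Longrightarrow> z \<in> N i \<Longrightarrow> lagrange (N i) z t = (\<Sum>k=0..n i - 1. c i z k * t ^ k)"
    by metis
  define A where "A i k y = (\<Sum>z\<in>N i. c i z k * interp_errors N (i - 1) F (y(i := z)))" for i k y
  show ?thesis unfolding pseudo_polynomial_def
  proof (intro exI[of _ A] ballI)
    fix x assume x: "x \<in> Pi\<^sub>E {1..d} I"
    have 0: "interp_errors N d F x = 0"
    proof (cases "\<exists>i\<in>{1..d}. x i \<in> N i")
      case True
      then show ?thesis using N by (intro interp_errors_node) auto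
    next
      case False
      have "mdd {1..d} (\<lambda>i. insert (x i) (N i)) (\<lambda>t. F (\<lambda>i. if i \<in> {1..d} then t i else x i))
          = mdd {1..d} (\<lambda>i. insert (x i) (N i)) F"
      proof (rule mdd_cong[OF refl])
        fix t assume "t \<in> Pi\<^sub>E {1..d} (\<lambda>i. insert (x i) (N i))"
        then have "(if i \<in> {1..d} then t i else x i) = t i" for i
          using PiE_arb[OF x, of i] PiE_arb[of t _ _ i] by metis
        then show "F (\<lambda>i. if i \<in> {1..d} then t i else x i) = F t" by simp
      qed
      also have "\<dots> = 0"
        using False N x by (intro F) (auto simp: nodes_def PiE_mem)
      finally show ?thesis using False N by (subst interp_errors_eq_mdd) auto
    qed
    have step: "interp_errors N (i - 1) F x - interp_errors N i F x
       = (\<Sum>k=0..n i - 1. A i k (restrict x ({1..d} - {i})) * x i ^ k)" if i: "i \<in> {1..d}" for i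
    proof -
      obtain j where j: "i = Suc j" using i by (cases i) auto
      have upd: "(restrict x ({1..d} - {i}))(i := z) = x(i := z)" for z
      proof
        fix l
        show "((restrict x ({1..d} - {i}))(i := z)) l = (x(i := z)) l"
          using PiE_arb[OF x, of l] by (cases "l \<in> {1..d}"; cases "l = i") (simp_all add: restrict_def)
      qed
      have "(\<Sum>k=0..n i - 1. A i k (restrict x ({1..d} - {i})) * x i ^ k)
        = (\<Sum>k=0..n i - 1. \<Sum>z\<in>N i. c i z k * x i ^ k * interp_errors N j F (x(i := z)))"
        unfolding A_def upd sum_distrib_right by (intro sum.cong refl) (simp add: j)
      also have "\<dots> = (\<Sum>z\<in>N i. lagrange (N i) z (x i) * interp_errors N j F (x(i := z)))"
        by (subst sum.swap) (simp add: c[OF i] sum_distrib_right)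
      finally show ?thesis by (simp add: j interp_error_def)
    qed
    have "F x = interp_errors N 0 F x - interp_errors N d F x" using 0 by simp
    also have "\<dots> = (\<Sum>i=1..d. interp_errors N (i - 1) F x - interp_errors N i F x)"
      by (induction d) (auto simp: sum.atLeast_Suc_atMost_Suc_shift)
    finally show "F x = (\<Sum>i=1..d. \<Sum>k=0..n i - 1. A i k (restrict x ({1..d} - {i})) * x i ^ k)"
      using step by simp
  qed
qed

section \<open>Continuity in each variable and reduction to rational nodes\<close>

lemma lagrange_tendsto [tendsto_intros]:
  "((\<lambda>t. lagrange Z z t) \<longlongrightarrow> lagrange Z z c) (at c within A)"
  unfolding lagrange_def by (intro tendsto_intros)

lemma interpolation_node:
  assumes "finite Z" "t \<in> Z"
  shows "(\<Sum>z\<in>Z. lagrange Z z t * h z) = h t"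
proof -
  have "(\<Sum>z\<in>Z. lagrange Z z t * h z) = (\<Sum>z\<in>Z. if z = t then h z else 0)"
    using assms by (intro sum.cong) (auto simp: lagrange_node)
  then show ?thesis using assms by simp
qed

text \<open>Near \<open>c\<close> the function lies between two interpolating polynomials through \<open>(c, h c)\<close> whose
  node polynomials have opposite signs.\<close>
lemma convex_imp_isCont:
  assumes "open I" "c \<in> I" "n \<ge> 2"
    and h: "\<And>S. S \<subseteq> I \<Longrightarrow> finite S \<Longrightarrow> card S = n + 1 \<Longrightarrow> dd S h \<ge> 0"
  shows "isCont h c"
proof -
  obtain e where e: "e > 0" "ball c e \<subseteq> I" using assms(1,2) open_contains_ball by blast
  \<comment> \<open>\<open>Y\<close> provides \<open>n - 2\<close> common nodes further left. With
    \<open>c\<close> and either \<open>y1\<close> or \<open>y2\<close> this makes \<open>n\<close>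
    nodes, and for \<open>t\<close> within \<open>e / 4\<close> of \<open>c\<close> the two node
    polynomials differ only in the factors \<open>t - y1 > 0\<close> and
    \<open>t - y2 < 0\<close>.\<close>
  have "infinite {c - e<..<c - e / 2}" using e by (intro infinite_Ioo) auto
  then obtain Y where Y: "Y \<subseteq> {c - e<..<c - e / 2}" "finite Y" "card Y = n - 2"
    using infinite_arbitrarily_large by metis
  define y1 y2 where "y1 = c - e / 4" and "y2 = c + e / 4"
  define Z1 Z2 where "Z1 = insert c (insert y1 Y)" and "Z2 = insert c (insert y2 Y)"
  define p where "p Z t = (\<Sum>z\<in>Z. lagrange Z z t * h z)" for Z t
  have notin: "c \<notin> insert y1 Y" "c \<notin> insert y2 Y" "y1 \<notin> Y" "y2 \<notin> Y"
    using Y e by (auto simp: y1_def y2_def)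
  have Z: "finite Z1" "finite Z2" "card Z1 = n" "card Z2 = n" "Z1 \<subseteq> I" "Z2 \<subseteq> I"
  proof -
    show "card Z1 = n" "card Z2 = n" using notin Y assms(3) by (auto simp: Z1_def Z2_def)
    have "Y \<subseteq> ball c e" "y1 \<in> ball c e" "y2 \<in> ball c e" using Y e by (auto simp: y1_def y2_def dist_real_def)
    then show "Z1 \<subseteq> I" "Z2 \<subseteq> I" using e assms(2) by (auto simp: Z1_def Z2_def)
  qed (use Y in \<open>auto simp: Z1_def Z2_def\<close>)
  have "((\<lambda>t. p Z t) \<longlongrightarrow> p Z c) (at c)" for Z
    unfolding p_def by (intro tendsto_intros)
  moreover have "p Z1 c = h c" "p Z2 c = h c"
    using Z by (auto simp: p_def interpolation_node Z1_def Z2_def)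
  ultimately have lim: "(p Z1 \<longlongrightarrow> h c) (at c)" "(p Z2 \<longlongrightarrow> h c) (at c)" by metis+
  have ev: "eventually (\<lambda>t. norm (h t - h c) \<le> \<bar>p Z1 t - h c\<bar> + \<bar>p Z2 t - h c\<bar>) (at c)"
    unfolding eventually_at
  proof (intro exI[of _ "e / 4"] conjI ballI impI)
    fix t assume t: "t \<noteq> c \<and> dist t c < e / 4"
    then have "\<bar>t - c\<bar> < e / 4" by (simp add: dist_real_def)
    then have tc: "y1 < t" "t < y2" "t \<in> ball c e"
      using e(1) unfolding y1_def y2_def mem_ball dist_real_def by linarith+
    have tI: "t \<in> I" using tc(3) e(2) by auto
    have tY: "t \<notin> Y" using Y tc e by (auto simp: y1_def)
    have *: "dd (insert t Z) h * (\<Prod>z\<in>Z. t - z) = h t - p Z t" "dd (insert t Z) h \<ge> 0"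
      if "Z = Z1 \<or> Z = Z2" for Z
    proof -
      have "t \<notin> Z" using that tc t tY by (auto simp: Z1_def Z2_def)
      then show "dd (insert t Z) h * (\<Prod>z\<in>Z. t - z) = h t - p Z t" "dd (insert t Z) h \<ge> 0"
        using that Z tI by (auto simp: p_def dd_insert_interpolation intro!: h)
    qed
    let ?Q = "(t - c) * (\<Prod>z\<in>Y. t - z)"
    have w: "(\<Prod>z\<in>Z1. t - z) = (t - y1) * ?Q" "(\<Prod>z\<in>Z2. t - z) = (t - y2) * ?Q"
      using notin Y by (auto simp: Z1_def Z2_def)
    \<comment> \<open>By the error formula both errors contain \<open>?Q\<close>, which appears
      squared; the product is \<open>\<le> 0\<close>, that is, \<open>h t\<close> lies between the
      two interpolants.\<close>
    have "(h t - p Z1 t) * (h t - p Z2 t)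
        = - ((dd (insert t Z1) h * dd (insert t Z2) h) * ((t - y1) * (y2 - t)) * (?Q * ?Q))"
    proof -
      have "(D1 * (u * q)) * (D2 * (v * q)) = - ((D1 * D2) * (u * - v) * (q * q))" for D1 D2 u v q :: real
        by (simp add: mult_ac)
      from this[of "dd (insert t Z1) h" "t - y1" ?Q "dd (insert t Z2) h" "t - y2"] show ?thesis
        using *(1)[of Z1] *(1)[of Z2] w by (simp only: minus_diff_eq simp_thms)
    qed
    also have "\<dots> \<le> 0" using *(2)[of Z1] *(2)[of Z2] tc by simp
    finally have "h t \<le> p Z1 t \<and> p Z2 t \<le> h t \<or> h t \<le> p Z2 t \<and> p Z1 t \<le> h t"
      by (auto simp: mult_le_0_iff)
    then show "norm (h t - h c) \<le> \<bar>p Z1 t - h c\<bar> + \<bar>p Z2 t - h c\<bar>" by auto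
  qed (use e in auto)
  have "((\<lambda>t. \<bar>p Z1 t - h c\<bar> + \<bar>p Z2 t - h c\<bar>) \<longlongrightarrow> \<bar>h c - h c\<bar> + \<bar>h c - h c\<bar>) (at c)"
    by (intro tendsto_intros lim)
  then have "((\<lambda>t. h t - h c) \<longlongrightarrow> 0) (at c)"
    by (intro Lim_null_comparison[OF ev]) simp
  then show ?thesis by (simp add: isCont_def LIM_zero_cancel)
qed

lemma obtain_rational_nodes:
  fixes a b :: real
  assumes "a < b"
  obtains Z where "Z \<subseteq> \<rat> \<inter> {a<..<b}" "finite Z" "card Z = m"
proof -
  have "\<exists>Z. Z \<subseteq> \<rat> \<inter> {a<..<b} \<and> finite Z \<and> card Z = m" using assms
  proof (induction m arbitrary: b)
    case (Suc m)
    obtain r where r: "r \<in> \<rat>" "a < r" "r < b" using Rats_dense_in_real[OF Suc.prems] by blast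
    obtain Z where "Z \<subseteq> \<rat> \<inter> {a<..<r}" "finite Z" "card Z = m" using Suc.IH[OF r(2)] by blast
    then show ?case using r by (intro exI[of _ "insert r Z"]) (auto simp: card_insert_if)
  qed (intro exI[of _ "{}"], auto)
  then show ?thesis using that by blast
qed

text \<open>Interpolation at \<open>n\<close> fixed rational points is exact at all rational points
  of \<open>I\<close> by the error formula, then on all of \<open>I\<close> by continuity. So
  \<open>h\<close> coincides on \<open>I\<close> with a polynomial of degree below
  \<open>n\<close>.\<close>

lemma dd_eq_0_of_rational:
  assumes "open I" "continuous_on I h" "n \<ge> 1"
    and h: "\<And>S. S \<subseteq> I \<inter> \<rat> \<Longrightarrow> finite S \<Longrightarrow> card S = n + 1 \<Longrightarrow> dd S h = 0"
    and S: "S \<subseteq> I" "finite S" "card S = n + 1"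
  shows "dd S h = 0"
proof -
  have rat: "\<exists>r\<in>U. r \<in> \<rat>" if U: "open U" "x \<in> U" for U and x :: real
  proof -
    obtain e where "e > 0" "ball x e \<subseteq> U" using U open_contains_ball by blast
    moreover obtain r where "r \<in> \<rat>" "x < r" "r < x + e" using Rats_dense_in_real[of x "x + e"] \<open>e > 0\<close> by auto
    ultimately show ?thesis by (force simp: dist_real_def)
  qed
  obtain c where "c \<in> S" using S by fastforce
  then obtain e where e: "e > 0" "ball c e \<subseteq> I" using assms(1) S open_contains_ball by blast
  obtain Z where Z: "Z \<subseteq> \<rat> \<inter> {c - e<..<c + e}" "finite Z" "card Z = n"
    using e obtain_rational_nodes[of "c - e" "c + e"] by auto
  then have ZI: "Z \<subseteq> I \<inter> \<rat>" using e by (force simp: dist_real_def)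
  define p where "p t = (\<Sum>z\<in>Z. lagrange Z z t * h z)" for t
  have hp: "h t = p t" if "t \<in> I \<inter> \<rat>" for t
  proof (cases "t \<in> Z")
    case True
    then show ?thesis using Z by (simp add: p_def interpolation_node)
  next
    case False
    then have "dd (insert t Z) h = 0" using that Z ZI by (intro h) auto
    then show ?thesis using dd_insert_interpolation[OF Z(2) False, of h] by (simp add: p_def)
  qed
  have "continuous_on I (\<lambda>t. h t - p t)" unfolding p_def
    by (intro continuous_intros assms(2)) (auto simp: continuous_on_def intro!: tendsto_intros)
  then have op: "open ((\<lambda>t. h t - p t) -` (- {0}) \<inter> I)"
    using assms(1) by (metis continuous_on_open_vimage open_Compl closed_singleton)
  have "h t = p t" if tI: "t \<in> I" for t
  proof (rule ccontr)
    assume "h t \<noteq> p t"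
    then have "t \<in> (\<lambda>t. h t - p t) -` (- {0}) \<inter> I" using tI by simp
    from rat[OF op this] show False using hp by auto
  qed
  then have "dd S h = dd S p" using S by (intro dd_cong) auto
  also have "\<dots> = (\<Sum>z\<in>Z. h z * (wt Z z * dd S (\<lambda>t. \<Prod>y\<in>Z - {z}. t - y)))"
    unfolding p_def lagrange_def dd_sum dd_cmult[symmetric] by (intro sum.cong dd_cong) (auto simp: mult_ac)
  also have "\<dots> = 0"
  proof (intro sum.neutral ballI)
    fix z assume z: "z \<in> Z"
    then have "card (Z - {z}) < card Z" using Z by (intro card_Diff1_less)
    then have "dd S (\<lambda>t. \<Prod>y\<in>Z - {z}. t - y) = 0"
      using Z S by (intro dd_prod_linear) auto
    then show "h z * (wt Z z * dd S (\<lambda>t. \<Prod>y\<in>Z - {z}. t - y)) = 0" by simp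
  qed
  finally show ?thesis .
qed

text \<open>The coordinates in \<open>B\<close> are freed from rationality one at a time. With all
  other nodes fixed, possibly irrational, the remaining function of the variable \<open>i\<close>
  has nonnegative divided differences, hence is continuous; this holds for \<open>f\<close> and
  \<open>g\<close>, so \<open>dd_eq_0_of_rational\<close> applies to their difference.\<close>

lemma mdd_eq_of_rational:
  assumes I: "\<And>i. i \<in> {1..d} \<Longrightarrow> open (I i)" and n: "\<And>i. i \<in> {1..d} \<Longrightarrow> n i \<ge> 2"
    and f: "box_convex d I n f" and g: "box_convex d I n g"
    and eq: "\<And>S. nodes d I n S \<Longrightarrow> (\<And>i. i \<in> {1..d} \<Longrightarrow> S i \<subseteq> \<rat>) \<Longrightarrow> mdd {1..d} S f = mdd {1..d} S g"
    and S: "nodes d I n S"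
  shows "mdd {1..d} S f = mdd {1..d} S g"
proof -
  have "mdd {1..d} S f = mdd {1..d} S g"
    if "finite B" "nodes d I n S" "\<forall>i\<in>{1..d} - B. S i \<subseteq> \<rat>" for B S
    using that
  proof (induction B arbitrary: S rule: finite_induct)
    case (insert i B)
    show ?case
    proof (cases "i \<in> {1..d}")
      case False
      then show ?thesis using insert by (intro insert.IH) auto
    next
      case True
      let ?h = "\<lambda>f s. mdd ({1..d} - {i}) S (\<lambda>t. f (t(i := s)))"
      have dd_h: "dd T (?h f) = mdd {1..d} (S(i := T)) f" for T f
      proof -
        have "?h f s = mdd ({1..d} - {i}) (S(i := T)) (\<lambda>t. f (t(i := s)))" for s
          by (rule mdd_cong) auto
        then show ?thesis using True by (simp add: mdd_remove[of _ i "S(i := T)"])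
      qed
      have nodesT: "nodes d I n (S(i := T))" if "T \<subseteq> I i" "finite T" "card T = n i + 1" for T
        using insert.prems(1) that by (auto simp: nodes_def)
      have cont: "continuous_on (I i) (?h f)" if "box_convex d I n f" for f
      proof (intro continuous_at_imp_continuous_on ballI convex_imp_isCont[OF I[OF True] _ n[OF True]])
        fix T assume "T \<subseteq> I i" "finite T" "card T = n i + 1"
        then show "dd T (?h f) \<ge> 0" unfolding dd_h using nodesT that box_convex_iff by blast
      qed
      have "dd (S i) (\<lambda>s. ?h f s - ?h g s) = 0"
      proof (rule dd_eq_0_of_rational[OF I[OF True]])
        show "continuous_on (I i) (\<lambda>s. ?h f s - ?h g s)"
          by (intro continuous_intros cont f g)
        fix T assume T: "T \<subseteq> I i \<inter> \<rat>" "finite T" "card T = n i + 1"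
        have "mdd {1..d} (S(i := T)) f = mdd {1..d} (S(i := T)) g"
          using T insert.prems(2) by (intro insert.IH nodesT) auto
        then show "dd T (\<lambda>s. ?h f s - ?h g s) = 0" unfolding dd_diff dd_h by simp
      qed (use n[OF True] insert.prems True in \<open>auto simp: nodes_def\<close>)
      then have "mdd {1..d} (S(i := S i)) f = mdd {1..d} (S(i := S i)) g" unfolding dd_diff dd_h by simp
      then show ?thesis by simp
    qed
  qed (use eq in auto)
  from this[of "{1..d}"] S show ?thesis by auto
qed

section \<open>Vague limits of discrete measures\<close>

lemma binary_expansion:
  fixes y :: real
  assumes "0 \<le> y" "y < 1"
  obtains a where "\<And>k. a k \<in> {0, 1}" "(\<lambda>k. (1 / 2) ^ Suc k * a k) sums y"
proof -
  define a where "a k = real_of_int (\<lfloor>2 ^ Suc k * y\<rfloor> - 2 * \<lfloor>2 ^ k * y\<rfloor>)" for k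
  have digit: "a k \<in> {0, 1}" for k
  proof -
    have "2 * \<lfloor>2 ^ k * y\<rfloor> \<le> \<lfloor>2 * (2 ^ k * y)\<rfloor>" "\<lfloor>2 * (2 ^ k * y)\<rfloor> < 2 * \<lfloor>2 ^ k * y\<rfloor> + 2"
      by linarith+
    then have "\<lfloor>2 ^ Suc k * y\<rfloor> - 2 * \<lfloor>2 ^ k * y\<rfloor> \<in> {0, 1}" by (auto simp: mult.assoc)
    then show ?thesis unfolding a_def by auto
  qed
  have sum: "(\<Sum>k<K. (1 / 2) ^ Suc k * a k) = of_int \<lfloor>2 ^ K * y\<rfloor> / 2 ^ K" for K
  proof (induction K)
    case 0
    have "\<lfloor>y\<rfloor> = 0" using assms by linarith
    then show ?case by simp
  next
    case (Suc K)
    then show ?case by (simp add: a_def field_simps power_divide)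
  qed
  have "(\<lambda>K. of_int \<lfloor>2 ^ K * y\<rfloor> / 2 ^ K) \<longlonglongrightarrow> y"
  proof (rule tendsto_sandwich)
    show "(\<lambda>K. y - (1 / 2) ^ K) \<longlonglongrightarrow> y"
      using tendsto_diff[OF tendsto_const LIMSEQ_power_zero[of "1/2::real"], of y] by simp
    show "\<forall>\<^sub>F K in sequentially. y - (1 / 2) ^ K \<le> of_int \<lfloor>2 ^ K * y\<rfloor> / 2 ^ K"
    proof (rule always_eventually, rule allI)
      fix K
      have "2 ^ K * y - 1 \<le> of_int \<lfloor>2 ^ K * y\<rfloor>" by linarith
      moreover have "(y - (1 / 2) ^ K) * 2 ^ K = 2 ^ K * y - 1" by (simp add: field_simps power_divide)
      ultimately show "y - (1 / 2) ^ K \<le> of_int \<lfloor>2 ^ K * y\<rfloor> / 2 ^ K"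
        by (simp add: pos_le_divide_eq)
    qed
    show "\<forall>\<^sub>F K in sequentially. of_int \<lfloor>2 ^ K * y\<rfloor> / 2 ^ K \<le> y"
      by (intro always_eventually allI) (simp add: field_simps)
  qed simp
  then have "(\<lambda>k. (1 / 2) ^ Suc k * a k) sums y" unfolding sums_def sum .
  then show ?thesis by (rule that[OF digit])
qed

text \<open>Schoenberg's space-filling curve, with values in the Hilbert cube: the coordinates read off the
  binary digits of a point from disjoint subsequences of the digits of a ternary expansion.\<close>
definition digit_fun :: "real \<Rightarrow> real" where
  "digit_fun t = max 0 (min 1 (1 / 2 - cos (pi * t)))"

definition schoenberg :: "nat \<Rightarrow> real \<Rightarrow> real" where
  "schoenberg i t = (\<Sum>k. (1 / 2) ^ Suc k * digit_fun (3 ^ prod_encode (k, i) * t))"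

lemma digit_fun_bounds: "0 \<le> digit_fun t" "digit_fun t \<le> 1"
  by (auto simp: digit_fun_def)

text \<open>\<open>digit_fun\<close> has period 2, is 0 where the cosine is at least 1/2 and 1 where
  it is at most -1/2, so it is constant on the first and on the last third of \<open>{0..1}\<close>.
  It reads off a leading ternary digit \<open>2 * a\<close> whatever the remainder
  \<open>R\<close>.\<close>

lemma digit_fun_digit:
  assumes "a \<in> {0, 1}" "0 \<le> R" "R \<le> 1" "t = 2 * of_int m + (2 * a + R) / 3"
  shows "digit_fun t = a"
proof -
  let ?s = "(2 * a + R) / 3"
  have "pi * t = pi * ?s + 2 * pi * of_int m" using assms(4) by (simp add: algebra_simps)
  then have c: "cos (pi * t) = cos (pi * ?s)" by (simp add: cos_add cos_int_2pin sin_int_2pin)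
  show ?thesis
  proof (cases "a = 0")
    case True
    have "cos (pi / 3) \<le> cos (pi * ?s)"
      by (rule cos_monotone_0_pi_le) (use True assms in \<open>auto simp: field_simps\<close>)
    then show ?thesis using c True by (simp add: digit_fun_def cos_60)
  next
    case False
    have "cos (pi * ?s) \<le> cos (2 / 3 * pi)"
      by (rule cos_monotone_0_pi_le) (use False assms in \<open>auto simp: field_simps\<close>)
    moreover have "cos (2 / 3 * pi) = - 1 / 2"
      using cos_double_cos[of "pi / 3"] by (simp add: cos_60 power2_eq_square mult.commute)
    ultimately show ?thesis using c False assms by (simp add: digit_fun_def)
  qed
qed

text \<open>The parameter is the point of the Cantor set with ternary digits \<open>2 * b m\<close>,
  where \<open>b\<close> interleaves the binary digits of all \<open>y i\<close> along
  \<open>prod_encode\<close>. As all digits are even, multiplication by \<open>3 ^ j\<close> yields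
  an even integer plus the rescaled tail \<open>T j\<close>, and \<open>digit_fun\<close> ignores
  even integers.\<close>

lemma schoenberg_surj:
  assumes y: "\<And>i. 0 \<le> y i" "\<And>i. y i < 1"
  obtains t where "t \<in> {0..1}" "\<And>i. schoenberg i t = y i"
proof -
  have "\<forall>i. \<exists>a. (\<forall>k. a k \<in> {0, 1}) \<and> (\<lambda>k. (1 / 2) ^ Suc k * a k) sums y i"
    using binary_expansion[OF y] by metis
  then obtain a where a: "\<And>i k. a i k \<in> {0, 1::real}" "\<And>i. (\<lambda>k. (1 / 2) ^ Suc k * a i k) sums y i"
    by metis
  define b where "b m = a (snd (prod_decode m)) (fst (prod_decode m))" for m
  have b: "b m \<in> {0, 1}" for m unfolding b_def by (rule a)
  have b01: "0 \<le> b m" "b m \<le> 1" for m using b[of m] by auto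
  define T where "T j = (\<Sum>m. 2 / 3 * (1 / 3) ^ m * b (m + j))" for j
  have le: "2 / 3 * (1 / 3) ^ m * b (m + j) \<le> 2 / 3 * (1 / 3) ^ m" for m j
    using b01[of "m + j"] by (simp add: mult_left_le)
  have geo: "(\<lambda>m. 2 / 3 * (1 / 3) ^ m) sums (1::real)"
    using sums_mult[OF geometric_sums[of "1 / 3 :: real"], of "2 / 3"] by simp
  have summ: "summable (\<lambda>m. 2 / 3 * (1 / 3) ^ m * b (m + j))" for j
    by (rule summable_comparison_test'[OF sums_summable[OF geo]]) (use le b01 in auto)
  have T01: "0 \<le> T j" "T j \<le> 1" for j
  proof -
    show "0 \<le> T j" unfolding T_def by (intro suminf_nonneg summ) (use b01 in auto)
    have "T j \<le> (\<Sum>m. 2 / 3 * (1 / 3) ^ m)"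
      unfolding T_def by (intro suminf_le le summ sums_summable[OF geo])
    then show "T j \<le> 1" using geo by (simp add: sums_iff)
  qed
  have rec: "T j = (2 * b j + T (Suc j)) / 3" for j
  proof -
    have "T j = 2 / 3 * b j + (\<Sum>m. 1 / 3 * (2 / 3 * (1 / 3) ^ m * b (m + Suc j)))"
      using suminf_split_head[OF summ[of j]] by (simp add: T_def)
    also have "(\<Sum>m. 1 / 3 * (2 / 3 * (1 / 3) ^ m * b (m + Suc j))) = 1 / 3 * T (Suc j)"
      unfolding T_def by (rule suminf_mult[OF summ])
    finally show ?thesis by simp
  qed
  have "\<exists>m::int. 3 ^ j * T 0 = 2 * of_int m + T j" for j
  proof (induction j)
    case 0
    show ?case by (intro exI[of _ 0]) simp
  next
    case (Suc j)
    then obtain m :: int where "3 ^ j * T 0 = 2 * of_int m + T j" by blast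
    moreover have "3 ^ Suc j * T 0 = 3 * (3 ^ j * T 0)" by simp
    ultimately have "3 ^ Suc j * T 0 = 2 * (3 * of_int m + b j) + T (Suc j)" using rec[of j] by argo
    moreover obtain e :: int where "b j = of_int e" using b[of j] by (metis empty_iff insertE of_int_0 of_int_1)
    ultimately show ?case by (intro exI[of _ "3 * m + e"]) simp
  qed
  then have "digit_fun (3 ^ j * T 0) = b j" for j
    using digit_fun_digit[OF b T01, of "3 ^ j * T 0" _ j] rec[of j] by metis
  then have "schoenberg i (T 0) = y i" for i
    using a(2)[of i] by (simp add: schoenberg_def b_def sums_iff)
  then show ?thesis using that[of "T 0"] T01[of 0] by simp
qed

lemma continuous_on_suminf_Weierstrass:
  fixes f :: "nat \<Rightarrow> 'a::topological_space \<Rightarrow> real"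
  assumes "\<And>k. continuous_on A (f k)" "\<And>k x. x \<in> A \<Longrightarrow> \<bar>f k x\<bar> \<le> M k" "summable M"
  shows "continuous_on A (\<lambda>x. \<Sum>k. f k x)"
proof (rule uniform_limit_theorem)
  show "uniform_limit A (\<lambda>n x. \<Sum>i<n. f i x) (\<lambda>x. \<Sum>k. f k x) sequentially"
    by (rule Weierstrass_m_test[OF _ assms(3)]) (use assms(2) in auto)
  show "\<forall>\<^sub>F n in sequentially. continuous_on A (\<lambda>x. \<Sum>i<n. f i x)"
    by (intro always_eventually allI continuous_intros assms)
qed simp

lemma half_powers: "(\<lambda>k. (1 / 2) ^ Suc k) sums (1::real)"
  using power_half_series by simp

lemma continuous_schoenberg [continuous_intros]: "continuous_on A (schoenberg i)"
  unfolding schoenberg_def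
proof (rule continuous_on_suminf_Weierstrass)
  show "summable (\<lambda>k. (1 / 2 :: real) ^ Suc k)" using half_powers by (rule sums_summable)
  show "continuous_on A (\<lambda>x. (1 / 2) ^ Suc k * digit_fun (3 ^ prod_encode (k, i) * x))" for k
    unfolding digit_fun_def by (intro continuous_intros)
  show "\<bar>(1 / 2) ^ Suc k * digit_fun (3 ^ prod_encode (k, i) * x)\<bar> \<le> (1 / 2) ^ Suc k" for k x
    using digit_fun_bounds by (simp add: abs_mult mult_left_le)
qed

text \<open>Discrete probability measures are carried to the line, where all their mass sits in
  \<open>{0..1}\<close>; hence they are tight and have a weakly convergent subsequence.\<close>

lemma weak_limit_atoms:
  fixes J :: "nat \<Rightarrow> 'j set" and w s :: "nat \<Rightarrow> 'j \<Rightarrow> real"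
  assumes fin: "\<And>N. finite (J N)" and w: "\<And>N j. j \<in> J N \<Longrightarrow> 0 \<le> w N j" "\<And>N. (\<Sum>j\<in>J N. w N j) = 1"
    and s: "\<And>N j. j \<in> J N \<Longrightarrow> s N j \<in> {0..1}"
  obtains r M where "strict_mono (r :: nat \<Rightarrow> nat)" "real_distribution M"
    "\<And>f B. (\<And>x. isCont f x) \<Longrightarrow> (\<And>x. norm (f x) \<le> B) \<Longrightarrow>
       (\<lambda>N. \<Sum>j\<in>J (r N). w (r N) j * f (s (r N) j)) \<longlonglongrightarrow> (\<integral>x. f x \<partial>M)"
proof -
  define D where "D N = distr (point_measure (J N) (w N)) borel (s N)" for N
  have meas: "s N \<in> measurable (point_measure (J N) (w N)) borel" for N
    by (simp add: measurable_point_measure_eq1)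
  have ps: "prob_space (D N)" for N
    unfolding D_def by (intro prob_space.prob_space_distr meas prob_space_point_measure fin)
      (use w in \<open>auto simp: ennreal_1[symmetric] sum_ennreal simp del: ennreal_1\<close>)
  then have rd: "real_distribution (D N)" for N
    by (simp add: real_distribution_def real_distribution_axioms_def) (simp add: D_def)
  have int: "(\<integral>x. f x \<partial>D N) = (\<Sum>j\<in>J N. w N j * f (s N j))" if "f \<in> borel_measurable borel" for N and f :: "real \<Rightarrow> real"
    unfolding D_def using that w fin by (simp add: integral_distr[OF meas] lebesgue_integral_point_measure_finite)
  \<comment> \<open>Tightness is expressed by intervals open on the left, so the left end is moved
    below 0 to include an atom there.\<close>
  have "measure (D N) {- 1<..1} = 1" for N
  proof -
    have "measure (D N) {- 1<..1} = (\<integral>x. indicator {- 1<..1} x \<partial>D N)"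
      using rd by (simp add: D_def)
    also have "\<dots> = (\<Sum>j\<in>J N. w N j * indicator {- 1<..1} (s N j))" by (rule int) simp
    also have "\<dots> = (\<Sum>j\<in>J N. w N j)"
      by (rule sum.cong) (use s in \<open>force simp: indicator_def\<close>)+
    finally show ?thesis using w by simp
  qed
  then have "tight D" unfolding tight_def using rd
    by (intro conjI allI impI exI[of _ "-1::real"] exI[of _ "1::real"]) auto
  from tight_imp_convergent_subsubsequence[OF this strict_mono_id]
  obtain r M where rM: "strict_mono (r :: nat \<Rightarrow> nat)" "real_distribution M" "weak_conv_m (D \<circ> id \<circ> r) M" by blast
  have "(\<lambda>N. \<Sum>j\<in>J (r N). w (r N) j * f (s (r N) j)) \<longlonglongrightarrow> (\<integral>x. f x \<partial>M)"
    if f: "\<And>x. isCont f x" "\<And>x. norm (f x) \<le> B" for f B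
  proof -
    have "(\<lambda>N. \<integral>x. f x \<partial>((D \<circ> id \<circ> r) N)) \<longlonglongrightarrow> (\<integral>x. f x \<partial>M)"
      by (rule weak_conv_imp_integral_bdd_continuous_conv[OF _ rM(2,3) f]) (use rd in auto)
    moreover have "f \<in> borel_measurable borel"
      using f by (intro borel_measurable_continuous_onI continuous_at_imp_continuous_on) auto
    ultimately show ?thesis by (simp add: int)
  qed
  with rM show ?thesis by (intro that) auto
qed

text \<open>Tychonoff over all indices, with the one-point factor \<open>{undefined}\<close> outside
  \<open>A\<close>.\<close>

lemma compact_PiE_box:
  fixes p q :: "'i \<Rightarrow> real"
  shows "compact (Pi\<^sub>E A (\<lambda>i. {p i..q i}))"
proof -
  have "Pi\<^sub>E A (\<lambda>i. {p i..q i}) = Pi\<^sub>E UNIV (\<lambda>i. if i \<in> A then {p i..q i} else {undefined})"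
    by (auto simp: PiE_def Pi_def extensional_def split: if_splits)
  moreover have "compactin (product_topology (\<lambda>_. euclidean) UNIV) \<dots>"
    unfolding compactin_PiE by auto
  ultimately show ?thesis
    by (metis compactin_euclidean_iff euclidean_product_topology)
qed

lemma closed_Collect_box:
  fixes f :: "'i \<Rightarrow> 'a::topological_space \<Rightarrow> real"
  assumes "\<And>i. i \<in> A \<Longrightarrow> continuous_on UNIV (f i)"
  shows "closed {s. \<forall>i\<in>A. p i \<le> f i s \<and> f i s \<le> q i}"
proof -
  have "{s. \<forall>i\<in>A. p i \<le> f i s \<and> f i s \<le> q i} = (\<Inter>i\<in>A. {s. p i \<le> f i s} \<inter> {s. f i s \<le> q i})" by auto
  also have "closed \<dots>"
    by (intro closed_INT ballI closed_Int closed_Collect_le continuous_intros assms)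
  finally show ?thesis .
qed

text \<open>The measures are weighted by \<open>\<Psi>\<close> to make them finite, pulled back along the space-filling curve
  (with the chart \<open>tan\<close> for each coordinate), and Helly's selection theorem is applied on the line.\<close>
lemma vague_limit_atoms:
  fixes J :: "nat \<Rightarrow> 'j set" and m :: "nat \<Rightarrow> 'j \<Rightarrow> real" and \<xi> :: "nat \<Rightarrow> 'j \<Rightarrow> nat \<Rightarrow> real"
    and b :: "nat \<Rightarrow> (nat \<Rightarrow> real) \<Rightarrow> real"
  assumes d: "d \<ge> 1" and I: "\<And>i. i \<in> {1..d} \<Longrightarrow> open (I i)" and x0: "x0 \<in> Pi\<^sub>E {1..d} I"
    and fin: "\<And>N. finite (J N)" and m: "\<And>N j. j \<in> J N \<Longrightarrow> 0 \<le> m N j"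
    and \<xi>: "\<And>N j. j \<in> J N \<Longrightarrow> \<xi> N j \<in> Pi\<^sub>E {1..d} I"
    and b_cont: "\<And>k. continuous_on UNIV (b k)" and b_nonneg: "\<And>k u. 0 \<le> b k u"
    and b_bdd: "\<And>k. \<exists>B. \<forall>u. b k u \<le> B" and b_pos: "\<And>u. u \<in> Pi\<^sub>E {1..d} I \<Longrightarrow> \<exists>k. b k u > 0"
    and b_sum: "\<And>k. \<exists>C. \<forall>N. (\<Sum>j\<in>J N. m N j * b k (\<xi> N j)) \<le> C"
  obtains r \<mu> where "strict_mono (r :: nat \<Rightarrow> nat)" "locally_finite_borel_measure d I \<mu>"
    "\<And>(\<phi> :: (nat \<Rightarrow> real) \<Rightarrow> real) p q. continuous_on UNIV \<phi> \<Longrightarrow> (\<And>i. i \<in> {1..d} \<Longrightarrow> {p i..q i} \<subseteq> I i) \<Longrightarrow>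
       (\<And>u. u \<in> Pi\<^sub>E {1..d} I \<Longrightarrow> \<phi> u \<noteq> 0 \<Longrightarrow> u \<in> Pi\<^sub>E {1..d} (\<lambda>i. {p i..q i})) \<Longrightarrow>
       (\<lambda>N. \<Sum>j\<in>J (r N). m (r N) j * \<phi> (\<xi> (r N) j)) \<longlonglongrightarrow> (\<integral>u. \<phi> u \<partial>\<mu>)"
proof -
  let ?X = "Pi\<^sub>E {1..d} I"
  obtain B where B: "\<And>k u. b k u \<le> B k" using b_bdd by metis
  obtain C where C: "\<And>k N. (\<Sum>j\<in>J N. m N j * b k (\<xi> N j)) \<le> C k" using b_sum by metis
  \<comment> \<open>One scaling serves two purposes: \<open>B k\<close> makes the series for
    \<open>\<Psi>\<close> converge uniformly, so that \<open>\<Psi>\<close> is continuous, and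
    \<open>C k\<close> makes the total mass of every measure weighted with \<open>\<Psi>\<close> at
    most 1.\<close>
  define c where "c k = (1 / 2) ^ Suc k / (1 + \<bar>B k\<bar> + \<bar>C k\<bar>)" for k
  define \<Psi> where "\<Psi> u = (\<Sum>k. c k * b k u)" for u
  have c_pos: "c k > 0" for k unfolding c_def by (intro divide_pos_pos) auto
  have c_le: "c k * z \<le> (1 / 2) ^ Suc k" if "z \<le> B k \<or> z \<le> C k" for k z
  proof -
    have "z \<le> 1 + \<bar>B k\<bar> + \<bar>C k\<bar>" using that by linarith
    then have "c k * z \<le> c k * (1 + \<bar>B k\<bar> + \<bar>C k\<bar>)" using c_pos[of k] by (intro mult_left_mono) auto
    also have "\<dots> = (1 / 2) ^ Suc k"
    proof -
      have "1 + \<bar>B k\<bar> + \<bar>C k\<bar> \<noteq> 0" by linarith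
      then show ?thesis unfolding c_def by (metis nonzero_mult_div_cancel_right times_divide_eq_left)
    qed
    finally show ?thesis .
  qed
  have abs_le: "\<bar>c k * b k u\<bar> \<le> (1 / 2) ^ Suc k" for k u
    using c_le[of "b k u" k] B c_pos[of k] b_nonneg[of k u] by (simp add: abs_mult)
  have half: "summable (\<lambda>k. (1 / 2 :: real) ^ Suc k)" using half_powers by (rule sums_summable)
  have summ: "summable (\<lambda>k. c k * b k u)" for u
    by (rule summable_comparison_test'[OF half]) (use abs_le in simp)
  have \<Psi>_cont: "continuous_on UNIV \<Psi>" unfolding \<Psi>_def
    by (rule continuous_on_suminf_Weierstrass[OF _ abs_le half]) (intro continuous_intros b_cont)
  have \<Psi>_pos: "\<Psi> u > 0" if u: "u \<in> ?X" for u
  proof -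
    obtain k where "b k u > 0" using b_pos[OF u] by blast
    then show ?thesis unfolding \<Psi>_def
      using suminf_pos2[OF summ, of u k] c_pos[of k] b_nonneg less_imp_le[OF c_pos] by (simp add: mult_nonneg_nonneg)
  qed
  have \<Psi>_sum: "(\<Sum>j\<in>J N. m N j * \<Psi> (\<xi> N j)) \<le> 1" for N
  proof -
    have eq: "c k * (\<Sum>j\<in>J N. m N j * b k (\<xi> N j)) = (\<Sum>j\<in>J N. m N j * (c k * b k (\<xi> N j)))" for k
      by (simp add: sum_distrib_left mult_ac)
    have "(\<Sum>j\<in>J N. m N j * \<Psi> (\<xi> N j)) = (\<Sum>k. \<Sum>j\<in>J N. m N j * (c k * b k (\<xi> N j)))"
      unfolding \<Psi>_def by (subst suminf_sum) (auto simp: suminf_mult summ intro!: summable_mult)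
    also have "\<dots> \<le> (\<Sum>k. (1 / 2) ^ Suc k)"
      by (intro suminf_le half summable_sum summable_mult summ) (auto simp: eq[symmetric] C simp del: power_Suc intro!: c_le)
    finally show ?thesis using half_powers by (simp add: sums_iff)
  qed

  have arctan01: "0 \<le> arctan y / pi + 1 / 2" "arctan y / pi + 1 / 2 < 1" for y
    using arctan_lbound[of y] arctan_ubound[of y] by (simp_all add: field_simps)
  have "\<exists>s. s \<in> {0..1} \<and> (\<forall>i. schoenberg i s = (if i \<in> {1..d} then arctan (\<xi> N j i) / pi + 1 / 2 else 0))" for N j
    by (rule schoenberg_surj[of "\<lambda>i. if i \<in> {1..d} then arctan (\<xi> N j i) / pi + 1 / 2 else 0"])
       (use arctan01 in auto)
  then obtain s where s: "\<And>N j. s N j \<in> {0..1}"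
    "\<And>N j i. i \<in> {1..d} \<Longrightarrow> schoenberg i (s N j) = arctan (\<xi> N j i) / pi + 1 / 2" by metis
  \<comment> \<open>Here all coordinates of the curve are 0, that is \<open>- pi / 2\<close> in the
    chart, which corresponds to no point of the box; the missing mass will be put there.\<close>
  obtain s0 where s0: "s0 \<in> {0..1}" "\<And>i. schoenberg i s0 = 0"
    using schoenberg_surj[of "\<lambda>_. 0"] by auto
  define \<gamma> where "\<gamma> i t = pi * (schoenberg i t - 1 / 2)" for i t
  \<comment> \<open>The parameters that the curve, read through \<open>tan\<close>, sends into the
    open box. Off \<open>X'\<close> the default value \<open>x0\<close> keeps \<open>u\<close> in
    the box, so that \<open>\<Psi> (u t) > 0\<close> throughout and \<open>u\<close> is measurable
    into the box.\<close>
  define X' where "X' = (\<Inter>i\<in>{1..d}. {t. - (pi / 2) < \<gamma> i t \<and> \<gamma> i t < pi / 2} \<inter> (\<lambda>t. tan (\<gamma> i t)) -` I i)"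
  define u where "u t = (if t \<in> X' then (\<lambda>i. if i \<in> {1..d} then tan (\<gamma> i t) else undefined) else x0)" for t
  have \<gamma>_cont: "continuous_on A (\<gamma> i)" for A i unfolding \<gamma>_def by (intro continuous_intros)
  have tan_cont: "continuous_on {t. - (pi / 2) < \<gamma> i t \<and> \<gamma> i t < pi / 2} (\<lambda>t. tan (\<gamma> i t))" for i
    by (intro continuous_intros \<gamma>_cont) (metis (mono_tags, lifting) cos_gt_zero_pi less_irrefl mem_Collect_eq)
  have X'_open: "open X'" unfolding X'_def
  proof (intro open_INT ballI)
    fix i assume "i \<in> {1..d}"
    have "open {t. - (pi / 2) < \<gamma> i t \<and> \<gamma> i t < pi / 2}"
      by (intro open_Collect_conj open_Collect_less continuous_intros \<gamma>_cont)
    from continuous_open_preimage[OF tan_cont this I[OF \<open>i \<in> {1..d}\<close>]]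
    show "open ({t. - (pi / 2) < \<gamma> i t \<and> \<gamma> i t < pi / 2} \<inter> (\<lambda>t. tan (\<gamma> i t)) -` I i)" .
  qed simp
  have u_X: "u t \<in> ?X" for t unfolding u_def using x0 by (auto simp: X'_def)
  have sX: "s N j \<in> X'" "u (s N j) = \<xi> N j" if "j \<in> J N" for N j
  proof -
    have eq: "\<gamma> i (s N j) = arctan (\<xi> N j i)" if "i \<in> {1..d}" for i using that by (simp add: \<gamma>_def s)
    show X': "s N j \<in> X'" unfolding X'_def
    proof (rule INT_I)
      fix i assume i: "i \<in> {1..d}"
      then show "s N j \<in> {t. - (pi / 2) < \<gamma> i t \<and> \<gamma> i t < pi / 2} \<inter> (\<lambda>t. tan (\<gamma> i t)) -` I i"
        using arctan_lbound[of "\<xi> N j i"] arctan_ubound[of "\<xi> N j i"] PiE_mem[OF \<xi>[OF that] i]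
        by (simp add: eq tan_arctan)
    qed
    show "u (s N j) = \<xi> N j"
    proof
      fix i
      show "u (s N j) i = \<xi> N j i"
        using X' PiE_arb[OF \<xi>[OF that], of i] eq[of i] by (cases "i \<in> {1..d}") (auto simp: u_def tan_arctan)
    qed
  qed
  have s0X: "s0 \<notin> X'" unfolding X'_def using d s0 by (auto simp: \<gamma>_def intro!: bexI[of _ 1])
  have u_cont: "continuous_on X' u"
  proof (rule continuous_on_coordinatewise_then_product)
    fix i
    have "continuous_on X' (\<lambda>t. if i \<in> {1..d} then tan (\<gamma> i t) else undefined)"
      by (cases "i \<in> {1..d}") (auto intro!: continuous_on_subset[OF tan_cont] simp: X'_def)
    then show "continuous_on X' (\<lambda>t. u t i)"
      by (rule continuous_on_eq) (simp add: u_def)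
  qed

  \<comment> \<open>The weighted masses add up to at most 1; the extra index \<open>None\<close>
    supplies the rest and makes them probability measures.\<close>
  define J' where "J' N = insert None (Some ` J N)" for N
  define w' where "w' N jo = (case jo of None \<Rightarrow> 1 - (\<Sum>j\<in>J N. m N j * \<Psi> (\<xi> N j)) | Some j \<Rightarrow> m N j * \<Psi> (\<xi> N j))" for N jo
  define s' where "s' N jo = (case jo of None \<Rightarrow> s0 | Some j \<Rightarrow> s N j)" for N and jo :: "'j option"
  have sum_J': "(\<Sum>j\<in>J' N. g j) = g None + (\<Sum>j\<in>J N. g (Some j))" for N and g :: "'j option \<Rightarrow> real"
    unfolding J'_def using fin by (subst sum.insert) (auto simp: sum.reindex)
  obtain r M where r: "strict_mono (r :: nat \<Rightarrow> nat)" and M: "real_distribution M" and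
    lim: "\<And>f B. (\<And>x. isCont f x) \<Longrightarrow> (\<And>x. norm (f x) \<le> B) \<Longrightarrow>
       (\<lambda>N. \<Sum>j\<in>J' (r N). w' (r N) j * f (s' (r N) j)) \<longlonglongrightarrow> (\<integral>x. f x \<partial>M)"
  proof (rule weak_limit_atoms[of J' w' s'])
    show "0 \<le> w' N j" if "j \<in> J' N" for N j
      using that \<Psi>_sum[of N] m less_imp_le[OF \<Psi>_pos[OF \<xi>]] by (auto simp: J'_def w'_def)
    show "s' N j \<in> {0..1}" for N j using s s0 by (auto simp: s'_def split: option.split)
  qed (use fin in \<open>auto simp: sum_J' w'_def\<close>, simp add: J'_def)
  interpret M: real_distribution M by fact
  \<comment> \<open>Division by \<open>\<Psi>\<close> undoes the weighting, and the indicator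
    discards limit mass outside \<open>X'\<close>: the filler at \<open>s0\<close> and whatever
    escaped to the boundary of the box.\<close>
  define g where "g t = indicator X' t / \<Psi> (u t)" for t
  define \<mu> where "\<mu> = distr (density M (\<lambda>t. ennreal (g t))) (restrict_space borel ?X) u"
  have X'_meas [measurable]: "X' \<in> sets borel" using X'_open by simp
  have u_meas [measurable]: "u \<in> borel_measurable borel"
    unfolding u_def by (rule borel_measurable_continuous_on_if)
       (use u_cont in \<open>auto simp: u_def cong: continuous_on_cong\<close>)
  have \<Psi>_meas [measurable]: "\<Psi> \<in> borel_measurable borel" using \<Psi>_cont by (rule borel_measurable_continuous_onI)
  have g_meas [measurable]: "g \<in> borel_measurable borel" unfolding g_def by measurable
  have g_nonneg: "0 \<le> g t" for t unfolding g_def using \<Psi>_pos[OF u_X[of t]] by simp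
  have uX_meas: "u \<in> measurable (density M f) (restrict_space borel ?X)" for f
    by (rule measurable_restrict_space2) (use u_X in \<open>auto simp: space_restrict_space\<close>)
  show ?thesis
  proof (rule that[OF r])
    show "locally_finite_borel_measure d I \<mu>"
      unfolding locally_finite_borel_measure_def
    proof (intro conjI allI impI)
      show "sets \<mu> = sets (restrict_space borel ?X)" by (simp add: \<mu>_def)
      fix K assume K: "K \<subseteq> ?X \<and> compact K"
      have Ks: "K \<in> sets borel" using K by (simp add: compact_imp_closed)
      show "emeasure \<mu> K < \<infinity>"
      proof (cases "K = {}")
        case False
        have "continuous_on K \<Psi>" using \<Psi>_cont by (rule continuous_on_subset) simp
        then obtain z where z: "z \<in> K" "\<And>y. y \<in> K \<Longrightarrow> \<Psi> z \<le> \<Psi> y"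
          using continuous_attains_inf[of K \<Psi>] K False by blast
        have zp: "\<Psi> z > 0" using z K \<Psi>_pos by auto
        have Kr: "K \<in> sets (restrict_space borel ?X)" using Ks K by (auto simp: sets_restrict_space)
        have "emeasure \<mu> K = emeasure (density M (\<lambda>t. ennreal (g t))) (u -` K)"
          unfolding \<mu>_def by (subst emeasure_distr[OF uX_meas Kr]) simp
        also have "\<dots> = (\<integral>\<^sup>+t. ennreal (g t) * indicator (u -` K) t \<partial>M)"
          by (rule emeasure_density) (use measurable_sets_borel[OF u_meas Ks] in auto)
        also have "\<dots> \<le> (\<integral>\<^sup>+t. ennreal (1 / \<Psi> z) \<partial>M)"
        proof (rule nn_integral_mono)
          fix t
          show "ennreal (g t) * indicator (u -` K) t \<le> ennreal (1 / \<Psi> z)"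
          proof (cases "u t \<in> K")
            case True
            have "g t \<le> 1 / \<Psi> (u t)" unfolding g_def using \<Psi>_pos[OF u_X[of t]] by (simp add: indicator_def)
            also have "\<dots> \<le> 1 / \<Psi> z" using z(2)[OF True] zp by (simp add: frac_le)
            finally show ?thesis using True by (simp add: ennreal_leI)
          qed simp
        qed
        also have "\<dots> < \<infinity>" by (simp add: M.emeasure_eq_measure ennreal_mult_less_top)
        finally show ?thesis .
      qed simp
    qed
    fix \<phi> :: "(nat \<Rightarrow> real) \<Rightarrow> real" and p q
    assume \<phi>: "continuous_on UNIV \<phi>" and pq: "\<And>i. i \<in> {1..d} \<Longrightarrow> {p i..q i} \<subseteq> I i"
      and supp: "\<And>u. u \<in> ?X \<Longrightarrow> \<phi> u \<noteq> 0 \<Longrightarrow> u \<in> Pi\<^sub>E {1..d} (\<lambda>i. {p i..q i})"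
    define \<theta> where "\<theta> t = g t * \<phi> (u t)" for t
    \<comment> \<open>The parameters sent into the compact box. \<open>C'\<close> is closed in the
      line and contained in the open \<open>X'\<close>; since \<open>\<theta>\<close> is continuous
      on \<open>X'\<close> and 0 off \<open>C'\<close>, and these two open sets cover the line,
      \<open>\<theta>\<close> is continuous everywhere, although \<open>g\<close> need not
      be.\<close>
    define C' where "C' = {t. \<forall>i\<in>{1..d}. arctan (p i) \<le> \<gamma> i t \<and> \<gamma> i t \<le> arctan (q i)}"
    have C'_X': "C' \<subseteq> X'"
    proof
      fix t assume t: "t \<in> C'"
      show "t \<in> X'" unfolding X'_def
      proof (rule INT_I)
        fix i assume i: "i \<in> {1..d}"
        have \<gamma>: "arctan (p i) \<le> \<gamma> i t" "\<gamma> i t \<le> arctan (q i)" using t i by (auto simp: C'_def)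
        then have \<gamma>b: "- (pi / 2) < \<gamma> i t" "\<gamma> i t < pi / 2"
          using arctan_lbound[of "p i"] arctan_ubound[of "q i"] by linarith+
        then have "arctan (tan (\<gamma> i t)) = \<gamma> i t" by (intro arctan_tan) auto
        then have "tan (\<gamma> i t) \<in> {p i..q i}" using \<gamma> by (metis arctan_le_iff atLeastAtMost_iff)
        then show "t \<in> {t. - (pi / 2) < \<gamma> i t \<and> \<gamma> i t < pi / 2} \<inter> (\<lambda>t. tan (\<gamma> i t)) -` I i"
          using \<gamma>b pq[OF i] by auto
      qed
    qed
    have \<theta>0: "\<theta> t = 0" if "t \<notin> C'" for t
    proof (rule ccontr)
      assume "\<theta> t \<noteq> 0"
      then have tX: "t \<in> X'" and "\<phi> (u t) \<noteq> 0" by (auto simp: \<theta>_def g_def indicator_def split: if_splits)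
      then have ut: "u t \<in> Pi\<^sub>E {1..d} (\<lambda>i. {p i..q i})" using supp u_X by blast
      have "arctan (p i) \<le> \<gamma> i t \<and> \<gamma> i t \<le> arctan (q i)" if i: "i \<in> {1..d}" for i
      proof -
        have "- (pi / 2) < \<gamma> i t" "\<gamma> i t < pi / 2" using tX i by (auto simp: X'_def)
        then have "arctan (tan (\<gamma> i t)) = \<gamma> i t" by (intro arctan_tan) auto
        moreover have "tan (\<gamma> i t) \<in> {p i..q i}" using PiE_mem[OF ut i] tX i by (simp add: u_def)
        ultimately show ?thesis by (metis arctan_le_iff atLeastAtMost_iff)
      qed
      then show False using that by (auto simp: C'_def)
    qed
    have "closed C'" unfolding C'_def by (intro closed_Collect_box \<gamma>_cont)
    have "continuous_on (X' \<union> - C') \<theta>"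
    proof (rule continuous_on_open_Un)
      have "continuous_on X' (\<lambda>t. \<phi> (u t) / \<Psi> (u t))"
        using \<Psi>_pos[OF u_X]
        by (intro continuous_intros continuous_on_compose2[OF \<phi> u_cont] continuous_on_compose2[OF \<Psi>_cont u_cont])
           (auto simp: less_le)
      then show "continuous_on X' \<theta>" by (rule continuous_on_eq) (simp add: \<theta>_def g_def)
      show "continuous_on (- C') \<theta>" by (rule continuous_on_eq[OF continuous_on_const[of _ 0]]) (simp add: \<theta>0)
    qed (use X'_open \<open>closed C'\<close> in auto)
    moreover have "X' \<union> - C' = UNIV" using C'_X' by auto
    ultimately have \<theta>_cont: "isCont \<theta> t" for t by (simp add: continuous_on_eq_continuous_at)
    obtain L where L: "norm (\<theta> t) \<le> L" for t
    proof -
      let ?K = "Pi\<^sub>E {1..d} (\<lambda>i. {p i..q i})"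
      have KX: "?K \<subseteq> ?X" using pq by (intro PiE_mono) auto
      have "continuous_on ?K (\<lambda>v. \<phi> v / \<Psi> v)"
        using \<Psi>_pos KX by (intro continuous_intros continuous_on_subset[OF \<phi>] continuous_on_subset[OF \<Psi>_cont]) (force simp: less_le)+
      then have "bounded ((\<lambda>v. \<phi> v / \<Psi> v) ` ?K)"
        by (intro compact_imp_bounded compact_continuous_image compact_PiE_box)
      then obtain L where L: "\<And>v. v \<in> ?K \<Longrightarrow> norm (\<phi> v / \<Psi> v) \<le> L" unfolding bounded_iff by blast
      have "norm (\<theta> t) \<le> max 0 L" for t
      proof (cases "\<theta> t = 0")
        case False
        then have "\<theta> t = \<phi> (u t) / \<Psi> (u t)" "\<phi> (u t) \<noteq> 0" by (auto simp: \<theta>_def g_def indicator_def split: if_splits)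
        then show ?thesis using L[of "u t"] supp[OF u_X] by (simp add: max.coboundedI2)
      qed simp
      then show ?thesis by (rule that)
    qed
    have "(\<Sum>j\<in>J' N. w' N j * \<theta> (s' N j)) = (\<Sum>j\<in>J N. m N j * \<phi> (\<xi> N j))" for N
    proof -
      have "w' N (Some j) * \<theta> (s' N (Some j)) = m N j * \<phi> (\<xi> N j)" if j: "j \<in> J N" for j
        using sX[OF j] \<Psi>_pos[OF \<xi>[OF j]] by (simp add: w'_def s'_def \<theta>_def g_def)
      moreover have "\<theta> s0 = 0" using s0X by (simp add: \<theta>_def g_def)
      ultimately show ?thesis unfolding sum_J' by (simp add: s'_def)
    qed
    moreover have "(\<integral>v. \<phi> v \<partial>\<mu>) = (\<integral>t. \<theta> t \<partial>M)"
    proof -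
      have \<phi>_meas [measurable]: "\<phi> \<in> borel_measurable borel" using \<phi> by (rule borel_measurable_continuous_onI)
      have "(\<integral>v. \<phi> v \<partial>\<mu>) = (\<integral>t. \<phi> (u t) \<partial>density M (\<lambda>t. ennreal (g t)))"
        unfolding \<mu>_def by (rule integral_distr[OF uX_meas]) (simp add: measurable_restrict_space1)
      also have "\<dots> = (\<integral>t. g t *\<^sub>R \<phi> (u t) \<partial>M)"
        by (rule integral_density) (use g_nonneg in auto)
      finally show ?thesis by (simp add: \<theta>_def)
    qed
    ultimately show "(\<lambda>N. \<Sum>j\<in>J (r N). m (r N) j * \<phi> (\<xi> (r N) j)) \<longlonglongrightarrow> (\<integral>u. \<phi> u \<partial>\<mu>)"
      using lim[OF \<theta>_cont L] by simp
  qed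
qed

section \<open>Integrals of B-splines\<close>

lemma dd_trunc_pow_outside:
  assumes "finite S" "card S = n + 1" "n \<ge> 1" "u \<notin> {Min S..Max S}"
  shows "dd S (trunc_pow n h u) = 0"
proof (cases "u < Min S")
  case True
  then show ?thesis
    by (intro dd_trunc_pow_below assms) (meson Min_le assms(1) less_le_trans)
next
  case False
  then have "Max S < u" using assms(4) by auto
  then have "\<not> u < t" if "t \<in> S" for t using Max_ge[OF assms(1) that] by linarith
  then show ?thesis by (intro dd_eq_0) (simp add: trunc_pow_def)
qed

lemma trunc_pow_perturb:
  "\<exists>C\<ge>0. \<forall>h\<in>{0..1}. \<forall>s\<in>{0..L}. \<bar>(\<Prod>l=1..<Suc m. s - real l * h) - s ^ m\<bar> \<le> C * h"
proof (induction m)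
  case 0
  show ?case by (intro exI[of _ 0]) simp
next
  case (Suc m)
  then obtain C where C: "C \<ge> 0"
    "\<And>h s. h \<in> {0..1} \<Longrightarrow> s \<in> {0..L} \<Longrightarrow> \<bar>(\<Prod>l=1..<Suc m. s - real l * h) - s ^ m\<bar> \<le> C * h" by blast
  show ?case
  proof (intro exI[of _ "C * (\<bar>L\<bar> + real (Suc m)) + \<bar>L\<bar> ^ m * real (Suc m)"] conjI ballI)
    fix h s :: real assume h: "h \<in> {0..1}" and s: "s \<in> {0..L}"
    let ?P = "\<Prod>l=1..<Suc m. s - real l * h" and ?x = "s - real (Suc m) * h"
    have "(\<Prod>l=1..<Suc (Suc m). s - real l * h) = ?P * ?x"
      by (rule prod.atLeastLessThan_Suc) simp
    then have "(\<Prod>l=1..<Suc (Suc m). s - real l * h) - s ^ Suc m = (?P - s ^ m) * ?x - s ^ m * (real (Suc m) * h)"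
      by (simp add: algebra_simps)
    also have "\<bar>\<dots>\<bar> \<le> \<bar>(?P - s ^ m) * ?x\<bar> + \<bar>s ^ m * (real (Suc m) * h)\<bar>" by (rule abs_triangle_ineq4)
    also have "\<bar>(?P - s ^ m) * ?x\<bar> \<le> (C * h) * (\<bar>L\<bar> + real (Suc m))"
    proof -
      have "real (Suc m) * h \<le> real (Suc m)" "0 \<le> real (Suc m) * h"
        using h by (auto intro!: mult_left_le simp del: of_nat_Suc)
      then have "\<bar>?x\<bar> \<le> \<bar>L\<bar> + real (Suc m)" using s unfolding atLeastAtMost_iff by linarith
      then show ?thesis unfolding abs_mult using C h s by (intro mult_mono) auto
    qed
    also have "\<bar>s ^ m * (real (Suc m) * h)\<bar> \<le> \<bar>L\<bar> ^ m * (real (Suc m) * h)"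
      using s h by (auto simp: abs_mult power_abs intro!: mult_right_mono power_mono)
    finally show "\<bar>(\<Prod>l=1..<Suc (Suc m). s - real l * h) - s ^ Suc m\<bar>
        \<le> (C * (\<bar>L\<bar> + real (Suc m)) + \<bar>L\<bar> ^ m * real (Suc m)) * h"
      by (simp add: algebra_simps)
  qed (use C in auto)
qed

text \<open>The constant is uniform in \<open>u\<close>: outside the range of the nodes both divided
  differences vanish, and inside it \<open>t - u\<close> is bounded by the length of that range
  wherever the truncation does not act.\<close>

lemma dd_trunc_pow_perturb:
  assumes S: "finite S" "card S = n + 1" and n: "n \<ge> 1"
  obtains C where "C \<ge> 0" "\<And>h u. h \<in> {0..1} \<Longrightarrow> \<bar>dd S (trunc_pow n h u) - dd S (trunc_pow n 0 u)\<bar> \<le> C * h"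
proof -
  let ?L = "Max S - Min S"
  obtain m where m: "n = Suc m" using n by (cases n) auto
  obtain C where C: "C \<ge> 0"
    "\<And>h s. h \<in> {0..1} \<Longrightarrow> s \<in> {0..?L} \<Longrightarrow> \<bar>(\<Prod>l=1..<Suc m. s - real l * h) - s ^ m\<bar> \<le> C * h"
    using trunc_pow_perturb[of ?L m] by blast
  have tp: "\<bar>trunc_pow n h u t - trunc_pow n 0 u t\<bar> \<le> C * h"
    if "h \<in> {0..1}" "u \<in> {Min S..Max S}" "t \<in> S" for h u t
  proof (cases "u < t")
    case True
    have "t \<le> Max S" using that S by simp
    then have e: "\<bar>(\<Prod>l=1..<Suc m. (t - u) - real l * h) - (t - u) ^ m\<bar> \<le> C * h"
      using that True by (intro C(2)) auto
    have fact: "\<bar>x / fact m\<bar> \<le> \<bar>x\<bar>" for x :: real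
      using mult_right_mono[OF fact_ge_1[of m], of "\<bar>x\<bar>"] by (simp add: abs_divide divide_le_eq mult.commute)
    have "trunc_pow n h u t - trunc_pow n 0 u t
        = ((\<Prod>l=1..<Suc m. (t - u) - real l * h) - (t - u) ^ m) / fact m"
      using True by (simp add: trunc_pow_def m diff_divide_distrib)
    then show ?thesis using order_trans[OF fact e] by (simp only:)
  qed (use C that in \<open>auto simp: trunc_pow_def\<close>)
  show ?thesis
  proof (rule that[of "\<Sum>t\<in>S. \<bar>wt S t\<bar> * C"])
    fix h u :: real assume h: "h \<in> {0..1}"
    show "\<bar>dd S (trunc_pow n h u) - dd S (trunc_pow n 0 u)\<bar> \<le> (\<Sum>t\<in>S. \<bar>wt S t\<bar> * C) * h"
    proof (cases "u \<in> {Min S..Max S}")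
      case True
      have "\<bar>dd S (trunc_pow n h u) - dd S (trunc_pow n 0 u)\<bar>
          \<le> (\<Sum>t\<in>S. \<bar>wt S t * (trunc_pow n h u t - trunc_pow n 0 u t)\<bar>)"
        by (subst dd_diff[symmetric]) (simp only: dd_def sum_abs)
      also have "\<dots> \<le> (\<Sum>t\<in>S. \<bar>wt S t\<bar> * (C * h))"
        unfolding abs_mult by (intro sum_mono mult_left_mono tp h True) auto
      finally show ?thesis by (simp add: sum_distrib_right mult.assoc)
    next
      case False
      have "0 \<le> (\<Sum>t\<in>S. \<bar>wt S t\<bar> * C)" using C by (intro sum_nonneg) auto
      then show ?thesis using dd_trunc_pow_outside[OF S n False] h by simp
    qed
  qed (use C in \<open>auto intro!: sum_nonneg\<close>)
qed

lemma continuous_bspline: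
  assumes "n \<ge> 2"
  shows "continuous_on A (\<lambda>u. dd S (trunc_pow n 0 u))"
  unfolding dd_def trunc_pow_0[OF assms] pos_part_def by (intro continuous_intros) auto

lemma bspline_nonneg:
  assumes "finite S" "card S = n + 1" "n \<ge> 1"
  shows "dd S (trunc_pow n 0 u) \<ge> 0"
  using assms by (intro dd_trunc_pow_nonneg) auto

lemma dd_trunc_pow_bounded:
  assumes S: "finite S" "card S = n + 1" and n: "n \<ge> 2"
  obtains M where "M \<ge> 1" "\<And>h u. h \<in> {0..1} \<Longrightarrow> \<bar>dd S (trunc_pow n h u)\<bar> \<le> M"
proof -
  obtain C where C: "C \<ge> 0"
    "\<And>h u. h \<in> {0..1} \<Longrightarrow> \<bar>dd S (trunc_pow n h u) - dd S (trunc_pow n 0 u)\<bar> \<le> C * h"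
    using dd_trunc_pow_perturb[OF S] n by auto
  have "bounded ((\<lambda>u. dd S (trunc_pow n 0 u)) ` {Min S..Max S})"
    by (intro compact_imp_bounded compact_continuous_image continuous_bspline n compact_Icc)
  then obtain B where B: "\<And>u. u \<in> {Min S..Max S} \<Longrightarrow> \<bar>dd S (trunc_pow n 0 u)\<bar> \<le> B"
    unfolding bounded_iff by (metis imageI real_norm_def)
  have "\<bar>dd S (trunc_pow n h u)\<bar> \<le> \<bar>B\<bar> + C + 1" if h: "h \<in> {0..1}" for h u
  proof (cases "u \<in> {Min S..Max S}")
    case True
    have "C * h \<le> C" using C(1) h by (simp add: mult_left_le)
    then show ?thesis using C(2)[OF h, of u] B[OF True] by linarith
  qed (use dd_trunc_pow_outside[OF S] n C in simp)
  then show ?thesis using C by (intro that[of "\<bar>B\<bar> + C + 1"]) auto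
qed

text \<open>Openness leaves room for rational end nodes strictly outside \<open>{p..q}\<close>; the
  B-spline is then positive on this compact interval and by continuity bounded below. It dominates,
  up to a constant, any bounded function supported there.\<close>

lemma obtain_dominating_nodes:
  assumes I: "open I" "is_interval I" and pq: "p \<in> I" "q \<in> I" "p \<le> q" and n: "n \<ge> 2"
  obtains S \<delta> where "S \<subseteq> I \<inter> \<rat>" "finite S" "card S = n + 1" "\<delta> > 0"
    "\<And>u. u \<in> {p..q} \<Longrightarrow> dd S (trunc_pow n 0 u) \<ge> \<delta>"
proof -
  obtain e where e: "e > 0" "ball p e \<subseteq> I" using I pq open_contains_ball by blast
  obtain e' where e': "e' > 0" "ball q e' \<subseteq> I" using I pq open_contains_ball by blast
  obtain a where a: "a \<in> \<rat>" "p - e < a" "a < p" using Rats_dense_in_real[of "p - e" p] e by auto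
  obtain b where b: "b \<in> \<rat>" "q < b" "b < q + e'" using Rats_dense_in_real[of q "q + e'"] e' by auto
  have "a \<in> ball p e" "b \<in> ball q e'" using a b by (auto simp: dist_real_def)
  then have ab: "a \<in> I" "b \<in> I" using e e' by auto
  obtain Z where Z: "Z \<subseteq> \<rat> \<inter> {a<..<b}" "finite Z" "card Z = n - 1"
    using obtain_rational_nodes[of a b "n - 1"] a b pq by auto
  define S where "S = insert a (insert b Z)"
  have "a \<notin> insert b Z" "b \<notin> Z" using Z a b pq by auto
  then have S: "finite S" "card S = n + 1" using Z n by (auto simp: S_def)
  have "{a..b} \<subseteq> I" using I ab by (meson atLeastAtMost_iff is_interval_1 subsetI)
  then have "Z \<subseteq> I" using Z(1) greaterThanLessThan_subseteq_atLeastAtMost_iff[of a b a b] by blast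
  then have SI: "S \<subseteq> I \<inter> \<rat>" using Z a b ab by (auto simp: S_def)
  have pos: "dd S (trunc_pow n 0 u) > 0" if "u \<in> {p..q}" for u
    by (rule bspline_pos[OF S, of a b]) (use that a b n in \<open>auto simp: S_def\<close>)
  obtain v where v: "v \<in> {p..q}" "\<And>u. u \<in> {p..q} \<Longrightarrow> dd S (trunc_pow n 0 v) \<le> dd S (trunc_pow n 0 u)"
    using continuous_attains_inf[of "{p..q}" "\<lambda>u. dd S (trunc_pow n 0 u)"] continuous_bspline[OF n] pq by auto
  show ?thesis using that[OF SI S pos[OF v(1)] v(2)] .
qed

section \<open>The kernels of the representation and their integrals\<close>

definition kern :: "nat \<Rightarrow> real \<Rightarrow> real \<Rightarrow> real \<Rightarrow> real" where
  "kern n a x u = (if u \<le> a then (- 1) ^ n * (neg_part (x - u) ^ (n - 1) / fact (n - 1))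
     else pos_part (x - u) ^ (n - 1) / fact (n - 1))"

text \<open>This turns the kernel for \<open>u \<le> a\<close> into the truncated power minus a full
  power of \<open>x - u\<close>, a polynomial in \<open>x\<close>. For \<open>n = 1\<close> the left
  side would be 2.\<close>

lemma pos_part_minus_neg_part_power:
  assumes "n \<ge> 2"
  shows "pos_part y ^ (n - 1) - (- 1) ^ n * neg_part y ^ (n - 1) = y ^ (n - 1)"
proof -
  obtain m where m: "n = Suc m" "m \<noteq> 0" using assms by (cases n) auto
  show ?thesis
  proof (cases "y \<ge> 0")
    case False
    then have "(- 1) ^ n * neg_part y ^ (n - 1) = - ((- 1) ^ m * (- y) ^ m)"
      using m by (simp add: neg_part_def)
    also have "\<dots> = - (y ^ m)" by (simp flip: power_mult_distrib)
    finally show ?thesis using False m by (simp add: pos_part_def)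
  qed (use m in \<open>simp add: pos_part_def neg_part_def\<close>)
qed

lemma dd_kern:
  assumes "finite S" "card S = n + 1" "n \<ge> 2"
  shows "dd S (\<lambda>x. kern n a x u) = dd S (trunc_pow n 0 u)"
proof (cases "u \<le> a")
  case True
  have "kern n a x u = trunc_pow n 0 u x - inverse (fact (n - 1)) * (\<Prod>i\<in>{..<n - 1}. x - u)" for x
    using pos_part_minus_neg_part_power[OF assms(3), of "x - u"] True
    by (simp add: kern_def trunc_pow_0[OF assms(3)] field_simps)
  moreover have "dd S (\<lambda>x. \<Prod>i\<in>{..<n - 1}. x - u) = 0"
    using assms by (intro dd_prod_linear) auto
  ultimately show ?thesis by (simp only: dd_diff dd_cmult)
next
  case False
  then show ?thesis using assms by (intro dd_cong) (simp add: kern_def trunc_pow_0)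
qed

text \<open>The reason for splitting at \<open>a\<close>: the kernel lives between \<open>a\<close>
  and \<open>x\<close>, whereas a truncated power alone is nonzero for all \<open>u < x\<close>. A
  measure that is only finite on compact sets can integrate the former.\<close>

lemma kern_bounds:
  assumes "n \<ge> 2"
  shows "\<bar>kern n a x u\<bar> \<le> \<bar>x - a\<bar> ^ (n - 1) / fact (n - 1)"
    and "kern n a x u \<noteq> 0 \<Longrightarrow> u \<in> {min a x..max a x}"
proof -
  have n: "n - 1 > 0" using assms by simp
  have "neg_part (x - u) \<le> \<bar>x - a\<bar>" if "u \<le> a" using that by (auto simp: neg_part_def)
  moreover have "pos_part (x - u) \<le> \<bar>x - a\<bar>" if "a < u" using that by (auto simp: pos_part_def)
  moreover have "0 \<le> neg_part y" "0 \<le> pos_part y" for y by (auto simp: neg_part_def pos_part_def)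
  ultimately show "\<bar>kern n a x u\<bar> \<le> \<bar>x - a\<bar> ^ (n - 1) / fact (n - 1)"
    by (auto simp: kern_def abs_mult power_abs intro!: divide_right_mono power_mono)
  show "kern n a x u \<noteq> 0 \<Longrightarrow> u \<in> {min a x..max a x}"
    using n by (auto simp: kern_def neg_part_def pos_part_def max_def min_def zero_power split: if_splits)
qed

lemma kern_measurable [measurable]: "(\<lambda>u. kern n a x u) \<in> borel_measurable borel"
  unfolding kern_def neg_part_def pos_part_def by measurable

lemma borel_measurable_locally_finite:
  assumes "locally_finite_borel_measure d I \<mu>" "\<phi> \<in> borel_measurable borel"
  shows "\<phi> \<in> borel_measurable \<mu>"
  using assms unfolding locally_finite_borel_measure_def
  by (metis measurable_cong_sets measurable_restrict_space1)

lemma space_locally_finite: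
  assumes "locally_finite_borel_measure d I \<mu>"
  shows "space \<mu> = Pi\<^sub>E {1..d} I"
  using assms sets_eq_imp_space_eq[of \<mu> "restrict_space borel (Pi\<^sub>E {1..d} I)"]
  by (simp add: locally_finite_borel_measure_def space_restrict_space)

lemma integrable_bounded_support:
  fixes \<phi> :: "(nat \<Rightarrow> real) \<Rightarrow> real"
  assumes \<mu>: "locally_finite_borel_measure d I \<mu>" and \<phi>: "\<phi> \<in> borel_measurable borel"
    and B: "\<And>u. u \<in> Pi\<^sub>E {1..d} I \<Longrightarrow> \<bar>\<phi> u\<bar> \<le> B" and pq: "\<And>i. i \<in> {1..d} \<Longrightarrow> {p i..q i} \<subseteq> I i"
    and supp: "\<And>u. u \<in> Pi\<^sub>E {1..d} I \<Longrightarrow> \<phi> u \<noteq> 0 \<Longrightarrow> u \<in> Pi\<^sub>E {1..d} (\<lambda>i. {p i..q i})"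
  shows "integrable \<mu> \<phi>"
proof (rule integrableI_bounded_set)
  let ?K = "Pi\<^sub>E {1..d} (\<lambda>i. {p i..q i})"
  have K: "?K \<subseteq> Pi\<^sub>E {1..d} I" using pq by (intro PiE_mono) auto
  have cK: "compact ?K" by (rule compact_PiE_box)
  have "?K \<in> sets (restrict_space borel (Pi\<^sub>E {1..d} I))"
    using K cK by (auto simp: sets_restrict_space intro!: image_eqI[of _ _ ?K] borel_closed compact_imp_closed)
  then show "?K \<in> sets \<mu>" using \<mu> by (simp add: locally_finite_borel_measure_def)
  show "emeasure \<mu> ?K < \<infinity>" using \<mu> K cK by (simp add: locally_finite_borel_measure_def)
  show "\<phi> \<in> borel_measurable \<mu>" by (rule borel_measurable_locally_finite[OF \<mu> \<phi>])
  show "AE u in \<mu>. u \<in> ?K \<longrightarrow> norm (\<phi> u) \<le> B" using B K by (intro AE_I2) auto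
  show "AE u in \<mu>. u \<notin> ?K \<longrightarrow> \<phi> u = 0"
    using supp space_locally_finite[OF \<mu>] by (intro AE_I2) metis
qed

lemma interval_Icc_subset:
  fixes I :: "real set"
  assumes "is_interval I" "p \<in> I" "q \<in> I"
  shows "{p..q} \<subseteq> I"
  using assms by (meson atLeastAtMost_iff is_interval_1 subsetI)

lemma integrable_kern:
  assumes \<mu>: "locally_finite_borel_measure d I \<mu>" and I: "\<And>i. i \<in> {1..d} \<Longrightarrow> is_interval (I i)"
    and n: "\<And>i. i \<in> {1..d} \<Longrightarrow> n i \<ge> 2" and \<alpha>: "\<alpha> \<in> Pi\<^sub>E {1..d} I" and x: "x \<in> Pi\<^sub>E {1..d} I"
  shows "integrable \<mu> (\<lambda>u. \<Prod>j\<in>{1..d}. kern (n j) (\<alpha> j) (x j) (u j))"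
proof (rule integrable_bounded_support[OF \<mu>])
  show "(\<lambda>u. \<Prod>j\<in>{1..d}. kern (n j) (\<alpha> j) (x j) (u j)) \<in> borel_measurable borel"
    by measurable
  show "\<bar>\<Prod>j\<in>{1..d}. kern (n j) (\<alpha> j) (x j) (u j)\<bar> \<le> (\<Prod>j\<in>{1..d}. \<bar>x j - \<alpha> j\<bar> ^ (n j - 1) / fact (n j - 1))" for u
    unfolding abs_prod by (intro prod_mono conjI kern_bounds n) auto
  show "{min (\<alpha> i) (x i)..max (\<alpha> i) (x i)} \<subseteq> I i" if "i \<in> {1..d}" for i
    by (intro interval_Icc_subset I that) (use PiE_mem[OF \<alpha> that] PiE_mem[OF x that] in \<open>auto simp: min_def max_def\<close>)
  show "u \<in> Pi\<^sub>E {1..d} (\<lambda>i. {min (\<alpha> i) (x i)..max (\<alpha> i) (x i)})"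
    if u: "u \<in> Pi\<^sub>E {1..d} I" and "(\<Prod>j\<in>{1..d}. kern (n j) (\<alpha> j) (x j) (u j)) \<noteq> 0" for u
  proof (rule PiE_I)
    fix i assume i: "i \<in> {1..d}"
    then have "kern (n i) (\<alpha> i) (x i) (u i) \<noteq> 0" using that by auto
    then show "u i \<in> {min (\<alpha> i) (x i)..max (\<alpha> i) (x i)}" by (rule kern_bounds(2)[OF n[OF i]])
  qed (use PiE_arb[OF u] in auto)
qed

lemma box_part_sets:
  assumes \<mu>: "locally_finite_borel_measure d I \<mu>" and A: "A \<subseteq> {1..d}"
  shows "box_part d I A \<alpha> \<in> sets \<mu>"
proof -
  have [measurable]: "(\<lambda>u. u j) \<in> borel_measurable \<mu>" for j
    by (rule borel_measurable_locally_finite[OF \<mu>]) simp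
  have [simp]: "finite A" using A finite_subset by blast
  have "box_part d I A \<alpha> = {u \<in> space \<mu>. (\<forall>j\<in>A. u j \<le> \<alpha> j) \<and> (\<forall>j\<in>{1..d} - A. u j > \<alpha> j)}"
    by (simp add: box_part_def space_locally_finite[OF \<mu>])
  also have "\<dots> \<in> sets \<mu>" by measurable
  finally show ?thesis .
qed

text \<open>The sets \<open>box_part d I A \<alpha>\<close> partition the box, \<open>u\<close>
  lying in the part whose \<open>A\<close> consists of the \<open>j\<close> with
  \<open>u j \<le> \<alpha> j\<close>. The case distinction in \<open>kern\<close> mirrors this
  choice of \<open>A\<close>.\<close>

lemma sum_box_part_eq_integral:
  assumes \<mu>: "locally_finite_borel_measure d I \<mu>" and I: "\<And>i. i \<in> {1..d} \<Longrightarrow> is_interval (I i)"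
    and n: "\<And>i. i \<in> {1..d} \<Longrightarrow> n i \<ge> 2" and \<alpha>: "\<alpha> \<in> Pi\<^sub>E {1..d} I" and x: "x \<in> Pi\<^sub>E {1..d} I"
  shows "(\<Sum>A\<in>Pow {1..d}. (LINT u : box_part d I A \<alpha> | \<mu>.
        (\<Prod>j\<in>{1..d} - A. pos_part (x j - u j) ^ (n j - 1) / fact (n j - 1)) *
        (\<Prod>j\<in>A. (- 1) ^ n j * (neg_part (x j - u j) ^ (n j - 1) / fact (n j - 1)))))
    = (\<integral>u. (\<Prod>j\<in>{1..d}. kern (n j) (\<alpha> j) (x j) (u j)) \<partial>\<mu>)"
proof -
  let ?k = "\<lambda>u. \<Prod>j\<in>{1..d}. kern (n j) (\<alpha> j) (x j) (u j)"
  let ?B = "\<lambda>A. box_part d I A \<alpha>"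
  have eq: "(LINT u : ?B A | \<mu>. (\<Prod>j\<in>{1..d} - A. pos_part (x j - u j) ^ (n j - 1) / fact (n j - 1)) *
        (\<Prod>j\<in>A. (- 1) ^ n j * (neg_part (x j - u j) ^ (n j - 1) / fact (n j - 1))))
      = (\<integral>u. ?k u * indicator (?B A) u \<partial>\<mu>)" if A: "A \<in> Pow {1..d}" for A
    unfolding set_lebesgue_integral_def
  proof (rule Bochner_Integration.integral_cong[OF refl])
    fix u
    show "indicator (?B A) u *\<^sub>R ((\<Prod>j\<in>{1..d} - A. pos_part (x j - u j) ^ (n j - 1) / fact (n j - 1)) *
        (\<Prod>j\<in>A. (- 1) ^ n j * (neg_part (x j - u j) ^ (n j - 1) / fact (n j - 1)))) = ?k u * indicator (?B A) u"
    proof (cases "u \<in> ?B A")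
      case True
      have "?k u = (\<Prod>j\<in>{1..d} - A. kern (n j) (\<alpha> j) (x j) (u j)) * (\<Prod>j\<in>A. kern (n j) (\<alpha> j) (x j) (u j))"
        using A by (intro prod.subset_diff) auto
      also have "(\<Prod>j\<in>{1..d} - A. kern (n j) (\<alpha> j) (x j) (u j))
          = (\<Prod>j\<in>{1..d} - A. pos_part (x j - u j) ^ (n j - 1) / fact (n j - 1))"
      proof (rule prod.cong[OF refl])
        fix j assume j: "j \<in> {1..d} - A"
        have "\<alpha> j < u j" using True j unfolding box_part_def by blast
        then show "kern (n j) (\<alpha> j) (x j) (u j) = pos_part (x j - u j) ^ (n j - 1) / fact (n j - 1)"
          by (simp add: kern_def)
      qed
      also have "(\<Prod>j\<in>A. kern (n j) (\<alpha> j) (x j) (u j))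
          = (\<Prod>j\<in>A. (- 1) ^ n j * (neg_part (x j - u j) ^ (n j - 1) / fact (n j - 1)))"
        using True by (intro prod.cong) (auto simp: kern_def box_part_def)
      finally show ?thesis using True by simp
    qed simp
  qed
  have int: "integrable \<mu> (\<lambda>u. ?k u * indicator (?B A) u)" if "A \<in> Pow {1..d}" for A
    by (intro integrable_real_mult_indicator box_part_sets[OF \<mu>] integrable_kern[OF \<mu> I n \<alpha> x]) (use that in auto)
  have "(\<Sum>A\<in>Pow {1..d}. (\<integral>u. ?k u * indicator (?B A) u \<partial>\<mu>)) = (\<integral>u. (\<Sum>A\<in>Pow {1..d}. ?k u * indicator (?B A) u) \<partial>\<mu>)"
    by (intro Bochner_Integration.integral_sum[symmetric] int)
  also have "\<dots> = (\<integral>u. ?k u \<partial>\<mu>)"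
  proof (rule Bochner_Integration.integral_cong[OF refl])
    fix u assume "u \<in> space \<mu>"
    then have u: "u \<in> Pi\<^sub>E {1..d} I" by (simp add: space_locally_finite[OF \<mu>])
    let ?A = "{j \<in> {1..d}. u j \<le> \<alpha> j}"
    have "u \<in> ?B A \<longleftrightarrow> A = ?A" if "A \<in> Pow {1..d}" for A
      using that u unfolding box_part_def by (auto simp: not_less) (metis DiffI atLeastAtMost_iff not_less)+
    then have "(\<Sum>A\<in>Pow {1..d}. ?k u * indicator (?B A) u) = (\<Sum>A\<in>Pow {1..d}. if A = ?A then ?k u else 0)"
      by (intro sum.cong) (auto simp: indicator_def)
    also have "\<dots> = ?k u"
    proof -
      have "?A \<in> Pow {1..d}" by blast
      then show ?thesis by (simp only: sum.delta' finite_Pow_iff finite_atLeastAtMost sum.delta if_True)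
    qed
    finally show "(\<Sum>A\<in>Pow {1..d}. ?k u * indicator (?B A) u) = ?k u" .
  qed
  finally show ?thesis by - (rule trans[OF sum.cong[OF refl eq]])
qed

lemma mdd_integral:
  fixes k :: "('i \<Rightarrow> real) \<Rightarrow> 'b \<Rightarrow> real"
  assumes "\<And>t. t \<in> Pi\<^sub>E A S \<Longrightarrow> integrable \<mu> (k t)"
  shows "mdd A S (\<lambda>x. \<integral>u. k x u \<partial>\<mu>) = (\<integral>u. mdd A S (\<lambda>x. k x u) \<partial>\<mu>)"
  unfolding mdd_def using assms by (simp add: Bochner_Integration.integral_sum)

lemma mdd_integral_kern:
  assumes \<mu>: "locally_finite_borel_measure d I \<mu>" and I: "\<And>i. i \<in> {1..d} \<Longrightarrow> is_interval (I i)"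
    and n: "\<And>i. i \<in> {1..d} \<Longrightarrow> n i \<ge> 2" and \<alpha>: "\<alpha> \<in> Pi\<^sub>E {1..d} I" and S: "nodes d I n S"
  shows "mdd {1..d} S (\<lambda>x. \<integral>u. (\<Prod>j\<in>{1..d}. kern (n j) (\<alpha> j) (x j) (u j)) \<partial>\<mu>)
     = (\<integral>u. (\<Prod>j\<in>{1..d}. dd (S j) (trunc_pow (n j) 0 (u j))) \<partial>\<mu>)"
proof -
  have SI: "Pi\<^sub>E {1..d} S \<subseteq> Pi\<^sub>E {1..d} I" using S by (intro PiE_mono) (auto simp: nodes_def)
  have "mdd {1..d} S (\<lambda>x. \<integral>u. (\<Prod>j\<in>{1..d}. kern (n j) (\<alpha> j) (x j) (u j)) \<partial>\<mu>)
     = (\<integral>u. mdd {1..d} S (\<lambda>x. \<Prod>j\<in>{1..d}. kern (n j) (\<alpha> j) (x j) (u j)) \<partial>\<mu>)"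
    using SI by (intro mdd_integral integrable_kern[OF \<mu> I n \<alpha>]) auto
  also have "\<dots> = (\<integral>u. (\<Prod>j\<in>{1..d}. dd (S j) (trunc_pow (n j) 0 (u j))) \<partial>\<mu>)"
  proof (rule Bochner_Integration.integral_cong[OF refl])
    fix u
    have "mdd {1..d} S (\<lambda>x. \<Prod>j\<in>{1..d}. kern (n j) (\<alpha> j) (x j) (u j))
        = (\<Prod>j\<in>{1..d}. dd (S j) (\<lambda>s. kern (n j) (\<alpha> j) s (u j)))"
      by (rule mdd_prod) simp
    also have "\<dots> = (\<Prod>j\<in>{1..d}. dd (S j) (trunc_pow (n j) 0 (u j)))"
      using S n by (intro prod.cong refl dd_kern) (auto simp: nodes_def)
    finally show "mdd {1..d} S (\<lambda>x. \<Prod>j\<in>{1..d}. kern (n j) (\<alpha> j) (x j) (u j))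
        = (\<Prod>j\<in>{1..d}. dd (S j) (trunc_pow (n j) 0 (u j)))" .
  qed
  finally show ?thesis .
qed

lemma prod_bspline_nonneg:
  assumes S: "nodes d I n S" and n: "\<And>i. i \<in> {1..d} \<Longrightarrow> n i \<ge> 2"
  shows "(\<Prod>j\<in>{1..d}. dd (S j) (trunc_pow (n j) 0 (u j))) \<ge> 0"
proof (rule prod_nonneg)
  fix j assume "j \<in> {1..d}"
  then show "dd (S j) (trunc_pow (n j) 0 (u j)) \<ge> 0"
    using S n[of j] by (intro bspline_nonneg) (auto simp: nodes_def)
qed

section \<open>The representing measure\<close>

text \<open>Only the end points are tested, which suffices for an interval. The bound by
  \<open>N\<close> leaves finitely many windows even if \<open>I\<close> is unbounded, and is
  eventually met by all windows in a given bounded range.\<close>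

definition grid_windows :: "real set \<Rightarrow> nat \<Rightarrow> nat \<Rightarrow> int set" where
  "grid_windows I n N = {z. of_int z / fact N \<in> I \<and> of_int (z + int n) / fact N \<in> I \<and>
     \<bar>of_int z / fact N\<bar> \<le> real N \<and> \<bar>of_int (z + int n) / fact N\<bar> \<le> real N}"

lemma finite_grid_windows: "finite (grid_windows I n N)"
proof (rule finite_subset)
  show "grid_windows I n N \<subseteq> {- int (N * fact N)..int (N * fact N)}"
  proof
    fix z assume "z \<in> grid_windows I n N"
    then have "\<bar>real_of_int z\<bar> \<le> real N * fact N"
      by (simp add: grid_windows_def abs_divide divide_le_eq)
    then have "real_of_int \<bar>z\<bar> \<le> real_of_int (int (N * fact N))" by simp
    then show "z \<in> {- int (N * fact N)..int (N * fact N)}" by (simp only: of_int_le_iff) auto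
  qed
qed simp

lemma window_subset:
  assumes "is_interval I" "z \<in> grid_windows I n N"
  shows "window (1 / fact N) n z \<subseteq> I"
proof -
  have "{1 / fact N * of_int z..1 / fact N * of_int (z + int n)} \<subseteq> I"
    using assms by (intro interval_Icc_subset) (auto simp: grid_windows_def)
  moreover have "window (1 / fact N) n z \<subseteq> {1 / fact N * of_int z..1 / fact N * of_int (z + int n)}"
    unfolding window_def by (auto intro!: divide_right_mono simp del: of_int_add)
  ultimately show ?thesis by blast
qed

lemma eventually_rational_grid:
  fixes t :: real
  assumes "t \<in> \<rat>"
  shows "eventually (\<lambda>N. \<exists>k::int. t = 1 / fact N * of_int k) sequentially"
proof -
  obtain a b :: int where ab: "b > 0" "t = of_int a / of_int b"
    using assms by (metis Rats_cases')
  show ?thesis unfolding eventually_sequentially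
  proof (intro exI[of _ "nat b"] allI impI)
    fix N assume "nat b \<le> N"
    then have "nat b dvd fact N" using ab by (intro dvd_fact) auto
    then obtain c where c: "fact N = nat b * c" by (elim dvdE)
    then have fact: "(fact N :: real) = of_int b * of_nat c" using ab by (metis of_nat_fact of_nat_mult of_nat_nat order_less_imp_le)
    then have "c \<noteq> 0" by (metis fact_nonzero mult_zero_right of_nat_0)
    then have "t = 1 / fact N * of_int (a * int c)" using ab unfolding fact by simp
    then show "\<exists>k::int. t = 1 / fact N * of_int k" by blast
  qed
qed

lemma eventually_grid:
  assumes I: "is_interval I" and n: "n \<ge> 1" and S: "S \<subseteq> I \<inter> \<rat>" "finite S" "card S = n + 1"
  shows "eventually (\<lambda>N. S \<subseteq> range (\<lambda>k::int. 1 / fact N * of_int k) \<and>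
    (\<forall>g. dd S g = (\<Sum>z\<in>grid_windows I n N. (fact n * (1 / fact N) * dd S (trunc_pow n (1 / fact N) (1 / fact N * of_int z)))
       * dd (window (1 / fact N) n z) g))) sequentially"
proof -
  have "eventually (\<lambda>N. \<forall>t\<in>S. \<exists>k::int. t = 1 / fact N * of_int k) sequentially"
    using S by (intro eventually_ball_finite ballI eventually_rational_grid) auto
  moreover have "eventually (\<lambda>N. max \<bar>Min S\<bar> \<bar>Max S\<bar> \<le> real N) sequentially"
    using filterlim_real_sequentially unfolding filterlim_at_top by blast
  ultimately show ?thesis
  proof eventually_elim
    case (elim N)
    let ?h = "1 / fact N :: real"
    have grid: "S \<subseteq> range (\<lambda>k::int. ?h * of_int k)" using elim(1) by blast
    have ne: "S \<noteq> {}" using S by auto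
    have MM: "Min S \<in> I" "Max S \<in> I" using S Min_in[OF S(2) ne] Max_in[OF S(2) ne] by auto
    have "dd S g = (\<Sum>z\<in>grid_windows I n N. (fact n * ?h * dd S (trunc_pow n ?h (?h * of_int z))) * dd (window ?h n z) g)" for g
    proof (rule dd_grid_expansion[OF _ n S(2,3) grid finite_grid_windows])
      fix z :: int assume z: "Min S \<le> ?h * of_int z" "?h * of_int (z + int n) \<le> Max S"
      have "?h * of_int z \<le> ?h * of_int (z + int n)" by (intro mult_left_mono) auto
      then have "?h * of_int z \<in> {Min S..Max S}" "?h * of_int (z + int n) \<in> {Min S..Max S}" using z by auto
      moreover have "v \<in> I \<and> \<bar>v\<bar> \<le> real N" if "v \<in> {Min S..Max S}" for v
        using that interval_Icc_subset[OF I MM] elim(2) by auto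
      moreover have eq: "of_int k / fact N = ?h * of_int k" for k by simp
      ultimately show "z \<in> grid_windows I n N" unfolding grid_windows_def mem_Collect_eq eq by blast
    qed simp
    then show ?case using grid by blast
  qed
qed

text \<open>The mass of the atom at the lower corner of the window \<open>z\<close>. It collects
  everything in the grid expansion except the discrete B-splines, so it depends on \<open>f\<close>
  but not on the nodes.\<close>

definition grid_mass :: "nat \<Rightarrow> (nat \<Rightarrow> nat) \<Rightarrow> ((nat \<Rightarrow> real) \<Rightarrow> real) \<Rightarrow> nat \<Rightarrow> (nat \<Rightarrow> int) \<Rightarrow> real" where
  "grid_mass d n f N z = (\<Prod>i\<in>{1..d}. fact (n i) * (1 / fact N)) * mdd {1..d} (\<lambda>i. window (1 / fact N) (n i) (z i)) f"

definition grid_index :: "nat \<Rightarrow> (nat \<Rightarrow> real set) \<Rightarrow> (nat \<Rightarrow> nat) \<Rightarrow> nat \<Rightarrow> (nat \<Rightarrow> int) set" where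
  "grid_index d I n N = Pi\<^sub>E {1..d} (\<lambda>i. grid_windows (I i) (n i) N)"

lemma grid_mass_nonneg:
  assumes f: "box_convex d I n f" and I: "\<And>i. i \<in> {1..d} \<Longrightarrow> is_interval (I i)" and z: "z \<in> grid_index d I n N"
  shows "grid_mass d n f N z \<ge> 0"
proof -
  have "nodes d I n (\<lambda>i. window (1 / fact N) (n i) (z i))"
    unfolding nodes_def using z by (intro ballI conjI window_subset I card_window finite_window) (auto simp: grid_index_def)
  then have "mdd {1..d} (\<lambda>i. window (1 / fact N) (n i) (z i)) f \<ge> 0" using f box_convex_iff by blast
  then show ?thesis unfolding grid_mass_def by (intro mult_nonneg_nonneg prod_nonneg) auto
qed

text \<open>Dividing each factor by \<open>M i\<close> brings it into the unit ball, where a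
  difference of products is at most the sum of the differences; \<open>M i \<ge> 1\<close> ensures
  that the division does not enlarge these.\<close>

lemma prod_diff_bound:
  fixes a b :: "'i \<Rightarrow> real"
  assumes "\<And>i. i \<in> A \<Longrightarrow> M i \<ge> 1" "\<And>i. i \<in> A \<Longrightarrow> \<bar>a i\<bar> \<le> M i" "\<And>i. i \<in> A \<Longrightarrow> \<bar>b i\<bar> \<le> M i"
  shows "\<bar>(\<Prod>i\<in>A. a i) - (\<Prod>i\<in>A. b i)\<bar> \<le> (\<Prod>i\<in>A. M i) * (\<Sum>i\<in>A. \<bar>a i - b i\<bar>)"
proof -
  have M: "0 < M i" if "i \<in> A" for i using assms(1)[OF that] by simp
  have P: "(\<Prod>i\<in>A. M i) > 0" using M by (rule prod_pos)
  have "norm ((\<Prod>i\<in>A. a i / M i) - (\<Prod>i\<in>A. b i / M i)) \<le> (\<Sum>i\<in>A. norm (a i / M i - b i / M i))"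
    by (rule norm_prod_diff) (use assms(2,3) M in \<open>simp_all add: abs_divide abs_of_pos pos_divide_le_eq\<close>)
  also have "\<dots> \<le> (\<Sum>i\<in>A. \<bar>a i - b i\<bar>)"
  proof (rule sum_mono)
    fix i assume i: "i \<in> A"
    have "\<bar>a i - b i\<bar> * 1 \<le> \<bar>a i - b i\<bar> * M i" using assms(1)[OF i] by (intro mult_left_mono) auto
    then show "norm (a i / M i - b i / M i) \<le> \<bar>a i - b i\<bar>"
      using M[OF i] by (simp add: diff_divide_distrib[symmetric] abs_divide divide_le_eq)
  qed
  finally have "\<bar>((\<Prod>i\<in>A. a i) - (\<Prod>i\<in>A. b i)) / (\<Prod>i\<in>A. M i)\<bar> \<le> (\<Sum>i\<in>A. \<bar>a i - b i\<bar>)"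
    by (simp add: prod_dividef diff_divide_distrib)
  then show ?thesis using P by (simp add: abs_divide divide_le_eq mult.commute)
qed

text \<open>That the nodes lie on the grid is kept in the conclusion because nonnegativity of the
  discrete B-splines relies on it.\<close>

lemma grid_expansion_eventually:
  assumes I: "\<And>i. i \<in> {1..d} \<Longrightarrow> is_interval (I i)"
    and n: "\<And>i. i \<in> {1..d} \<Longrightarrow> n i \<ge> 2" and S: "nodes d I n S" "\<And>i. i \<in> {1..d} \<Longrightarrow> S i \<subseteq> \<rat>"
  shows "eventually (\<lambda>N. (\<forall>i\<in>{1..d}. S i \<subseteq> range (\<lambda>k::int. 1 / fact N * of_int k)) \<and>
    mdd {1..d} S f = (\<Sum>z\<in>grid_index d I n N. grid_mass d n f N z *
      (\<Prod>i\<in>{1..d}. dd (S i) (trunc_pow (n i) (1 / fact N) (1 / fact N * of_int (z i)))))) sequentially"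
proof -
  have "eventually (\<lambda>N. \<forall>i\<in>{1..d}. S i \<subseteq> range (\<lambda>k::int. 1 / fact N * of_int k) \<and>
    (\<forall>g. dd (S i) g = (\<Sum>z\<in>grid_windows (I i) (n i) N. (fact (n i) * (1 / fact N) * dd (S i) (trunc_pow (n i) (1 / fact N) (1 / fact N * of_int z)))
       * dd (window (1 / fact N) (n i) z) g))) sequentially"
  proof (intro eventually_ball_finite ballI eventually_grid)
    fix i assume i: "i \<in> {1..d}"
    show "n i \<ge> 1" using n[OF i] by simp
  qed (use I S in \<open>auto simp: nodes_def\<close>)
  then show ?thesis
  proof eventually_elim
    case (elim N)
    have "mdd {1..d} S f = (\<Sum>z\<in>grid_index d I n N.
      (\<Prod>i\<in>{1..d}. fact (n i) * (1 / fact N) * dd (S i) (trunc_pow (n i) (1 / fact N) (1 / fact N * of_int (z i))))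
      * mdd {1..d} (\<lambda>i. window (1 / fact N) (n i) (z i)) f)"
      unfolding grid_index_def by (rule mdd_expansion) (use elim in blast)+
    also have "\<dots> = (\<Sum>z\<in>grid_index d I n N. grid_mass d n f N z *
      (\<Prod>i\<in>{1..d}. dd (S i) (trunc_pow (n i) (1 / fact N) (1 / fact N * of_int (z i)))))"
      by (intro sum.cong refl) (simp only: grid_mass_def prod.distrib mult_ac)
    finally show ?case using elim by blast
  qed
qed

lemma inverse_fact_tendsto_0: "(\<lambda>N. 1 / fact N :: real) \<longlonglongrightarrow> 0"
  using summable_LIMSEQ_zero[OF summable_exp[of "1::real"]] by (simp add: field_simps)

text \<open>The errors are absorbed by the discretised B-splines of coarser nodes \<open>S'\<close> that dominate those
  of \<open>S\<close>, since the grid sum for \<open>S'\<close> is \<open>mdd {1..d} S' f\<close> and hence bounded.\<close>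
lemma grid_sum_tendsto:
  assumes I: "\<And>i. i \<in> {1..d} \<Longrightarrow> open (I i) \<and> is_interval (I i)"
    and n: "\<And>i. i \<in> {1..d} \<Longrightarrow> n i \<ge> 2" and f: "box_convex d I n f"
    and S: "nodes d I n S" "\<And>i. i \<in> {1..d} \<Longrightarrow> S i \<subseteq> \<rat>"
  shows "(\<lambda>N. \<Sum>z\<in>grid_index d I n N. grid_mass d n f N z *
     (\<Prod>i\<in>{1..d}. dd (S i) (trunc_pow (n i) 0 (1 / fact N * of_int (z i))))) \<longlonglongrightarrow> mdd {1..d} S f"
proof -
  have Ii: "\<And>i. i \<in> {1..d} \<Longrightarrow> is_interval (I i)" using I by blast
  have n1: "n i \<ge> 1" if "i \<in> {1..d}" for i using n[OF that] by simp
  have Si: "finite (S i)" "card (S i) = n i + 1" "S i \<subseteq> I i" "S i \<noteq> {}" if "i \<in> {1..d}" for i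
  proof -
    show "finite (S i)" "card (S i) = n i + 1" "S i \<subseteq> I i" using S that by (auto simp: nodes_def)
    then show "S i \<noteq> {}" by auto
  qed
  have "\<forall>i\<in>{1..d}. \<exists>S' \<delta>. S' \<subseteq> I i \<inter> \<rat> \<and> finite S' \<and> card S' = n i + 1 \<and> \<delta> > 0 \<and>
      (\<forall>u\<in>{Min (S i)..Max (S i)}. dd S' (trunc_pow (n i) 0 u) \<ge> \<delta>)"
  proof
    fix i assume i: "i \<in> {1..d}"
    have M: "Min (S i) \<in> S i" "Max (S i) \<in> S i" using Si[OF i] by auto
    then have "Min (S i) \<in> I i" "Max (S i) \<in> I i" "Min (S i) \<le> Max (S i)"
      using Si(3)[OF i] Min_le[OF Si(1)[OF i] M(2)] by blast+
    from obtain_dominating_nodes[OF _ _ this n[OF i]] I[OF i]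
    show "\<exists>S' \<delta>. S' \<subseteq> I i \<inter> \<rat> \<and> finite S' \<and> card S' = n i + 1 \<and> \<delta> > 0 \<and>
      (\<forall>u\<in>{Min (S i)..Max (S i)}. dd S' (trunc_pow (n i) 0 u) \<ge> \<delta>)" by metis
  qed
  then obtain S' \<delta> where S': "\<And>i. i \<in> {1..d} \<Longrightarrow> S' i \<subseteq> I i \<inter> \<rat> \<and> finite (S' i) \<and> card (S' i) = n i + 1"
    and \<delta>: "\<And>i. i \<in> {1..d} \<Longrightarrow> \<delta> i > 0"
    and dom: "\<And>i u. i \<in> {1..d} \<Longrightarrow> u \<in> {Min (S i)..Max (S i)} \<Longrightarrow> dd (S' i) (trunc_pow (n i) 0 u) \<ge> \<delta> i"
    by metis
  have S'n: "nodes d I n S'" "\<And>i. i \<in> {1..d} \<Longrightarrow> S' i \<subseteq> \<rat>" using S' by (auto simp: nodes_def)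
  have "\<forall>i\<in>{1..d}. \<exists>C\<ge>0. \<forall>h\<in>{0..1}. \<forall>u. \<bar>dd (S i) (trunc_pow (n i) h u) - dd (S i) (trunc_pow (n i) 0 u)\<bar> \<le> C * h"
    using dd_trunc_pow_perturb Si n1 by metis
  then obtain C where C: "\<And>i. i \<in> {1..d} \<Longrightarrow> C i \<ge> 0"
    "\<And>i h u. i \<in> {1..d} \<Longrightarrow> h \<in> {0..1} \<Longrightarrow> \<bar>dd (S i) (trunc_pow (n i) h u) - dd (S i) (trunc_pow (n i) 0 u)\<bar> \<le> C i * h"
    by metis
  have "\<forall>i\<in>{1..d}. \<exists>C\<ge>0. \<forall>h\<in>{0..1}. \<forall>u. \<bar>dd (S' i) (trunc_pow (n i) h u) - dd (S' i) (trunc_pow (n i) 0 u)\<bar> \<le> C * h"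
    using dd_trunc_pow_perturb S' n1 by metis
  then obtain C' where C': "\<And>i. i \<in> {1..d} \<Longrightarrow> C' i \<ge> 0"
    "\<And>i h u. i \<in> {1..d} \<Longrightarrow> h \<in> {0..1} \<Longrightarrow> \<bar>dd (S' i) (trunc_pow (n i) h u) - dd (S' i) (trunc_pow (n i) 0 u)\<bar> \<le> C' i * h"
    by metis
  have "\<forall>i\<in>{1..d}. \<exists>M\<ge>1. \<forall>h\<in>{0..1}. \<forall>u. \<bar>dd (S i) (trunc_pow (n i) h u)\<bar> \<le> M"
    using dd_trunc_pow_bounded Si n by metis
  then obtain M where M: "\<And>i. i \<in> {1..d} \<Longrightarrow> M i \<ge> 1"
    "\<And>i h u. i \<in> {1..d} \<Longrightarrow> h \<in> {0..1} \<Longrightarrow> \<bar>dd (S i) (trunc_pow (n i) h u)\<bar> \<le> M i"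
    by metis
  let ?h = "\<lambda>N. 1 / fact N :: real"
  \<comment> \<open>\<open>K * ?h N\<close> bounds the change of the product for \<open>S\<close>
    when B-splines replace discrete ones. \<open>D\<close> bounds the product of discrete B-splines
    for \<open>S'\<close> from below on the range of \<open>S\<close>, half of each
    \<open>\<delta> i\<close> being given up for the passage to positive mesh.\<close>
  define K where "K = (\<Prod>i\<in>{1..d}. M i) * (\<Sum>i\<in>{1..d}. C i)"
  define D where "D = (\<Prod>i\<in>{1..d}. \<delta> i / 2)"
  have K: "K \<ge> 0" unfolding K_def using M(1) C(1)
    by (intro mult_nonneg_nonneg prod_nonneg sum_nonneg) (auto intro: order_trans[of 0 1])
  have D: "D > 0" unfolding D_def using \<delta> by (intro prod_pos) auto
  have small: "eventually (\<lambda>N. \<forall>i\<in>{1..d}. C' i * ?h N < \<delta> i / 2) sequentially"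
  proof (intro eventually_ball_finite ballI)
    fix i assume "i \<in> {1..d}"
    moreover have "(\<lambda>N. C' i * ?h N) \<longlonglongrightarrow> C' i * 0" by (intro tendsto_intros inverse_fact_tendsto_0)
    ultimately show "eventually (\<lambda>N. C' i * ?h N < \<delta> i / 2) sequentially"
      using \<delta> by (intro order_tendstoD(2)[of _ "C' i * 0"]) auto
  qed simp
  have exps: "eventually (\<lambda>N. (\<forall>i\<in>{1..d}. S i \<subseteq> range (\<lambda>k::int. 1 / fact N * of_int k)) \<and>
    mdd {1..d} S f = (\<Sum>z\<in>grid_index d I n N. grid_mass d n f N z *
      (\<Prod>i\<in>{1..d}. dd (S i) (trunc_pow (n i) (1 / fact N) (1 / fact N * of_int (z i)))))) sequentially"
    "eventually (\<lambda>N. (\<forall>i\<in>{1..d}. S' i \<subseteq> range (\<lambda>k::int. 1 / fact N * of_int k)) \<and>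
    mdd {1..d} S' f = (\<Sum>z\<in>grid_index d I n N. grid_mass d n f N z *
      (\<Prod>i\<in>{1..d}. dd (S' i) (trunc_pow (n i) (1 / fact N) (1 / fact N * of_int (z i)))))) sequentially"
    by (rule grid_expansion_eventually[OF Ii n S] grid_expansion_eventually[OF Ii n S'n]; assumption)+
  from small exps have ev: "eventually (\<lambda>N. norm ((\<Sum>z\<in>grid_index d I n N. grid_mass d n f N z *
     (\<Prod>i\<in>{1..d}. dd (S i) (trunc_pow (n i) 0 (?h N * of_int (z i))))) - mdd {1..d} S f)
     \<le> K / D * mdd {1..d} S' f * ?h N) sequentially"
  proof eventually_elim
    case (elim N)
    let ?J = "grid_index d I n N" and ?m = "grid_mass d n f N"
    let ?u = "\<lambda>z i. ?h N * of_int (z i :: int)"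
    let ?a = "\<lambda>z i. dd (S i) (trunc_pow (n i) 0 (?u z i))"
    let ?b = "\<lambda>z i. dd (S i) (trunc_pow (n i) (?h N) (?u z i))"
    let ?c = "\<lambda>z i. dd (S' i) (trunc_pow (n i) (?h N) (?u z i))"
    have h01: "?h N \<in> {0..1}" by (simp add: divide_le_eq fact_ge_1)
    have c_nonneg: "?c z i \<ge> 0" if i: "i \<in> {1..d}" for z i
    proof (rule dd_trunc_pow_nonneg)
      fix t assume "t \<in> S' i"
      then obtain k :: int where "t = ?h N * of_int k" using elim(3) i by blast
      then have "t = ?u z i + of_int (k - z i) * ?h N" by (simp add: field_simps)
      then show "?h N = 0 \<or> (\<exists>k::int. t = ?u z i + of_int k * ?h N)" by blast
    qed (use S'[OF i] n1[OF i] in auto)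
    \<comment> \<open>Where some coordinate leaves the range of its nodes, both products on the left
      vanish; elsewhere the last product is at least \<open>D\<close>. Summed against the
      nonnegative masses, this makes the error a bounded multiple of \<open>?h N\<close>.\<close>
    have key: "\<bar>(\<Prod>i\<in>{1..d}. ?a z i) - (\<Prod>i\<in>{1..d}. ?b z i)\<bar> \<le> K / D * ?h N * (\<Prod>i\<in>{1..d}. ?c z i)" for z
    proof (cases "\<forall>i\<in>{1..d}. ?u z i \<in> {Min (S i)..Max (S i)}")
      case True
      have "\<bar>(\<Prod>i\<in>{1..d}. ?a z i) - (\<Prod>i\<in>{1..d}. ?b z i)\<bar> \<le> (\<Prod>i\<in>{1..d}. M i) * (\<Sum>i\<in>{1..d}. \<bar>?a z i - ?b z i\<bar>)"
        by (rule prod_diff_bound) (use M h01 in auto)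
      also have "\<dots> \<le> (\<Prod>i\<in>{1..d}. M i) * (\<Sum>i\<in>{1..d}. C i * ?h N)"
      proof (intro mult_left_mono sum_mono)
        show "\<bar>?a z i - ?b z i\<bar> \<le> C i * ?h N" if "i \<in> {1..d}" for i
          using C(2)[OF that h01] by (simp only: abs_minus_commute)
        show "0 \<le> (\<Prod>i\<in>{1..d}. M i)" using M(1) by (intro prod_nonneg) (auto intro: order_trans[of 0 1])
      qed
      also have "\<dots> = K / D * ?h N * D" using D unfolding K_def sum_distrib_right[symmetric] by simp
      also have "\<dots> \<le> K / D * ?h N * (\<Prod>i\<in>{1..d}. ?c z i)"
      proof (rule mult_left_mono)
        show "D \<le> (\<Prod>i\<in>{1..d}. ?c z i)" unfolding D_def
        proof (rule prod_mono)
          fix i assume i: "i \<in> {1..d}"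
          have "\<delta> i \<le> dd (S' i) (trunc_pow (n i) 0 (?u z i))" using dom[OF i] True i by blast
          moreover have "C' i * ?h N < \<delta> i / 2" using elim(1) i by blast
          ultimately show "0 \<le> \<delta> i / 2 \<and> \<delta> i / 2 \<le> ?c z i"
            using C'(2)[OF i h01, of "?u z i"] \<delta>[OF i] by linarith
        qed
      qed (use K D in auto)
      finally show ?thesis .
    next
      case False
      then obtain i where i: "i \<in> {1..d}" "?u z i \<notin> {Min (S i)..Max (S i)}" by blast
      then have "?a z i = 0" "?b z i = 0" using Si n1 by (auto intro!: dd_trunc_pow_outside)
      then have "(\<Prod>i\<in>{1..d}. ?a z i) = 0" "(\<Prod>i\<in>{1..d}. ?b z i) = 0"
        using i(1) by (meson finite_atLeastAtMost prod_zero)+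
      moreover have "0 \<le> K / D * ?h N * (\<Prod>i\<in>{1..d}. ?c z i)"
        using K D c_nonneg by (intro mult_nonneg_nonneg prod_nonneg) auto
      ultimately show ?thesis by (simp only: diff_self abs_zero)
    qed
    have diff: "(\<Sum>z\<in>?J. ?m z * (\<Prod>i\<in>{1..d}. ?a z i)) - mdd {1..d} S f
        = (\<Sum>z\<in>?J. ?m z * ((\<Prod>i\<in>{1..d}. ?a z i) - (\<Prod>i\<in>{1..d}. ?b z i)))"
      using elim(2) by (simp add: right_diff_distrib sum_subtractf)
    have "norm ((\<Sum>z\<in>?J. ?m z * (\<Prod>i\<in>{1..d}. ?a z i)) - mdd {1..d} S f)
        \<le> (\<Sum>z\<in>?J. norm (?m z * ((\<Prod>i\<in>{1..d}. ?a z i) - (\<Prod>i\<in>{1..d}. ?b z i))))"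
      unfolding diff by (rule norm_sum)
    also have "\<dots> \<le> (\<Sum>z\<in>?J. ?m z * (K / D * ?h N * (\<Prod>i\<in>{1..d}. ?c z i)))"
    proof (rule sum_mono)
      fix z assume "z \<in> ?J"
      then have "?m z \<ge> 0" using grid_mass_nonneg[OF f, where z = z and N = N] Ii by blast
      then show "norm (?m z * ((\<Prod>i\<in>{1..d}. ?a z i) - (\<Prod>i\<in>{1..d}. ?b z i))) \<le> ?m z * (K / D * ?h N * (\<Prod>i\<in>{1..d}. ?c z i))"
        unfolding real_norm_def abs_mult using key[of z] by (simp only: abs_of_nonneg mult_left_mono)
    qed
    also have "\<dots> = K / D * ?h N * (\<Sum>z\<in>?J. ?m z * (\<Prod>i\<in>{1..d}. ?c z i))"
      unfolding sum_distrib_left by (intro sum.cong refl) (simp only: mult_ac)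
    also have "\<dots> = K / D * ?h N * mdd {1..d} S' f"
      by (simp only: conjunct2[OF elim(3)])
    also have "\<dots> = K / D * mdd {1..d} S' f * ?h N" by simp
    finally show ?case .
  qed
  have "(\<lambda>N. K / D * mdd {1..d} S' f * ?h N) \<longlonglongrightarrow> 0"
    by (intro tendsto_mult_right_zero inverse_fact_tendsto_0)
  then show ?thesis by (rule LIM_zero_cancel[OF Lim_null_comparison[OF ev]])
qed

text \<open>The functions \<open>b k\<close> for \<open>vague_limit_atoms\<close> are the products
  of B-splines with rational nodes: they are countably many, each point of the box has one that is
  positive there, and their grid sums are bounded because they converge.\<close>

lemma box_convex_imp_measure:
  assumes d: "d \<ge> 1" and I: "\<And>i. i \<in> {1..d} \<Longrightarrow> open (I i) \<and> is_interval (I i)"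
    and n: "\<And>i. i \<in> {1..d} \<Longrightarrow> n i \<ge> 2" and f: "box_convex d I n f" and x0: "x0 \<in> Pi\<^sub>E {1..d} I"
  obtains \<mu> where "locally_finite_borel_measure d I \<mu>"
    "\<And>S. nodes d I n S \<Longrightarrow> (\<And>i. i \<in> {1..d} \<Longrightarrow> S i \<subseteq> \<rat>) \<Longrightarrow>
       mdd {1..d} S f = (\<integral>u. (\<Prod>j\<in>{1..d}. dd (S j) (trunc_pow (n j) 0 (u j))) \<partial>\<mu>)"
proof -
  let ?X = "Pi\<^sub>E {1..d} I"
  let ?b = "\<lambda>S u. \<Prod>j\<in>{1..d}. dd (S j) (trunc_pow (n j) 0 (u j))"
  have Ii: "\<And>i. i \<in> {1..d} \<Longrightarrow> is_interval (I i)" using I by blast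
  \<comment> \<open>Extensional families, so that the set of all rational node tuples is
    countable.\<close>
  define \<F> where "\<F> = Pi\<^sub>E {1..d} (\<lambda>i. {T. finite T \<and> T \<subseteq> I i \<inter> \<rat> \<and> card T = n i + 1})"
  have \<F>: "nodes d I n S" "\<And>i. i \<in> {1..d} \<Longrightarrow> S i \<subseteq> \<rat>" if "S \<in> \<F>" for S
    using that by (auto simp: \<F>_def nodes_def PiE_iff)
  have "countable \<F>" unfolding \<F>_def
  proof (rule countable_PiE)
    fix i
    have "countable {T. finite T \<and> T \<subseteq> I i \<inter> \<rat>}"
      by (intro countable_Collect_finite_subset countable_Int2 countable_rat)
    then show "countable {T. finite T \<and> T \<subseteq> I i \<inter> \<rat> \<and> card T = n i + 1}"
      by (rule countable_subset[rotated]) auto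
  qed simp
  have pos: "\<exists>S\<in>\<F>. ?b S u > 0" if u: "u \<in> ?X" for u
  proof -
    have "\<forall>i\<in>{1..d}. \<exists>S. S \<subseteq> I i \<inter> \<rat> \<and> finite S \<and> card S = n i + 1 \<and> dd S (trunc_pow (n i) 0 (u i)) > 0"
    proof
      fix i assume i: "i \<in> {1..d}"
      have ui: "u i \<in> I i" "u i \<le> u i" using u i by auto
      obtain S \<delta> where "S \<subseteq> I i \<inter> \<rat>" "finite S" "card S = n i + 1" "\<delta> > 0"
        "\<And>v. v \<in> {u i..u i} \<Longrightarrow> dd S (trunc_pow (n i) 0 v) \<ge> \<delta>"
        using obtain_dominating_nodes[OF _ _ ui(1) ui n[OF i]] I[OF i] by metis
      then show "\<exists>S. S \<subseteq> I i \<inter> \<rat> \<and> finite S \<and> card S = n i + 1 \<and> dd S (trunc_pow (n i) 0 (u i)) > 0"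
        by (meson atLeastAtMost_iff less_le_trans order_refl)
    qed
    then obtain S where S: "\<And>i. i \<in> {1..d} \<Longrightarrow> S i \<subseteq> I i \<inter> \<rat> \<and> finite (S i) \<and> card (S i) = n i + 1 \<and> dd (S i) (trunc_pow (n i) 0 (u i)) > 0"
      by metis
    have "restrict S {1..d} \<in> \<F>" using S by (simp add: \<F>_def)
    moreover have "?b (restrict S {1..d}) u > 0" using S by (intro prod_pos) auto
    ultimately show ?thesis by blast
  qed
  then have ne: "\<F> \<noteq> {}" using x0 by blast
  let ?S = "from_nat_into \<F>"
  have SF: "?S k \<in> \<F>" for k using ne by (rule from_nat_into)
  have bcont: "continuous_on UNIV (?b S)" if "nodes d I n S" for S
  proof (intro continuous_on_prod)
    fix j assume "j \<in> {1..d}"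
    then show "continuous_on UNIV (\<lambda>u. dd (S j) (trunc_pow (n j) 0 (u j)))"
      by (intro continuous_on_compose2[OF continuous_bspline[OF n] continuous_on_product_coordinates]) auto
  qed
  let ?\<xi> = "\<lambda>N z. \<lambda>i\<in>{1..d}. 1 / fact N * of_int (z i :: int)"
  have sum_eq: "(\<Sum>z\<in>grid_index d I n N. grid_mass d n f N z * ?b S (?\<xi> N z))
      = (\<Sum>z\<in>grid_index d I n N. grid_mass d n f N z *
     (\<Prod>i\<in>{1..d}. dd (S i) (trunc_pow (n i) 0 (1 / fact N * of_int (z i)))))" for S N
    by (intro sum.cong arg_cong2[of _ _ _ _ "(*)"] prod.cong refl) simp
  have lim: "(\<lambda>N. \<Sum>z\<in>grid_index d I n N. grid_mass d n f N z * ?b S (?\<xi> N z)) \<longlonglongrightarrow> mdd {1..d} S f"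
    if "nodes d I n S" "\<And>i. i \<in> {1..d} \<Longrightarrow> S i \<subseteq> \<rat>" for S
    unfolding sum_eq by (rule grid_sum_tendsto[OF I n f that])
  obtain r \<mu> where r: "strict_mono (r :: nat \<Rightarrow> nat)" and \<mu>: "locally_finite_borel_measure d I \<mu>" and
    conv: "\<And>(\<phi> :: (nat \<Rightarrow> real) \<Rightarrow> real) p q. continuous_on UNIV \<phi> \<Longrightarrow> (\<And>i. i \<in> {1..d} \<Longrightarrow> {p i..q i} \<subseteq> I i) \<Longrightarrow>
       (\<And>u. u \<in> ?X \<Longrightarrow> \<phi> u \<noteq> 0 \<Longrightarrow> u \<in> Pi\<^sub>E {1..d} (\<lambda>i. {p i..q i})) \<Longrightarrow>
       (\<lambda>N. \<Sum>j\<in>grid_index d I n (r N). grid_mass d n f (r N) j * \<phi> (?\<xi> (r N) j)) \<longlonglongrightarrow> (\<integral>u. \<phi> u \<partial>\<mu>)"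
  proof -
    note obt = that
    show thesis
    proof (rule vague_limit_atoms[where d = d and I = I and ?x0.0 = x0 and J = "grid_index d I n" and m = "grid_mass d n f" and \<xi> = ?\<xi> and b = "\<lambda>k. ?b (?S k)"])
      show "finite (grid_index d I n N)" for N
        unfolding grid_index_def by (intro finite_PiE finite_grid_windows) simp
      show "0 \<le> grid_mass d n f N z" if "z \<in> grid_index d I n N" for N z
        using that grid_mass_nonneg[OF f, where z = z and N = N] Ii by blast
      show "?\<xi> N z \<in> ?X" if "z \<in> grid_index d I n N" for N z
        using that by (auto simp: grid_index_def grid_windows_def PiE_iff)
      show "continuous_on UNIV (?b (?S k))" for k by (rule bcont[OF \<F>(1)[OF SF]])
      show "0 \<le> ?b (?S k) u" for k u by (rule prod_bspline_nonneg[OF \<F>(1)[OF SF] n])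
      show "\<exists>B. \<forall>u. ?b (?S k) u \<le> B" for k
      proof -
        have "\<forall>j\<in>{1..d}. \<exists>M. \<forall>u. \<bar>dd (?S k j) (trunc_pow (n j) 0 u)\<bar> \<le> M"
        proof
          fix j assume j: "j \<in> {1..d}"
          have "finite (?S k j)" "card (?S k j) = n j + 1" using \<F>(1)[OF SF, of k] j by (auto simp: nodes_def)
          from dd_trunc_pow_bounded[OF this n[OF j]] show "\<exists>M. \<forall>u. \<bar>dd (?S k j) (trunc_pow (n j) 0 u)\<bar> \<le> M"
            by (metis atLeastAtMost_iff order_refl zero_le_one)
        qed
        then obtain M where M: "\<And>j u. j \<in> {1..d} \<Longrightarrow> \<bar>dd (?S k j) (trunc_pow (n j) 0 u)\<bar> \<le> M j" by metis
        have "?b (?S k) u \<le> (\<Prod>j\<in>{1..d}. M j)" for u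
        proof -
          have "\<bar>?b (?S k) u\<bar> \<le> (\<Prod>j\<in>{1..d}. M j)" unfolding abs_prod by (intro prod_mono conjI M) auto
          then show ?thesis by linarith
        qed
        then show ?thesis by blast
      qed
      show "\<exists>k. ?b (?S k) u > 0" if "u \<in> ?X" for u
        using pos[OF that] from_nat_into_surj[OF \<open>countable \<F>\<close>] by metis
      show "\<exists>C. \<forall>N. (\<Sum>z\<in>grid_index d I n N. grid_mass d n f N z * ?b (?S k) (?\<xi> N z)) \<le> C" for k
      proof -
        have "Bseq (\<lambda>N. \<Sum>z\<in>grid_index d I n N. grid_mass d n f N z * ?b (?S k) (?\<xi> N z))"
          by (rule convergent_imp_Bseq[OF convergentI[OF lim[OF \<F>[OF SF]]]])
        then obtain C where C: "\<And>N. norm (\<Sum>z\<in>grid_index d I n N. grid_mass d n f N z * ?b (?S k) (?\<xi> N z)) \<le> C"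
          by (elim BseqE) blast
        then show ?thesis by (intro exI[of _ C] allI) (rule order_trans[OF abs_ge_self C[unfolded real_norm_def]])
      qed
      show "1 \<le> d" by (rule d)
      show "open (I i)" if "i \<in> {1..d}" for i using I[OF that] by (rule conjunct1)
      show "x0 \<in> ?X" by (rule x0)
      fix r \<mu> assume r: "strict_mono (r :: nat \<Rightarrow> nat)" and \<mu>: "locally_finite_borel_measure d I \<mu>" and
        conv: "\<And>(\<phi> :: (nat \<Rightarrow> real) \<Rightarrow> real) p q. continuous_on UNIV \<phi> \<Longrightarrow> (\<And>i. i \<in> {1..d} \<Longrightarrow> {p i..q i} \<subseteq> I i) \<Longrightarrow>
          (\<And>u. u \<in> ?X \<Longrightarrow> \<phi> u \<noteq> 0 \<Longrightarrow> u \<in> Pi\<^sub>E {1..d} (\<lambda>i. {p i..q i})) \<Longrightarrow>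
          (\<lambda>N. \<Sum>j\<in>grid_index d I n (r N). grid_mass d n f (r N) j * \<phi> (?\<xi> (r N) j)) \<longlonglongrightarrow> (\<integral>u. \<phi> u \<partial>\<mu>)"
      show thesis by (rule obt[OF r \<mu>]) (rule conv)
    qed
  qed
  show ?thesis
  proof (rule that[OF \<mu>])
    fix S assume S: "nodes d I n S" "\<And>i. i \<in> {1..d} \<Longrightarrow> S i \<subseteq> \<rat>"
    have Si: "finite (S i)" "card (S i) = n i + 1" "S i \<subseteq> I i" "S i \<noteq> {}" if "i \<in> {1..d}" for i
    proof -
      show "finite (S i)" "card (S i) = n i + 1" "S i \<subseteq> I i" using S that by (auto simp: nodes_def)
      then show "S i \<noteq> {}" by auto
    qed
    have "(\<lambda>N. \<Sum>z\<in>grid_index d I n (r N). grid_mass d n f (r N) z * ?b S (?\<xi> (r N) z)) \<longlonglongrightarrow> (\<integral>u. ?b S u \<partial>\<mu>)"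
    proof (rule conv[of "?b S" "\<lambda>i. Min (S i)" "\<lambda>i. Max (S i)"])
      show "continuous_on UNIV (?b S)" by (rule bcont[OF S(1)])
      show "{Min (S i)..Max (S i)} \<subseteq> I i" if i: "i \<in> {1..d}" for i
        using Min_in[of "S i"] Max_in[of "S i"] Si[OF i] by (intro interval_Icc_subset Ii i) blast+
      show "u \<in> Pi\<^sub>E {1..d} (\<lambda>i. {Min (S i)..Max (S i)})" if u: "u \<in> ?X" and b: "?b S u \<noteq> 0" for u
      proof (rule PiE_I)
        fix i assume i: "i \<in> {1..d}"
        then have "dd (S i) (trunc_pow (n i) 0 (u i)) \<noteq> 0" using b by (meson finite_atLeastAtMost prod_zero)
        then show "u i \<in> {Min (S i)..Max (S i)}"
          using dd_trunc_pow_outside[OF Si(1,2)[OF i]] n[OF i] by (metis one_le_numeral order_trans)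
      qed (use PiE_arb[OF u] in auto)
    qed
    moreover have "(\<lambda>N. \<Sum>z\<in>grid_index d I n (r N). grid_mass d n f (r N) z * ?b S (?\<xi> (r N) z)) \<longlonglongrightarrow> mdd {1..d} S f"
      using LIMSEQ_subseq_LIMSEQ[OF lim[OF S] r] by (simp add: o_def)
    ultimately show "mdd {1..d} S f = (\<integral>u. ?b S u \<partial>\<mu>)" by (rule LIMSEQ_unique[symmetric])
  qed
qed

theorem theorem37:
  fixes d :: nat and I :: "nat \<Rightarrow> real set" and n :: "nat \<Rightarrow> nat"
    and f :: "(nat \<Rightarrow> real) \<Rightarrow> real"
  assumes "d \<ge> 1"
    and "\<And>i. i \<in> {1..d} \<Longrightarrow> open (I i) \<and> is_interval (I i)"
    and "\<And>i. i \<in> {1..d} \<Longrightarrow> n i \<ge> 2"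
  shows "box_convex d I n f \<longleftrightarrow>
    (\<forall>\<alpha>\<in>Pi\<^sub>E {1..d} I.
       \<exists>(W :: (nat \<Rightarrow> real) \<Rightarrow> real) (\<mu> :: (nat \<Rightarrow> real) measure).
         pseudo_polynomial d I (\<lambda>i. n i - 1) W \<and>
         locally_finite_borel_measure d I \<mu> \<and>
         (\<forall>x\<in>Pi\<^sub>E {1..d} I.
            f x = W x + (\<Sum>A\<in>Pow {1..d}.
              (LINT u : box_part d I A \<alpha> | \<mu>.
                 (\<Prod>j\<in>{1..d} - A. pos_part (x j - u j) ^ (n j - 1) / fact (n j - 1)) *
                 (\<Prod>j\<in>A. (- 1) ^ n j * (neg_part (x j - u j) ^ (n j - 1) / fact (n j - 1)))))))"
proof -
  note I = assms(2) and n = assms(3)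
  have Ii: "\<And>i. i \<in> {1..d} \<Longrightarrow> is_interval (I i)" using I by blast
  have n1: "n i \<ge> 1" if "i \<in> {1..d}" for i using n[OF that] by simp
  let ?g = "\<lambda>\<alpha> \<mu> x. \<integral>u. (\<Prod>j\<in>{1..d}. kern (n j) (\<alpha> j) (x j) (u j)) \<partial>\<mu>"
  have g_nonneg: "mdd {1..d} S (?g \<alpha> \<mu>) \<ge> 0"
    if "locally_finite_borel_measure d I \<mu>" "\<alpha> \<in> Pi\<^sub>E {1..d} I" "nodes d I n S" for \<alpha> \<mu> S
  proof -
    have "mdd {1..d} S (?g \<alpha> \<mu>) = (\<integral>u. (\<Prod>j\<in>{1..d}. dd (S j) (trunc_pow (n j) 0 (u j))) \<partial>\<mu>)"
      by (rule mdd_integral_kern[OF that(1) Ii n that(2,3)])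
    also have "\<dots> \<ge> 0" by (rule Bochner_Integration.integral_nonneg, rule prod_bspline_nonneg[OF that(3) n])
    finally show ?thesis .
  qed
  have sum_eq: "(\<Sum>A\<in>Pow {1..d}.
              (LINT u : box_part d I A \<alpha> | \<mu>.
                 (\<Prod>j\<in>{1..d} - A. pos_part (x j - u j) ^ (n j - 1) / fact (n j - 1)) *
                 (\<Prod>j\<in>A. (- 1) ^ n j * (neg_part (x j - u j) ^ (n j - 1) / fact (n j - 1))))) = ?g \<alpha> \<mu> x"
    if "locally_finite_borel_measure d I \<mu>" "\<alpha> \<in> Pi\<^sub>E {1..d} I" "x \<in> Pi\<^sub>E {1..d} I" for \<alpha> \<mu> x
    by (rule sum_box_part_eq_integral[OF that(1) Ii n that(2,3)])
  show ?thesis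
  proof (intro iffI ballI)
    fix \<alpha> assume f: "box_convex d I n f" and \<alpha>: "\<alpha> \<in> Pi\<^sub>E {1..d} I"
    obtain \<mu> where \<mu>: "locally_finite_borel_measure d I \<mu>" and
      rat: "\<And>S. nodes d I n S \<Longrightarrow> (\<And>i. i \<in> {1..d} \<Longrightarrow> S i \<subseteq> \<rat>) \<Longrightarrow>
       mdd {1..d} S f = (\<integral>u. (\<Prod>j\<in>{1..d}. dd (S j) (trunc_pow (n j) 0 (u j))) \<partial>\<mu>)"
      using box_convex_imp_measure[OF assms(1) I n f \<alpha>] by blast
    \<comment> \<open>Box-convexity of the integral gives it the continuity in each variable that is
      needed, along with that of \<open>f\<close>, to pass from rational nodes to all nodes.\<close>
    have g: "box_convex d I n (?g \<alpha> \<mu>)" using g_nonneg[OF \<mu> \<alpha>] box_convex_iff by blast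
    have "mdd {1..d} S f = mdd {1..d} S (?g \<alpha> \<mu>)" if "nodes d I n S" for S
      by (rule mdd_eq_of_rational[OF _ n f g _ that]) (use I rat mdd_integral_kern[OF \<mu> Ii n \<alpha>] in auto)
    then have "pseudo_polynomial d I (\<lambda>i. n i - 1) (\<lambda>x. f x - ?g \<alpha> \<mu> x)"
    proof (intro pseudo_polynomial_of_mdd_0 n1)
      fix i assume i: "i \<in> {1..d}"
      have "I i \<noteq> {}" using PiE_mem[OF \<alpha> i] by blast
      then show "infinite (I i)" using I[OF i] finite_imp_not_open by blast
    qed (simp_all add: mdd_diff)
    then show "\<exists>W \<mu>. pseudo_polynomial d I (\<lambda>i. n i - 1) W \<and> locally_finite_borel_measure d I \<mu> \<and>
         (\<forall>x\<in>Pi\<^sub>E {1..d} I.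
            f x = W x + (\<Sum>A\<in>Pow {1..d}.
              (LINT u : box_part d I A \<alpha> | \<mu>.
                 (\<Prod>j\<in>{1..d} - A. pos_part (x j - u j) ^ (n j - 1) / fact (n j - 1)) *
                 (\<Prod>j\<in>A. (- 1) ^ n j * (neg_part (x j - u j) ^ (n j - 1) / fact (n j - 1))))))"
      using \<mu> by (intro exI[of _ "\<lambda>x. f x - ?g \<alpha> \<mu> x"] exI[of _ \<mu>] conjI ballI)
        (assumption | simp only: sum_eq[OF \<mu> \<alpha>] diff_add_cancel)+
  next
    assume rep: "\<forall>\<alpha>\<in>Pi\<^sub>E {1..d} I. \<exists>W \<mu>. pseudo_polynomial d I (\<lambda>i. n i - 1) W \<and> locally_finite_borel_measure d I \<mu> \<and>
         (\<forall>x\<in>Pi\<^sub>E {1..d} I.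
            f x = W x + (\<Sum>A\<in>Pow {1..d}.
              (LINT u : box_part d I A \<alpha> | \<mu>.
                 (\<Prod>j\<in>{1..d} - A. pos_part (x j - u j) ^ (n j - 1) / fact (n j - 1)) *
                 (\<Prod>j\<in>A. (- 1) ^ n j * (neg_part (x j - u j) ^ (n j - 1) / fact (n j - 1))))))"
    show "box_convex d I n f" unfolding box_convex_iff
    proof (intro allI impI)
      fix S assume S: "nodes d I n S"
      then have SI: "Pi\<^sub>E {1..d} S \<subseteq> Pi\<^sub>E {1..d} I" by (intro PiE_mono) (auto simp: nodes_def)
      \<comment> \<open>Any point of the node grid serves as the base point
        \<open>\<alpha>\<close>.\<close>
      have "\<forall>i\<in>{1..d}. S i \<noteq> {}" using S by (auto simp: nodes_def)
      then obtain \<alpha> where \<alpha>: "\<alpha> \<in> Pi\<^sub>E {1..d} I" using SI PiE_eq_empty_iff[of "{1..d}" S] by blast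
      obtain W \<mu> where W: "pseudo_polynomial d I (\<lambda>i. n i - 1) W" and \<mu>: "locally_finite_borel_measure d I \<mu>"
        and fW: "\<forall>x\<in>Pi\<^sub>E {1..d} I.
            f x = W x + (\<Sum>A\<in>Pow {1..d}.
              (LINT u : box_part d I A \<alpha> | \<mu>.
                 (\<Prod>j\<in>{1..d} - A. pos_part (x j - u j) ^ (n j - 1) / fact (n j - 1)) *
                 (\<Prod>j\<in>A. (- 1) ^ n j * (neg_part (x j - u j) ^ (n j - 1) / fact (n j - 1)))))"
        using bspec[OF rep \<alpha>] by blast
      have fx: "f x = W x + ?g \<alpha> \<mu> x" if "x \<in> Pi\<^sub>E {1..d} I" for x
        using bspec[OF fW that] unfolding sum_eq[OF \<mu> \<alpha> that] .
      have "mdd {1..d} S f = mdd {1..d} S (\<lambda>x. W x + ?g \<alpha> \<mu> x)"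
        using SI fx by (intro mdd_cong) auto
      also have "\<dots> = mdd {1..d} S (?g \<alpha> \<mu>)"
        by (simp only: mdd_add mdd_pseudo_polynomial[OF W S n1] add_0_left)
      finally show "mdd {1..d} S f \<ge> 0" using g_nonneg[OF \<mu> \<alpha> S] by simp
    qed
  qed
qed

end
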